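(* Let $\gamma_+:(\mathbb R,0)\to\mathbb R^2$ be a cooriented frontal germ with Legendre data $(\ell,\theta)$, i.e. $\gamma_+'(t)=\ell(t)\mathbf e(t)$ with $\mathbf e(t)=(\cos\theta(t),\sin\theta(t))$, and let $\gamma_-$ be an angularly regular cooriented frontal germ parametrised by tangent angle $u$ near $\theta(0)$, with $\gamma_-'(\theta(t))=-\rho_-(\theta(t))\mathbf e(t)$ (derivative with respect to $u$). Put $\Delta_\gamma(t)=\gamma_+(t)-\gamma_-(\theta(t))$, $\rho_{-,0}=\rho_-(\theta(0))$, and assume $\Delta_\gamma(0)\neq0$ and $\det(\Delta_\gamma(0),\mathbf e(0))\neq0$. Let $\mathrm E_{1/2}(t)=\frac12(\gamma_+(t)+\gamma_-(\theta(t)))$ be the Wigner caustic, $S(t)=\gamma_-(\theta(t))+\Lambda(t)\Delta_\gamma(t)$ with $\Lambda=\dfrac{\rho_-(\theta)\theta'}{\ell+\rho_-(\theta)\theta'}$ the finite centre symmetry set, and $\widetilde S(t)=[\rho_-(\theta(t))\theta'(t)\gamma_+(t)+\ell(t)\gamma_-(\theta(t)):\ell(t)+\rho_-(\theta(t))\theta'(t)]\in\mathbb{RP}^2$ the projective centre symmetry set. Assume that $\gamma_+$ is a $5/2$-cusp at $0$. Then: (i) If $\ell'(0)-\rho_{-,0}\theta''(0)\ne0$, the Wigner caustic is a $5/2$-cusp at $0$. If $\ell'(0)-\rho_{-,0}\theta''(0)=0$, it is a $5/3$-cusp at $0$. (ii) Suppose $\rho_{-,0}\ne0$ and $\ell'(0)+\rho_{-,0}\theta''(0)\ne0$.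 Then the centre symmetry set extends smoothly across $t=0$ and is regular there. More precisely, $\Lambda$ extends smoothly with $$\Lambda(0)=\frac{\rho_{-,0}\theta''(0)}{\ell'(0)+\rho_{-,0}\theta''(0)},\qquad \Lambda'(0)=\frac{\rho_{-,0}\bigl(\ell'(0)\theta'''(0)-\ell''(0)\theta''(0)\bigr)}{2\bigl(\ell'(0)+\rho_{-,0}\theta''(0)\bigr)^2}\ne0 .$$ (iii) Suppose $\rho_{-,0}\ne0$ and $\ell'(0)+\rho_{-,0}\theta''(0)=0$. Then the projective centre symmetry set tends to $[\Delta_\gamma(0):0]$ as $t\to0$; thus the affine branch goes to infinity in the chord direction. If $\theta''(0)\neq0$, call the value of $\rho_{-,0}$ producing the exceptional Wigner case in (i) the Wigner-resonant signed radius $\rho_{-,0}^{\,\mathrm E_{1/2}}$, and the value producing the projective degeneration in (iii) the CSS-resonant signed radius $\rho_{-,0}^{\,\mathrm{CSS}}$. These are opposite: $$\rho_{-,0}^{\,\mathrm E_{1/2}}=\frac{\ell'(0)}{\theta''(0)},\qquad \rho_{-,0}^{\,\mathrm{CSS}}=-\frac{\ell'(0)}{\theta''(0)} .$$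
   Context: All data are $C^\infty$. A smooth germ $\gamma:(\mathbb R,0)\to\mathbb R^2$ is a cooriented frontal if it has a smooth unit normal field $\mathbf n$ with $\gamma'\cdot\mathbf n=0$; with the unit tangent field $\mathbf e$ chosen so that $(\mathbf e,\mathbf n)$ is positively oriented, locally $\gamma'=\ell\mathbf e$, $\mathbf e=(\cos\theta,\sin\theta)$ with smooth $\ell,\theta$ (Legendre data). It is angularly regular if $\theta'\ne0$. The germ $\gamma_-$ is parametrised by its tangent angle, with its tangent lift $\mathbf e_-$ chosen so that $\mathbf e_-(\theta(t))=-\mathbf e(t)$; equivalently $\gamma_-'(u)=-\rho_-(u)(\cos u,\sin u)$ for $u$ near $\theta(0)$, where $\rho_-$ is smooth (its extended signed radius of curvature, possibly vanishing). The parallel pairs are $(\gamma_+(t),\gamma_-(\theta(t)))$. The centre symmetry set is the envelope of the chord lines $\gamma_-(\theta(t))+\lambda\Delta_\gamma(t)$, given by $S$ where the denominator of $\Lambda$ is nonzero and by smooth extension elsewhere when possible. Points of $\mathbb{RP}^2$ are written $[x:w]$, $x\in\mathbb R^2$, $w\in\mathbb R$; $\widetilde S$ is evaluated at $t=0$ after cancelling common factors of $t$. A $5/2$-cusp (resp. $5/3$-cusp) is a germ that becomes $t\mapsto(t^2,t^5)$ (resp. $t\mapsto(t^3,t^5)$) after smooth diffeomorphism germs in source and target. *)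

theory Defs
  imports "HOL-Analysis.Analysis"
begin

subsection \<open>Smooth germs and diffeomorphism germs\<close>

primrec Ck_on :: "nat \<Rightarrow> 'a::euclidean_space set \<Rightarrow> ('a \<Rightarrow> 'b::euclidean_space) \<Rightarrow> bool" where
  "Ck_on 0 U f \<longleftrightarrow> continuous_on U f"
| "Ck_on (Suc k) U f \<longleftrightarrow>
     (\<forall>x\<in>U. f differentiable (at x)) \<and> (\<forall>v. Ck_on k U (\<lambda>x. frechet_derivative f (at x) v))"

definition smooth_on :: "'a::euclidean_space set \<Rightarrow> ('a \<Rightarrow> 'b::euclidean_space) \<Rightarrow> bool" where
  "smooth_on U f \<longleftrightarrow> (\<forall>k. Ck_on k U f)"

text \<open>A germ at \<open>a\<close> is represented by a total function; only its values near \<open>a\<close> are constrained.\<close>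

definition smooth_germ :: "('a::euclidean_space \<Rightarrow> 'b::euclidean_space) \<Rightarrow> 'a \<Rightarrow> bool" where
  "smooth_germ f a \<longleftrightarrow> (\<exists>U. open U \<and> a \<in> U \<and> smooth_on U f)"

definition diffeo_germ :: "('a::euclidean_space \<Rightarrow> 'a) \<Rightarrow> 'a \<Rightarrow> 'a \<Rightarrow> bool" where
  "diffeo_germ f a b \<longleftrightarrow> f a = b \<and>
     (\<exists>U V g. open U \<and> a \<in> U \<and> open V \<and> b \<in> V \<and> f ` U = V \<and> g ` V = U \<and>
        (\<forall>x\<in>U. g (f x) = x) \<and> (\<forall>y\<in>V. f (g y) = y) \<and> smooth_on U f \<and> smooth_on V g)"

subsection \<open>Cusps\<close>

definition curve_germs_equivalent :: "(real \<Rightarrow> real^2) \<Rightarrow> (real \<Rightarrow> real^2) \<Rightarrow> bool" where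
  "curve_germs_equivalent f g \<longleftrightarrow>
     (\<exists>\<phi> \<Psi>. diffeo_germ \<phi> 0 0 \<and> diffeo_germ \<Psi> (f 0) (g 0) \<and>
        (\<forall>\<^sub>F t in nhds 0. \<Psi> (f (\<phi> t)) = g t))"

definition cusp_5_2 :: "(real \<Rightarrow> real^2) \<Rightarrow> bool" where
  "cusp_5_2 f \<longleftrightarrow> curve_germs_equivalent f (\<lambda>t. vector [t ^ 2, t ^ 5])"

definition cusp_5_3 :: "(real \<Rightarrow> real^2) \<Rightarrow> bool" where
  "cusp_5_3 f \<longleftrightarrow> curve_germs_equivalent f (\<lambda>t. vector [t ^ 3, t ^ 5])"

subsection \<open>Cooriented frontal germs and Legendre data\<close>

definition cooriented_frontal :: "(real \<Rightarrow> real^2) \<Rightarrow> (real \<Rightarrow> real^2) \<Rightarrow> real \<Rightarrow> bool" where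
  "cooriented_frontal \<gamma> n a \<longleftrightarrow> smooth_germ \<gamma> a \<and> smooth_germ n a \<and>
     (\<forall>\<^sub>F t in nhds a. norm (n t) = 1 \<and> vector_derivative \<gamma> (at t) \<bullet> n t = 0)"

definition unit_vec :: "real \<Rightarrow> real^2" where
  "unit_vec u = vector [cos u, sin u]"

text \<open>The unit tangent is \<open>unit_vec (\<theta> t)\<close>; the equation for \<open>n\<close> says that (tangent, normal) is
  a positively oriented orthonormal frame.\<close>

definition legendre_data ::
    "(real \<Rightarrow> real^2) \<Rightarrow> (real \<Rightarrow> real^2) \<Rightarrow> (real \<Rightarrow> real) \<Rightarrow> (real \<Rightarrow> real) \<Rightarrow> real \<Rightarrow> bool" where
  "legendre_data \<gamma> n l \<theta> a \<longleftrightarrow> cooriented_frontal \<gamma> n a \<and> smooth_germ l a \<and> smooth_germ \<theta> a \<and>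
     (\<forall>\<^sub>F t in nhds a. n t = vector [- sin (\<theta> t), cos (\<theta> t)] \<and>
        (\<gamma> has_vector_derivative l t *\<^sub>R unit_vec (\<theta> t)) (at t))"

definition angularly_regular :: "(real \<Rightarrow> real) \<Rightarrow> real \<Rightarrow> bool" where
  "angularly_regular \<theta> a \<longleftrightarrow> (\<forall>\<^sub>F t in nhds a. deriv \<theta> t \<noteq> 0)"

text \<open>The germ is parametrised by the angle \<open>u\<close> with tangent lift \<open>- unit_vec u = unit_vec (u + pi)\<close>,
  so its Legendre angle is \<open>u + pi\<close> and its derivative is \<open>- \<rho> u *\<^sub>R unit_vec u\<close>.\<close>

definition opposite_tangent_angle_param ::
    "(real \<Rightarrow> real^2) \<Rightarrow> (real \<Rightarrow> real^2) \<Rightarrow> (real \<Rightarrow> real) \<Rightarrow> real \<Rightarrow> bool" where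
  "opposite_tangent_angle_param \<gamma> n \<rho> a \<longleftrightarrow>
     legendre_data \<gamma> n \<rho> (\<lambda>u. u + pi) a \<and> angularly_regular (\<lambda>u. u + pi) a"

subsection \<open>The real projective plane\<close>

quotient_type rp2 = "(real^2) \<times> real" / partial: "\<lambda>p q. p \<noteq> 0 \<and> (\<exists>c. c \<noteq> 0 \<and> q = c *\<^sub>R p)"
proof (rule part_equivpI)
  show "\<exists>p::(real^2) \<times> real. p \<noteq> 0 \<and> (\<exists>c. c \<noteq> 0 \<and> p = c *\<^sub>R p)"
  proof (intro exI conjI)
    show "(0, 1) \<noteq> (0::(real^2) \<times> real)" by (simp add: zero_prod_def)
    show "(1::real) \<noteq> 0" by simp
    show "(0, 1) = (1::real) *\<^sub>R (0, 1 :: real)" by simp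
  qed
  show "symp (\<lambda>p q::(real^2) \<times> real. p \<noteq> 0 \<and> (\<exists>c. c \<noteq> 0 \<and> q = c *\<^sub>R p))"
  proof (rule sympI)
    fix p q :: "(real^2) \<times> real"
    assume "p \<noteq> 0 \<and> (\<exists>c. c \<noteq> 0 \<and> q = c *\<^sub>R p)"
    then obtain c where "p \<noteq> 0" "c \<noteq> 0" "q = c *\<^sub>R p" by blast
    then show "q \<noteq> 0 \<and> (\<exists>c. c \<noteq> 0 \<and> p = c *\<^sub>R q)"
      by (intro conjI exI[of _ "inverse c"]) simp_all
  qed
  show "transp (\<lambda>p q::(real^2) \<times> real. p \<noteq> 0 \<and> (\<exists>c. c \<noteq> 0 \<and> q = c *\<^sub>R p))"
  proof (rule transpI)
    fix p q r :: "(real^2) \<times> real"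
    assume "p \<noteq> 0 \<and> (\<exists>c. c \<noteq> 0 \<and> q = c *\<^sub>R p)" "q \<noteq> 0 \<and> (\<exists>c. c \<noteq> 0 \<and> r = c *\<^sub>R q)"
    then obtain c d where "p \<noteq> 0" "c \<noteq> 0" "d \<noteq> 0" "r = (d * c) *\<^sub>R p"
      by (elim conjE exE) simp
    then show "p \<noteq> 0 \<and> (\<exists>c. c \<noteq> 0 \<and> r = c *\<^sub>R p)"
      by (intro conjI exI[of _ "d * c"]) simp_all
  qed
qed

text \<open>Homogeneous coordinates \<open>[x : w]\<close>; meaningful only for \<open>(x, w) \<noteq> 0\<close>.\<close>

definition proj_point :: "real^2 \<Rightarrow> real \<Rightarrow> rp2" where
  "proj_point x w = abs_rp2 (x, w)"

text \<open>Quotient topology: \<open>- {0}\<close> is open, so its relatively open subsets are its open subsets.\<close>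

instantiation rp2 :: topological_space
begin

definition open_rp2 :: "rp2 set \<Rightarrow> bool" where
  "open_rp2 A \<longleftrightarrow> open {p. p \<noteq> 0 \<and> abs_rp2 p \<in> A}"

instance
proof
  have "{p::(real^2) \<times> real. p \<noteq> 0 \<and> abs_rp2 p \<in> UNIV} = - {0}" by auto
  then show "open (UNIV :: rp2 set)"
    unfolding open_rp2_def by (simp add: open_Compl)
next
  fix A B :: "rp2 set"
  assume "open A" "open B"
  moreover have "{p. p \<noteq> 0 \<and> abs_rp2 p \<in> A \<inter> B} =
      {p. p \<noteq> 0 \<and> abs_rp2 p \<in> A} \<inter> {p. p \<noteq> 0 \<and> abs_rp2 p \<in> B}" by auto
  ultimately show "open (A \<inter> B)"
    unfolding open_rp2_def by (simp only: open_Int)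
next
  fix K :: "rp2 set set"
  assume K: "\<forall>A\<in>K. open A"
  have "{p. p \<noteq> 0 \<and> abs_rp2 p \<in> \<Union>K} = (\<Union>A\<in>K. {p. p \<noteq> 0 \<and> abs_rp2 p \<in> A})" by auto
  moreover have "open (\<Union>A\<in>K. {p. p \<noteq> 0 \<and> abs_rp2 p \<in> A})"
    using K unfolding open_rp2_def by (intro open_UN)
  ultimately show "open (\<Union>K)"
    unfolding open_rp2_def by (simp only:)
qed

end

subsection \<open>Wigner caustic and centre symmetry set\<close>

text \<open>The parallel pairs are \<open>(\<gamma>p t, \<gamma>m (\<theta> t))\<close>.\<close>

definition chord :: "(real \<Rightarrow> real^2) \<Rightarrow> (real \<Rightarrow> real^2) \<Rightarrow> (real \<Rightarrow> real) \<Rightarrow> real \<Rightarrow> real^2" where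
  "chord \<gamma>p \<gamma>m \<theta> t = \<gamma>p t - \<gamma>m (\<theta> t)"

definition wigner_caustic ::
    "(real \<Rightarrow> real^2) \<Rightarrow> (real \<Rightarrow> real^2) \<Rightarrow> (real \<Rightarrow> real) \<Rightarrow> real \<Rightarrow> real^2" where
  "wigner_caustic \<gamma>p \<gamma>m \<theta> t = (1/2) *\<^sub>R (\<gamma>p t + \<gamma>m (\<theta> t))"

definition css_denom :: "(real \<Rightarrow> real) \<Rightarrow> (real \<Rightarrow> real) \<Rightarrow> (real \<Rightarrow> real) \<Rightarrow> real \<Rightarrow> real" where
  "css_denom l \<theta> \<rho>m t = l t + \<rho>m (\<theta> t) * deriv \<theta> t"

definition css_ratio :: "(real \<Rightarrow> real) \<Rightarrow> (real \<Rightarrow> real) \<Rightarrow> (real \<Rightarrow> real) \<Rightarrow> real \<Rightarrow> real" where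
  "css_ratio l \<theta> \<rho>m t = \<rho>m (\<theta> t) * deriv \<theta> t / css_denom l \<theta> \<rho>m t"

definition css ::
    "(real \<Rightarrow> real^2) \<Rightarrow> (real \<Rightarrow> real^2) \<Rightarrow> (real \<Rightarrow> real) \<Rightarrow> (real \<Rightarrow> real) \<Rightarrow> (real \<Rightarrow> real)
      \<Rightarrow> real \<Rightarrow> real^2" where
  "css \<gamma>p \<gamma>m l \<theta> \<rho>m t = \<gamma>m (\<theta> t) + css_ratio l \<theta> \<rho>m t *\<^sub>R chord \<gamma>p \<gamma>m \<theta> t"

text \<open>At a common zero of \<open>l\<close> and \<open>deriv \<theta>\<close> both homogeneous coordinates vanish; there the
  projective centre symmetry set has to be read as the limit along nearby parameters. Likewise
  \<open>css\<close> is meaningful only where \<open>css_denom\<close> is nonzero.\<close>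

definition projective_css ::
    "(real \<Rightarrow> real^2) \<Rightarrow> (real \<Rightarrow> real^2) \<Rightarrow> (real \<Rightarrow> real) \<Rightarrow> (real \<Rightarrow> real) \<Rightarrow> (real \<Rightarrow> real)
      \<Rightarrow> real \<Rightarrow> rp2" where
  "projective_css \<gamma>p \<gamma>m l \<theta> \<rho>m t =
     proj_point ((\<rho>m (\<theta> t) * deriv \<theta> t) *\<^sub>R \<gamma>p t + l t *\<^sub>R \<gamma>m (\<theta> t)) (css_denom l \<theta> \<rho>m t)"

text \<open>\<open>F\<close> is a smooth extension across \<open>0\<close> of the function \<open>f\<close> given near, but not at, \<open>0\<close>.\<close>

definition smooth_extension_at_0 :: "(real \<Rightarrow> 'b::euclidean_space) \<Rightarrow> (real \<Rightarrow> 'b) \<Rightarrow> bool" where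
  "smooth_extension_at_0 f F \<longleftrightarrow> smooth_germ F 0 \<and> (\<forall>\<^sub>F t in at 0. F t = f t)"

text \<open>Here \<open>r\<close> stands for the value \<open>\<rho>m (\<theta> 0)\<close>.\<close>

definition wigner_exceptional :: "(real \<Rightarrow> real) \<Rightarrow> (real \<Rightarrow> real) \<Rightarrow> real \<Rightarrow> bool" where
  "wigner_exceptional l \<theta> r \<longleftrightarrow> deriv l 0 - r * (deriv ^^ 2) \<theta> 0 = 0"

definition css_degenerate :: "(real \<Rightarrow> real) \<Rightarrow> (real \<Rightarrow> real) \<Rightarrow> real \<Rightarrow> bool" where
  "css_degenerate l \<theta> r \<longleftrightarrow> r \<noteq> 0 \<and> deriv l 0 + r * (deriv ^^ 2) \<theta> 0 = 0"

definition wigner_resonant_radius :: "(real \<Rightarrow> real) \<Rightarrow> (real \<Rightarrow> real) \<Rightarrow> real" where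
  "wigner_resonant_radius l \<theta> = (THE r. wigner_exceptional l \<theta> r)"

definition css_resonant_radius :: "(real \<Rightarrow> real) \<Rightarrow> (real \<Rightarrow> real) \<Rightarrow> real" where
  "css_resonant_radius l \<theta> = (THE r. css_degenerate l \<theta> r)"

end

theory Submission
  imports Defs
begin

text \<open>
  Everything is read off Taylor coefficients at the singular point. For a frontal
  \<open>\<gamma>' = l *\<^sub>R unit_vec \<theta>\<close>, being a 5/2-cusp means \<open>l = 0\<close>, \<open>l' \<noteq> 0\<close>, \<open>\<theta>' = 0\<close> and
  \<open>l' \<theta>''' - l'' \<theta>'' \<noteq> 0\<close> at \<open>0\<close>; the Wigner caustic has speed \<open>(l - \<rho>m (\<theta>) \<theta>') / 2\<close> and the same
  angle, and this substitution only halves the last expression. If the new speed vanishes to second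
  order, that expression forces its second derivative and \<open>\<theta>''\<close> to be nonzero, which makes the curve
  a 5/3-cusp. The statements on the centre symmetry set follow by cancelling a factor \<open>t\<close> from \<open>l\<close>
  and \<open>\<rho>m (\<theta>) \<theta>'\<close>.

  That finitely many coefficients decide the type of a cusp is seen as follows. A polynomial change of
  parameter removes the exponents missing from the semigroup generated by \<open>p\<close> and \<open>5\<close>
  (\<open>p = 2, 3\<close>). Any smooth function whose Taylor series avoids those gaps is a smooth function of
  \<open>(t ^ p, t ^ 5)\<close>: by Borel's lemma there is such a function with the right Taylor series, and a flat
  remainder is a smooth function of \<open>t ^ 5\<close> alone. Hence the curve is the image of
  \<open>(t ^ p, t ^ 5)\<close> under a local diffeomorphism.
\<close>

subsection \<open>Calculus of smooth functions\<close>

text \<open>The number l' \<theta>''' - l'' \<theta>'' at 0 is 2 l'^2 times the derivative of the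
  curvature \<theta>' / l, which extends smoothly across the cusp. This is why it governs all the
  curves. Let b = \<rho>m(\<theta>) \<theta>' and r = \<rho>m(\<theta>(0)). As \<theta>'(0) = 0, the
  functions b and r \<theta>' have the same derivatives at 0 up to order 2. Hence passing from l to
  l - b subtracts r times (\<theta>'', \<theta>''') from (l', l''), which a determinant with rows
  (l', l'') and (\<theta>'', \<theta>''') does not notice; and the ratio b / (l + b) is a Moebius
  function of b / l, whose derivative at 0 is r times that of the curvature. The obstacle is that a
  cusp is defined by an equivalence and not by its coefficients. To read coefficients off a given
  equivalence, the curve is written as a diffeomorphism applied to the model; its velocity and the
  derivative of its direction field then share one scalar factor with a simple zero. To build an
  equivalence, smoothness has to survive substituting the fifth root of y for t. It does so for flat
  functions only, whence the splitting into a part realised by Borel's lemma and a flat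
  part.\<close>

lemma Ck_on_continuous_on: "Ck_on k U f \<Longrightarrow> continuous_on U f"
  by (cases k) (auto intro!: continuous_at_imp_continuous_on differentiable_imp_continuous_within)

lemma Ck_on_SucD: "Ck_on (Suc k) U f \<Longrightarrow> Ck_on k U f"
proof (induction k arbitrary: f)
  case 0
  then show ?case using Ck_on_continuous_on by fastforce
next
  case (Suc k)
  then have "Ck_on k U (\<lambda>x. frechet_derivative f (at x) v)" for v by auto
  with Suc.prems show ?case by simp
qed

lemma Ck_on_subset: "Ck_on k U f \<Longrightarrow> V \<subseteq> U \<Longrightarrow> Ck_on k V f"
proof (induction k arbitrary: f)
  case 0
  then show ?case by (auto intro: continuous_on_subset)
next
  case (Suc k)
  then show ?case by (auto simp: subset_iff)
qed

lemma Ck_on_cong: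
  assumes "Ck_on k U f" "open U" "\<And>x. x \<in> U \<Longrightarrow> f x = g x"
  shows "Ck_on k U g"
  using assms(1,3)
proof (induction k arbitrary: f g)
  case 0
  then show ?case by (simp cong: continuous_on_cong)
next
  case (Suc k)
  have d: "(g has_derivative frechet_derivative f (at x)) (at x)" if "x \<in> U" for x
  proof (rule has_derivative_transform_within_open[OF _ assms(2) that])
    show "(f has_derivative frechet_derivative f (at x)) (at x)"
      using Suc.prems(1) that frechet_derivative_works by auto
  qed (simp add: Suc.prems(2))
  have "frechet_derivative g (at x) = frechet_derivative f (at x)" if "x \<in> U" for x
    using frechet_derivative_at[OF d[OF that]] by simp
  then have "Ck_on k U (\<lambda>x. frechet_derivative g (at x) v)" for v
    using Suc.IH[of "\<lambda>x. frechet_derivative f (at x) v" "\<lambda>x. frechet_derivative g (at x) v"] Suc.prems(1)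
    by simp
  with d show ?case by (auto simp: differentiable_def)
qed

lemma Ck_on_SucI:
  assumes "open U" "\<And>x. x \<in> U \<Longrightarrow> (f has_derivative f' x) (at x)"
    and "\<And>v. Ck_on k U (\<lambda>x. f' x v)"
  shows "Ck_on (Suc k) U f"
proof -
  have "Ck_on k U (\<lambda>x. frechet_derivative f (at x) v)" for v
    by (rule Ck_on_cong[OF assms(3)[of v] assms(1)])
       (simp add: frechet_derivative_at[OF assms(2), symmetric])
  with assms(2) show ?thesis by (auto simp: differentiable_def)
qed

lemma Ck_on_SucE:
  assumes "Ck_on (Suc k) U f" "x \<in> U"
  shows "(f has_derivative frechet_derivative f (at x)) (at x)"
  using assms frechet_derivative_works by auto

text \<open>A family of functions stable under directional differentiation is smooth by induction on
  the order. Only the shape of the first derivative has to be recognised; formulas for the higher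
  ones are not computed.\<close>

lemma smooth_on_coinduct:
  assumes "P f" "open U"
    and step: "\<And>f. P f \<Longrightarrow>
      \<exists>f'. (\<forall>x\<in>U. (f has_derivative f' x) (at x)) \<and> (\<forall>v. P (\<lambda>x. f' x v))"
  shows "smooth_on U f"
proof -
  have "Ck_on k U f" if "P f" for k f
    using that
  proof (induction k arbitrary: f)
    case 0
    from step[OF this] obtain f' where "\<forall>x\<in>U. (f has_derivative f' x) (at x)" by blast
    then have "\<forall>x\<in>U. isCont f x" by (blast intro: has_derivative_continuous)
    then show ?case by (simp add: continuous_at_imp_continuous_on)
  next
    case (Suc k)
    from step[OF Suc.prems] obtain f' where
      "\<forall>x\<in>U. (f has_derivative f' x) (at x)" "\<forall>v. P (\<lambda>x. f' x v)" by blast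
    with Suc.IH assms(2) show ?case by (intro Ck_on_SucI[of U f f']) auto
  qed
  with assms(1) show ?thesis by (simp add: smooth_on_def)
qed

lemma Ck_on_const: "Ck_on k U (\<lambda>x. c)"
  by (induction k arbitrary: c) auto

lemma smooth_on_const: "smooth_on U (\<lambda>x. c)"
  by (simp add: smooth_on_def Ck_on_const)

lemma Ck_on_bounded_linear:
  assumes "bounded_linear h" "open U"
  shows "Ck_on k U h"
proof (cases k)
  case 0
  then show ?thesis using assms(1) by (simp add: linear_continuous_on)
next
  case (Suc j)
  then show ?thesis
    using assms by (auto intro!: Ck_on_SucI[of _ _ "\<lambda>_. h"] Ck_on_const bounded_linear_imp_has_derivative
        simp del: Ck_on.simps)
qed

lemma Ck_on_linear_comp:
  assumes h: "bounded_linear h" and U: "open U"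
  shows "Ck_on k U f \<Longrightarrow> Ck_on k U (\<lambda>x. h (f x))"
proof (induction k arbitrary: f)
  case 0
  then show ?case using bounded_linear.continuous_on[OF h] by simp
next
  case (Suc k)
  have "Ck_on k U (\<lambda>x. frechet_derivative f (at x) v)" for v using Suc.prems by simp
  then show ?case
    by (intro Ck_on_SucI[of _ _ "\<lambda>x v. h (frechet_derivative f (at x) v)"] U Suc.IH
        bounded_linear.has_derivative[OF h] Ck_on_SucE[OF Suc.prems])
qed

lemma Ck_on_add:
  assumes "open U"
  shows "Ck_on k U f \<Longrightarrow> Ck_on k U g \<Longrightarrow> Ck_on k U (\<lambda>x. f x + g x)"
proof (induction k arbitrary: f g)
  case 0
  then show ?case by (auto intro: continuous_on_add)
next
  case (Suc k)
  have "Ck_on k U (\<lambda>x. frechet_derivative f (at x) v)" "Ck_on k U (\<lambda>x. frechet_derivative g (at x) v)" for v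
    using Suc.prems by simp_all
  then show ?case
    by (intro Ck_on_SucI[of _ _ "\<lambda>x v. frechet_derivative f (at x) v + frechet_derivative g (at x) v"]
        assms Suc.IH has_derivative_add Ck_on_SucE[OF Suc.prems(1)] Ck_on_SucE[OF Suc.prems(2)])
qed

lemma Ck_on_sum:
  assumes "open U" "\<And>i. i \<in> I \<Longrightarrow> Ck_on k U (f i)"
  shows "Ck_on k U (\<lambda>x. \<Sum>i\<in>I. f i x)"
  using assms(2) by (induction I rule: infinite_finite_induct) (auto intro!: Ck_on_const Ck_on_add assms(1))

lemma Ck_on_bounded_bilinear:
  assumes h: "bounded_bilinear h" and U: "open U"
  shows "Ck_on k U f \<Longrightarrow> Ck_on k U g \<Longrightarrow> Ck_on k U (\<lambda>x. h (f x) (g x))"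
proof (induction k arbitrary: f g)
  case 0
  then show ?case using bounded_bilinear.continuous_on[OF h] by simp
next
  case (Suc k)
  have d: "Ck_on k U (\<lambda>x. frechet_derivative f (at x) v)" "Ck_on k U (\<lambda>x. frechet_derivative g (at x) v)" for v
    using Suc.prems by simp_all
  show ?case
    by (intro Ck_on_SucI[of _ _ "\<lambda>x v. h (f x) (frechet_derivative g (at x) v) + h (frechet_derivative f (at x) v) (g x)"]
        U Ck_on_add Suc.IH d bounded_bilinear.FDERIV[OF h] Ck_on_SucE[OF Suc.prems(1)]
        Ck_on_SucE[OF Suc.prems(2)] Ck_on_SucD[OF Suc.prems(1)] Ck_on_SucD[OF Suc.prems(2)])
qed

lemma Ck_on_compose:
  assumes U: "open U" and V: "open V"
  shows "Ck_on k V f \<Longrightarrow> Ck_on k U g \<Longrightarrow> g ` U \<subseteq> V \<Longrightarrow> Ck_on k U (\<lambda>x. f (g x))"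
proof (induction k arbitrary: f)
  case 0
  then show ?case by (auto intro: continuous_on_compose2)
next
  case (Suc k)
  let ?f' = "\<lambda>x. frechet_derivative f (at x)" and ?g' = "\<lambda>x. frechet_derivative g (at x)"
  have g': "Ck_on k U (\<lambda>x. ?g' x v)" for v using Suc.prems by simp
  have f': "Ck_on k V (\<lambda>x. ?f' x v)" for v using Suc.prems by simp
  show ?case
  proof (rule Ck_on_SucI[OF U])
    fix x assume x: "x \<in> U"
    then have "g x \<in> V" using Suc.prems(3) by auto
    note df = Ck_on_SucE[OF Suc.prems(1) this] and dg = Ck_on_SucE[OF Suc.prems(2) x]
    \<comment> \<open>The induction hypothesis concerns the derivative of \<open>f\<close> in a
      fixed direction, whereas \<open>?g' x v\<close> moves with \<open>x\<close>. Expanding it in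
      the basis separates the two dependencies.\<close>
    have "?f' (g x) w = (\<Sum>b\<in>Basis. (w \<bullet> b) *\<^sub>R ?f' (g x) b)" for w
    proof -
      have "linear (?f' (g x))" using df has_derivative_linear by blast
      then have "?f' (g x) (\<Sum>b\<in>Basis. (w \<bullet> b) *\<^sub>R b) = (\<Sum>b\<in>Basis. (w \<bullet> b) *\<^sub>R ?f' (g x) b)"
        by (simp add: linear_sum linear_cmul)
      then show ?thesis by (simp add: euclidean_representation)
    qed
    then have "(\<lambda>v. ?f' (g x) (?g' x v)) = (\<lambda>v. \<Sum>b\<in>Basis. (?g' x v \<bullet> b) *\<^sub>R ?f' (g x) b)"
      by blast
    with has_derivative_compose[OF dg df]
    show "((\<lambda>x. f (g x)) has_derivative (\<lambda>v. \<Sum>b\<in>Basis. (?g' x v \<bullet> b) *\<^sub>R ?f' (g x) b)) (at x)"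
      by simp
  next
    fix v
    show "Ck_on k U (\<lambda>x. \<Sum>b\<in>Basis. (?g' x v \<bullet> b) *\<^sub>R ?f' (g x) b)"
      by (intro Ck_on_sum U Ck_on_bounded_bilinear[OF bounded_bilinear_scaleR]
          Ck_on_linear_comp[OF bounded_linear_inner_left] g' Suc.IH f' Ck_on_SucD[OF Suc.prems(2)] Suc.prems(3))
  qed
qed

section \<open>The same closure rules for smooth functions on open sets\<close>

lemma smooth_on_subset: "smooth_on U f \<Longrightarrow> V \<subseteq> U \<Longrightarrow> smooth_on V f"
  unfolding smooth_on_def using Ck_on_subset by blast

lemma smooth_on_cong: "smooth_on U f \<Longrightarrow> open U \<Longrightarrow> (\<And>x. x \<in> U \<Longrightarrow> f x = g x) \<Longrightarrow> smooth_on U g"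
  unfolding smooth_on_def using Ck_on_cong by blast

lemma smooth_on_continuous_on: "smooth_on U f \<Longrightarrow> continuous_on U f"
  unfolding smooth_on_def using Ck_on_continuous_on by blast

lemma smooth_on_has_derivative:
  "smooth_on U f \<Longrightarrow> x \<in> U \<Longrightarrow> (f has_derivative frechet_derivative f (at x)) (at x)"
  unfolding smooth_on_def using Ck_on_SucE by blast

lemma smooth_on_frechet_derivative: "smooth_on U f \<Longrightarrow> smooth_on U (\<lambda>x. frechet_derivative f (at x) v)"
  unfolding smooth_on_def
proof
  fix k assume "\<forall>k. Ck_on k U f"
  then have "Ck_on (Suc k) U f" by blast
  then show "Ck_on k U (\<lambda>x. frechet_derivative f (at x) v)" by simp
qed

lemma smooth_on_compose:
  "smooth_on V f \<Longrightarrow> smooth_on U g \<Longrightarrow> g ` U \<subseteq> V \<Longrightarrow> open U \<Longrightarrow> open V \<Longrightarrow> smooth_on U (\<lambda>x. f (g x))"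
  unfolding smooth_on_def using Ck_on_compose by blast

lemma smooth_on_bounded_bilinear:
  "bounded_bilinear h \<Longrightarrow> smooth_on U f \<Longrightarrow> smooth_on U g \<Longrightarrow> open U \<Longrightarrow> smooth_on U (\<lambda>x. h (f x) (g x))"
  unfolding smooth_on_def using Ck_on_bounded_bilinear by blast

lemma smooth_on_linear_comp:
  "bounded_linear h \<Longrightarrow> smooth_on U f \<Longrightarrow> open U \<Longrightarrow> smooth_on U (\<lambda>x. h (f x))"
  unfolding smooth_on_def using Ck_on_linear_comp by blast

lemma smooth_on_bounded_linear: "bounded_linear h \<Longrightarrow> open U \<Longrightarrow> smooth_on U h"
  unfolding smooth_on_def using Ck_on_bounded_linear by blast

lemma smooth_on_id: "open U \<Longrightarrow> smooth_on U (\<lambda>x. x)"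
  by (rule smooth_on_bounded_linear[OF bounded_linear_ident])

lemma smooth_on_add: "smooth_on U f \<Longrightarrow> smooth_on U g \<Longrightarrow> open U \<Longrightarrow> smooth_on U (\<lambda>x. f x + g x)"
  unfolding smooth_on_def using Ck_on_add by blast

lemma smooth_on_minus: "smooth_on U f \<Longrightarrow> open U \<Longrightarrow> smooth_on U (\<lambda>x. - f x)"
  by (rule smooth_on_linear_comp[OF bounded_linear_minus[OF bounded_linear_ident]])

lemma smooth_on_diff: "smooth_on U f \<Longrightarrow> smooth_on U g \<Longrightarrow> open U \<Longrightarrow> smooth_on U (\<lambda>x. f x - g x)"
  using smooth_on_add[of U f "\<lambda>x. - g x"] smooth_on_minus[of U g] by simp

lemma smooth_on_sum:
  "(\<And>i. i \<in> I \<Longrightarrow> smooth_on U (f i)) \<Longrightarrow> open U \<Longrightarrow> smooth_on U (\<lambda>x. \<Sum>i\<in>I. f i x)"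
  by (simp add: smooth_on_def Ck_on_sum)

lemmas smooth_on_scaleR = smooth_on_bounded_bilinear[OF bounded_bilinear_scaleR]

lemma smooth_on_mult:
  fixes f g :: "'a::euclidean_space \<Rightarrow> real"
  shows "smooth_on U f \<Longrightarrow> smooth_on U g \<Longrightarrow> open U \<Longrightarrow> smooth_on U (\<lambda>x. f x * g x)"
  using smooth_on_scaleR by fastforce

lemma smooth_on_power:
  fixes f :: "'a::euclidean_space \<Rightarrow> real"
  shows "smooth_on U f \<Longrightarrow> open U \<Longrightarrow> smooth_on U (\<lambda>x. f x ^ n)"
  by (induction n) (auto intro: smooth_on_const smooth_on_mult)

section \<open>Elementary functions, smooth because all their derivatives are known\<close>

lemma smooth_on_derivative_sequence:
  fixes D :: "nat \<Rightarrow> real \<Rightarrow> 'b::euclidean_space"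
  assumes "open U" "\<And>n x. x \<in> U \<Longrightarrow> (D n has_vector_derivative D (Suc n) x) (at x)"
  shows "smooth_on U (D n)"
\<comment> \<open>Differentiating in direction \<open>v\<close> multiplies the next member of the
  sequence by the number \<open>v\<close>, so the family has to contain scalar multiples.\<close>
proof (rule smooth_on_coinduct[where P = "\<lambda>f. \<exists>n c. f = (\<lambda>x. c *\<^sub>R D n x)"])
  show "\<exists>m c. D n = (\<lambda>x. c *\<^sub>R D m x)" by (rule exI[of _ n], rule exI[of _ 1]) simp
  fix f :: "real \<Rightarrow> 'b" assume "\<exists>n c. f = (\<lambda>x. c *\<^sub>R D n x)"
  then obtain n c where f: "f = (\<lambda>x. c *\<^sub>R D n x)" by blast
  show "\<exists>f'. (\<forall>x\<in>U. (f has_derivative f' x) (at x)) \<and> (\<forall>v. \<exists>n c. (\<lambda>x. f' x v) = (\<lambda>x. c *\<^sub>R D n x))"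
  proof (intro exI conjI ballI allI)
    fix x assume "x \<in> U"
    then show "(f has_derivative (\<lambda>v. (v * c) *\<^sub>R D (Suc n) x)) (at x)"
      using has_vector_derivative_scaleR[OF DERIV_const assms(2)[of x n], of c]
      unfolding f has_vector_derivative_def by simp
  qed (rule refl)
qed (fact assms(1))

lemma smooth_on_inverse_real: "smooth_on {x. x \<noteq> 0} (\<lambda>x::real. inverse x)"
proof -
  let ?D = "\<lambda>n x. (- 1) ^ n * fact n * inverse x ^ Suc n :: real"
  have "smooth_on (- {0}) (?D 0)"
  proof (rule smooth_on_derivative_sequence[of _ ?D])
    fix n and x :: real assume "x \<in> - {0}"
    then have "((\<lambda>x. (- 1) ^ n * fact n * inverse x ^ Suc n) has_real_derivative
        (- 1) ^ n * fact n * ((1 + real n) * (- (inverse x ^ Suc (Suc 0)) * inverse x ^ n))) (at x)"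
      by (intro DERIV_cmult DERIV_power_Suc DERIV_inverse) simp
    then show "((\<lambda>x. (- 1) ^ n * fact n * inverse x ^ Suc n) has_vector_derivative
        (- 1) ^ Suc n * fact (Suc n) * inverse x ^ Suc (Suc n)) (at x)"
      unfolding has_real_derivative_iff_has_vector_derivative[symmetric] by (simp add: ac_simps)
  qed auto
  then show ?thesis by (simp add: Compl_eq)
qed

text \<open>Each differentiation of cosine shifts the argument by a quarter turn, so one formula
  covers all orders; the free shift \<open>a\<close> yields sine as well.\<close>

lemma smooth_on_cos_add: "smooth_on UNIV (\<lambda>x::real. cos (x + a))"
proof -
  let ?D = "\<lambda>n x. cos (x + a + real n * pi / 2)"
  have "smooth_on UNIV (?D 0)"
  proof (rule smooth_on_derivative_sequence[of _ ?D])
    fix n and x :: real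
    have "cos (x + a + real (Suc n) * pi / 2) = - sin (x + a + real n * pi / 2)"
      using cos_add[of "x + a + real n * pi / 2" "pi / 2"] by (simp add: field_simps)
    then show "((\<lambda>x. cos (x + a + real n * pi / 2)) has_vector_derivative
        cos (x + a + real (Suc n) * pi / 2)) (at x)"
      unfolding has_real_derivative_iff_has_vector_derivative[symmetric]
      by (auto intro!: derivative_eq_intros)
  qed auto
  then show ?thesis by simp
qed

lemma smooth_on_cos: "smooth_on UNIV (cos :: real \<Rightarrow> real)"
  using smooth_on_cos_add[of 0] by simp

lemma smooth_on_sin: "smooth_on UNIV (sin :: real \<Rightarrow> real)"
  using smooth_on_cos_add[of "- (pi / 2)"] by (simp add: cos_sin_eq)

subsection \<open>Taylor expansion with smooth remainder\<close>

lemma smooth_on_has_vector_derivative: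
  fixes f :: "real \<Rightarrow> 'b::euclidean_space"
  assumes "smooth_on U f" "t \<in> U"
  shows "(f has_vector_derivative vector_derivative f (at t)) (at t)"
  using smooth_on_has_derivative[OF assms] differentiable_def vector_derivative_works by blast

lemma smooth_on_vector_derivative:
  fixes f :: "real \<Rightarrow> 'b::euclidean_space"
  assumes "smooth_on U f" "open U"
  shows "smooth_on U (\<lambda>t. vector_derivative f (at t))"
proof (rule smooth_on_cong[OF smooth_on_frechet_derivative[OF assms(1)] assms(2)])
  fix t assume t: "t \<in> U"
  have "frechet_derivative f (at t) = (\<lambda>h. h *\<^sub>R vector_derivative f (at t))"
    using smooth_on_has_vector_derivative[OF assms(1) t] frechet_derivative_at
    unfolding has_vector_derivative_def by metis
  then show "frechet_derivative f (at t) 1 = vector_derivative f (at t)" by simp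
qed

lemma smooth_on_derivative_sequenceE:
  fixes f :: "real \<Rightarrow> 'b::euclidean_space"
  assumes "smooth_on U f" "open U"
  obtains D where "D 0 = f" "\<And>n t. t \<in> U \<Longrightarrow> (D n has_vector_derivative D (Suc n) t) (at t)"
proof
  let ?D = "\<lambda>n. ((\<lambda>g t. vector_derivative g (at t)) ^^ n) f"
  show "?D 0 = f" by simp
  have s: "smooth_on U (?D n)" for n
    by (induction n) (auto intro: assms smooth_on_vector_derivative)
  show "(?D n has_vector_derivative ?D (Suc n) t) (at t)" if "t \<in> U" for n t
    using smooth_on_has_vector_derivative[OF s that] by simp
qed

lemma has_vector_derivative_rescale:
  fixes f :: "real \<Rightarrow> 'b::real_normed_vector"
  assumes "(f has_vector_derivative f') (at (s * t))"
  shows "((\<lambda>t. f (s * t)) has_vector_derivative s *\<^sub>R f') (at t)"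
proof -
  have "((\<lambda>t. s * t) has_vector_derivative s) (at t)"
    unfolding has_real_derivative_iff_has_vector_derivative[symmetric]
    using DERIV_cmult_Id by (simp add: mult.commute)
  from vector_diff_chain_at[OF this assms] show ?thesis by (simp add: o_def)
qed

text \<open>Differentiation under the integral sign produces one factor \<open>s\<close> by the
  chain rule. The derivative of order \<open>n\<close> is therefore the moment of order
  \<open>N + n\<close> of the corresponding derivative of \<open>R\<close>.\<close>

lemma smooth_on_moment:
  fixes R :: "real \<Rightarrow> 'b::euclidean_space"
  assumes "smooth_on (ball 0 e) R"
  shows "smooth_on (ball 0 e) (\<lambda>t. integral {0..1} (\<lambda>s. s ^ N *\<^sub>R R (s * t)))"
proof -
  obtain D where D0: "D 0 = R" and
    D: "\<And>n t. t \<in> ball 0 e \<Longrightarrow> (D n has_vector_derivative D (Suc n) t) (at t)"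
    using smooth_on_derivative_sequenceE[OF assms open_ball] by blast
  have st: "s * t \<in> ball 0 e" if "t \<in> ball 0 e" "s \<in> {0..1}" for s t :: real
  proof -
    have "\<bar>s\<bar> * \<bar>t\<bar> \<le> 1 * \<bar>t\<bar>" using that(2) by (intro mult_right_mono) auto
    then show ?thesis using that(1) by (simp add: abs_mult)
  qed
  have cD: "continuous_on (ball 0 e) (D n)" for n
    using D has_vector_derivative_continuous by (blast intro: continuous_at_imp_continuous_on)
  let ?G = "\<lambda>n t. integral {0..1} (\<lambda>s. s ^ (N + n) *\<^sub>R D n (s * t))"
  have "smooth_on (ball 0 e) (?G 0)"
  proof (rule smooth_on_derivative_sequence[of _ ?G])
    fix n t assume t: "t \<in> ball (0::real) e"
    have "((\<lambda>t. integral (cbox 0 1) (\<lambda>s. s ^ (N + n) *\<^sub>R D n (s * t))) has_vector_derivative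
        integral (cbox 0 1) (\<lambda>s. s ^ (N + Suc n) *\<^sub>R D (Suc n) (s * t))) (at t within ball 0 e)"
    proof (rule leibniz_rule_vector_derivative[where U = "ball 0 e" and a = 0 and b = "1::real"
          and f = "\<lambda>t s. s ^ (N + n) *\<^sub>R D n (s * t)" and fx = "\<lambda>t s. s ^ (N + Suc n) *\<^sub>R D (Suc n) (s * t)"])
      fix x s :: real assume x: "x \<in> ball 0 e" and s: "s \<in> cbox 0 1"
      have "((\<lambda>x. D n (s * x)) has_vector_derivative s *\<^sub>R D (Suc n) (s * x)) (at x)"
        using s by (intro has_vector_derivative_rescale D st[OF x]) auto
      then have "((\<lambda>x. s ^ (N + n) *\<^sub>R D n (s * x)) has_vector_derivative
          s ^ (N + n) *\<^sub>R s *\<^sub>R D (Suc n) (s * x)) (at x)"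
        by (rule bounded_linear.has_vector_derivative[OF bounded_linear_scaleR_right])
      then show "((\<lambda>x. s ^ (N + n) *\<^sub>R D n (s * x)) has_vector_derivative
          s ^ (N + Suc n) *\<^sub>R D (Suc n) (s * x)) (at x within ball 0 e)"
        by (simp add: mult.commute has_vector_derivative_at_within)
    next
      fix x :: real assume "x \<in> ball 0 e"
      then show "(\<lambda>s. s ^ (N + n) *\<^sub>R D n (s * x)) integrable_on cbox 0 1"
        using st by (intro integrable_continuous continuous_intros continuous_on_compose2[OF cD]) auto
    next
      show "continuous_on (ball 0 e \<times> cbox 0 1) (\<lambda>(t, s). s ^ (N + Suc n) *\<^sub>R D (Suc n) (s * t))"
        unfolding split_beta using st
        by (intro continuous_intros continuous_on_compose2[OF cD]) auto
    qed (use t in auto)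
    then show "(?G n has_vector_derivative ?G (Suc n) t) (at t)"
      using at_within_open[OF t open_ball] by simp
  qed simp
  then show ?thesis by (simp add: D0)
qed

text \<open>Integrating along the segment from 0 to \<open>t\<close>, parametrised by
  \<open>s * t\<close>, pulls out \<open>N\<close> powers of \<open>t\<close> from the integrand and
  one from the substitution. What remains is a moment of \<open>R\<close>, so smoothness at 0 needs
  no quotient.\<close>

lemma antiderivative_power_expansion:
  fixes h :: "real \<Rightarrow> 'b::euclidean_space"
  assumes R: "smooth_on (ball 0 e) R"
    and h: "\<And>t. t \<in> ball 0 e \<Longrightarrow> (h has_vector_derivative t ^ N *\<^sub>R R t) (at t)"
  shows "\<exists>g. smooth_on (ball 0 e) g \<and> (\<forall>t\<in>ball 0 e. h t = h 0 + t ^ Suc N *\<^sub>R g t)"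
proof (intro exI conjI ballI)
  show "smooth_on (ball 0 e) (\<lambda>t. integral {0..1} (\<lambda>s. s ^ N *\<^sub>R R (s * t)))"
    by (rule smooth_on_moment[OF R])
  fix t assume t: "t \<in> ball (0::real) e"
  have "((\<lambda>s. t *\<^sub>R (s * t) ^ N *\<^sub>R R (s * t)) has_integral h (1 * t) - h (0 * t)) {0..1}"
  proof (rule fundamental_theorem_of_calculus)
    fix s :: real assume s: "s \<in> {0..1}"
    have "\<bar>s\<bar> * \<bar>t\<bar> \<le> 1 * \<bar>t\<bar>" using s by (intro mult_right_mono) auto
    then have "s * t \<in> ball 0 e" using t by (simp add: abs_mult)
    then have "((\<lambda>s. h (t * s)) has_vector_derivative t *\<^sub>R (t * s) ^ N *\<^sub>R R (t * s)) (at s)"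
      by (intro has_vector_derivative_rescale h) (simp add: mult.commute)
    then show "((\<lambda>s. h (s * t)) has_vector_derivative t *\<^sub>R (s * t) ^ N *\<^sub>R R (s * t)) (at s within {0..1})"
      by (simp add: mult.commute has_vector_derivative_at_within)
  qed simp
  then have "integral {0..1} (\<lambda>s. t ^ Suc N *\<^sub>R s ^ N *\<^sub>R R (s * t)) = h t - h 0"
    by (simp add: integral_unique power_mult_distrib ac_simps)
  then show "h t = h 0 + t ^ Suc N *\<^sub>R integral {0..1} (\<lambda>s. s ^ N *\<^sub>R R (s * t))"
    by (simp only: integral_cmul) simp
qed

text \<open>The induction expands the derivative, that is the shifted sequence, and integrates. The
  point is the smoothness of \<open>g\<close> at 0, which the usual estimates of the remainder do
  not give.\<close>

lemma taylor_smooth_remainder: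
  fixes D :: "nat \<Rightarrow> real \<Rightarrow> 'b::euclidean_space"
  assumes "\<And>n t. t \<in> ball 0 e \<Longrightarrow> (D n has_vector_derivative D (Suc n) t) (at t)"
  shows "\<exists>g. smooth_on (ball 0 e) g \<and>
    (\<forall>t\<in>ball 0 e. D 0 t = (\<Sum>n<N. (t ^ n / fact n) *\<^sub>R D n 0) + t ^ N *\<^sub>R g t)"
  using assms
proof (induction N arbitrary: D)
  case 0
  show ?case
    using smooth_on_derivative_sequence[of "ball 0 e" D 0] 0 by (intro exI[of _ "D 0"]) simp
next
  case (Suc N)
  obtain g where g: "smooth_on (ball 0 e) g" and
    D1: "\<And>t. t \<in> ball 0 e \<Longrightarrow> D (Suc 0) t = (\<Sum>n<N. (t ^ n / fact n) *\<^sub>R D (Suc n) 0) + t ^ N *\<^sub>R g t"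
    using Suc.IH[of "\<lambda>n. D (Suc n)"] Suc.prems by blast
  let ?P = "\<lambda>t. \<Sum>n<N. (t ^ Suc n / fact (Suc n)) *\<^sub>R D (Suc n) 0"
  let ?h = "\<lambda>t. D 0 t - ?P t"
  have "(?h has_vector_derivative t ^ N *\<^sub>R g t) (at t)" if "t \<in> ball 0 e" for t
  proof -
    have "((\<lambda>t. t ^ Suc n / fact (Suc n)) has_real_derivative t ^ n / fact n) (at t)" for n
      by (rule DERIV_cong, rule DERIV_cdivide, rule DERIV_pow) (simp add: fact_Suc del: of_nat_Suc)
    then have "(?P has_vector_derivative (\<Sum>n<N. (t ^ n / fact n) *\<^sub>R D (Suc n) 0)) (at t)"
      by (intro has_vector_derivative_sum)
         (use has_vector_derivative_scaleR[OF _ has_vector_derivative_const] in fastforce)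
    from has_vector_derivative_diff[OF Suc.prems[OF that, of 0] this] D1[OF that]
    show ?thesis by simp
  qed
  from antiderivative_power_expansion[OF g this] obtain g2 where g2: "smooth_on (ball 0 e) g2"
    "\<And>t. t \<in> ball 0 e \<Longrightarrow> ?h t = ?h 0 + t ^ Suc N *\<^sub>R g2 t" by blast
  have "D 0 t = (\<Sum>n<Suc N. (t ^ n / fact n) *\<^sub>R D n 0) + t ^ Suc N *\<^sub>R g2 t" if "t \<in> ball 0 e" for t
  proof -
    have "D 0 t = D 0 0 + ?P t + t ^ Suc N *\<^sub>R g2 t"
      using g2(2)[OF that] by (simp add: algebra_simps)
    then show ?thesis by (simp only: sum.lessThan_Suc_shift) simp
  qed
  with g2(1) show ?case by blast
qed

subsection \<open>Smooth germs\<close>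

lemma smooth_germ_iff_ball: "smooth_germ f a \<longleftrightarrow> (\<exists>e>0. smooth_on (ball a e) f)"
proof
  assume "smooth_germ f a"
  then obtain U where "open U" "a \<in> U" "smooth_on U f" by (auto simp: smooth_germ_def)
  then show "\<exists>e>0. smooth_on (ball a e) f" by (meson open_contains_ball smooth_on_subset)
next
  assume "\<exists>e>0. smooth_on (ball a e) f"
  then show "smooth_germ f a" unfolding smooth_germ_def by (meson centre_in_ball open_ball)
qed

lemma smooth_germ_common_ball:
  assumes "smooth_germ f a" "smooth_germ g a"
  obtains e where "e > 0" "smooth_on (ball a e) f" "smooth_on (ball a e) g"
proof -
  obtain d e where "d > 0" "smooth_on (ball a d) f" "e > 0" "smooth_on (ball a e) g"
    using assms unfolding smooth_germ_iff_ball by blast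
  then show thesis
    using that[of "min d e"] smooth_on_subset[of "ball a d" f "ball a (min d e)"]
      smooth_on_subset[of "ball a e" g "ball a (min d e)"] by (simp add: subset_ball)
qed

lemma smooth_germ_ball_eventually:
  assumes "smooth_germ f a" "\<forall>\<^sub>F x in nhds a. P x"
  obtains e where "e > 0" "smooth_on (ball a e) f" "\<And>x. x \<in> ball a e \<Longrightarrow> P x"
proof -
  obtain d e where "d > 0" "smooth_on (ball a d) f" "e > 0" "\<forall>x. dist x a < e \<longrightarrow> P x"
    using assms unfolding smooth_germ_iff_ball eventually_nhds_metric by blast
  then show thesis
    using that[of "min d e"] smooth_on_subset[of "ball a d" f "ball a (min d e)"]
    by (simp add: subset_ball dist_commute)
qed

lemma smooth_germ_cong:
  assumes "smooth_germ f a" "\<forall>\<^sub>F x in nhds a. f x = g x"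
  shows "smooth_germ g a"
  using smooth_germ_ball_eventually[OF assms] smooth_on_cong open_ball smooth_germ_iff_ball by metis

lemma smooth_germ_smooth_on: "smooth_on U f \<Longrightarrow> open U \<Longrightarrow> a \<in> U \<Longrightarrow> smooth_germ f a"
  unfolding smooth_germ_def by blast

lemma smooth_germ_eventually:
  "smooth_germ f a \<Longrightarrow> \<forall>\<^sub>F x in nhds a. smooth_germ f x"
  unfolding smooth_germ_def eventually_nhds by blast

lemma smooth_germ_isCont: "smooth_germ f a \<Longrightarrow> isCont f a"
  unfolding smooth_germ_def using smooth_on_continuous_on continuous_on_eq_continuous_at by blast

lemma smooth_germ_differentiable: "smooth_germ f a \<Longrightarrow> f differentiable (at a)"
  unfolding smooth_germ_def using smooth_on_has_derivative differentiable_def by blast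

lemma smooth_germ_compose:
  assumes "smooth_germ f (g a)" "smooth_germ g a"
  shows "smooth_germ (\<lambda>x. f (g x)) a"
proof -
  obtain U V where U: "open U" "a \<in> U" "smooth_on U g" and V: "open V" "g a \<in> V" "smooth_on V f"
    using assms unfolding smooth_germ_def by blast
  let ?W = "U \<inter> g -` V"
  have "open ?W" using continuous_open_preimage smooth_on_continuous_on U V by blast
  moreover have "smooth_on ?W (\<lambda>x. f (g x))"
    by (rule smooth_on_compose[OF V(3)]) (use U V calculation smooth_on_subset[OF U(3), of ?W] in auto)
  ultimately show ?thesis using U V by (auto intro: smooth_germ_smooth_on)
qed

lemma smooth_germ_bounded_bilinear:
  assumes "bounded_bilinear h" "smooth_germ f a" "smooth_germ g a"
  shows "smooth_germ (\<lambda>x. h (f x) (g x)) a"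
  using smooth_germ_common_ball[OF assms(2,3)] smooth_on_bounded_bilinear[OF assms(1)] open_ball
    smooth_germ_iff_ball by metis

lemma smooth_germ_bounded_linear: "bounded_linear h \<Longrightarrow> smooth_germ h a"
  by (rule smooth_germ_smooth_on[OF smooth_on_bounded_linear open_UNIV]) auto

lemma smooth_germ_linear_comp: "bounded_linear h \<Longrightarrow> smooth_germ f a \<Longrightarrow> smooth_germ (\<lambda>x. h (f x)) a"
  by (rule smooth_germ_compose[OF smooth_germ_bounded_linear])

lemma smooth_germ_const: "smooth_germ (\<lambda>x. c) a"
  by (rule smooth_germ_smooth_on[OF smooth_on_const open_UNIV]) simp

lemma smooth_germ_id: "smooth_germ (\<lambda>x. x) a"
  by (rule smooth_germ_bounded_linear[OF bounded_linear_ident])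

lemma smooth_germ_add:
  assumes "smooth_germ f a" "smooth_germ g a"
  shows "smooth_germ (\<lambda>x. f x + g x) a"
  using smooth_germ_common_ball[OF assms] smooth_on_add open_ball smooth_germ_iff_ball by metis

lemma smooth_germ_minus: "smooth_germ f a \<Longrightarrow> smooth_germ (\<lambda>x. - f x) a"
  by (rule smooth_germ_linear_comp[OF bounded_linear_minus[OF bounded_linear_ident]])

lemma smooth_germ_diff: "smooth_germ f a \<Longrightarrow> smooth_germ g a \<Longrightarrow> smooth_germ (\<lambda>x. f x - g x) a"
  using smooth_germ_add[of f a "\<lambda>x. - g x"] smooth_germ_minus[of g a] by simp

lemmas smooth_germ_scaleR = smooth_germ_bounded_bilinear[OF bounded_bilinear_scaleR]
lemmas smooth_germ_inner = smooth_germ_bounded_bilinear[OF bounded_bilinear_inner]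
lemmas smooth_germ_vec_nth = smooth_germ_linear_comp[OF bounded_linear_vec_nth]

lemma smooth_germ_mult:
  fixes f g :: "'a::euclidean_space \<Rightarrow> real"
  shows "smooth_germ f a \<Longrightarrow> smooth_germ g a \<Longrightarrow> smooth_germ (\<lambda>x. f x * g x) a"
  by (rule smooth_germ_bounded_bilinear[OF bounded_bilinear_mult])

lemma smooth_germ_power:
  fixes f :: "'a::euclidean_space \<Rightarrow> real"
  shows "smooth_germ f a \<Longrightarrow> smooth_germ (\<lambda>x. f x ^ n) a"
  by (induction n) (auto intro: smooth_germ_const smooth_germ_mult)

lemma smooth_germ_inverse:
  fixes f :: "'a::euclidean_space \<Rightarrow> real"
  assumes "smooth_germ f a" "f a \<noteq> 0"
  shows "smooth_germ (\<lambda>x. inverse (f x)) a"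
proof (rule smooth_germ_compose[OF _ assms(1)])
  have "open {x::real. x \<noteq> 0}" by (simp add: open_Collect_neq)
  then show "smooth_germ inverse (f a)"
    using smooth_germ_smooth_on[OF smooth_on_inverse_real] assms(2) by simp
qed

lemma smooth_germ_divide:
  fixes f :: "'a::euclidean_space \<Rightarrow> real"
  assumes "smooth_germ f a" "smooth_germ g a" "g a \<noteq> 0"
  shows "smooth_germ (\<lambda>x. f x / g x) a"
  unfolding divide_inverse by (intro smooth_germ_mult smooth_germ_inverse assms)

lemma smooth_germ_cos: "smooth_germ f a \<Longrightarrow> smooth_germ (\<lambda>x. cos (f x :: real)) a"
  by (rule smooth_germ_compose[OF smooth_germ_smooth_on[OF smooth_on_cos open_UNIV]]) auto

lemma smooth_germ_sin: "smooth_germ f a \<Longrightarrow> smooth_germ (\<lambda>x. sin (f x :: real)) a"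
  by (rule smooth_germ_compose[OF smooth_germ_smooth_on[OF smooth_on_sin open_UNIV]]) auto

lemma smooth_germ_has_vector_derivative:
  fixes f :: "real \<Rightarrow> 'b::euclidean_space"
  shows "smooth_germ f a \<Longrightarrow> (f has_vector_derivative vector_derivative f (at a)) (at a)"
  unfolding smooth_germ_def using smooth_on_has_vector_derivative by blast

lemma smooth_germ_vector_derivative:
  fixes f :: "real \<Rightarrow> 'b::euclidean_space"
  shows "smooth_germ f a \<Longrightarrow> smooth_germ (\<lambda>t. vector_derivative f (at t)) a"
  unfolding smooth_germ_def using smooth_on_vector_derivative by blast

lemma smooth_germ_DERIV:
  fixes f :: "real \<Rightarrow> real"
  shows "smooth_germ f a \<Longrightarrow> (f has_real_derivative deriv f a) (at a)"
  using smooth_germ_has_vector_derivative has_real_derivative_iff_has_vector_derivative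
    DERIV_deriv_iff_real_differentiable real_differentiable_def by metis

lemma smooth_germ_deriv:
  fixes f :: "real \<Rightarrow> real"
  assumes "smooth_germ f a"
  shows "smooth_germ (deriv f) a"
proof (rule smooth_germ_cong[OF smooth_germ_vector_derivative[OF assms]])
  show "\<forall>\<^sub>F t in nhds a. vector_derivative f (at t) = deriv f t"
    using smooth_germ_eventually[OF assms]
  proof eventually_elim
    case (elim t)
    then show ?case
      using smooth_germ_DERIV vector_derivative_at has_real_derivative_iff_has_vector_derivative by blast
  qed
qed

lemma smooth_germ_deriv_funpow:
  fixes f :: "real \<Rightarrow> real"
  shows "smooth_germ f a \<Longrightarrow> smooth_germ ((deriv ^^ n) f) a"
  by (induction n) (auto intro: smooth_germ_deriv)

subsection \<open>Borel's lemma\<close>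

text \<open>An algebra closed under differentiation whose members are bounded on the whole line. It
  takes the place of cutoff functions in the usual proof of Borel's lemma.\<close>

inductive trig_poly :: "(real \<Rightarrow> real) \<Rightarrow> bool" where
  const: "trig_poly (\<lambda>x. c)"
| sin: "trig_poly sin"
| cos: "trig_poly cos"
| add: "trig_poly f \<Longrightarrow> trig_poly g \<Longrightarrow> trig_poly (\<lambda>x. f x + g x)"
| mult: "trig_poly f \<Longrightarrow> trig_poly g \<Longrightarrow> trig_poly (\<lambda>x. f x * g x)"

lemma trig_poly_bounded: "trig_poly f \<Longrightarrow> \<exists>B. \<forall>x. \<bar>f x\<bar> \<le> B"
proof (induction rule: trig_poly.induct)
  case (const c)
  then show ?case by blast
next
  case sin
  then show ?case using abs_sin_le_one by blast
next
  case cos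
  then show ?case using abs_cos_le_one by blast
next
  case (add f g)
  then show ?case by (meson abs_triangle_ineq add_mono order_trans)
next
  case (mult f g)
  then obtain B C where "\<forall>x. \<bar>f x\<bar> \<le> B" "\<forall>x. \<bar>g x\<bar> \<le> C" by blast
  then have "\<bar>f x * g x\<bar> \<le> B * C" for x
    unfolding abs_mult by (meson abs_ge_zero mult_mono order_trans)
  then show ?case by blast
qed

lemma trig_poly_DERIV: "trig_poly f \<Longrightarrow> \<exists>f'. trig_poly f' \<and> (\<forall>x. (f has_real_derivative f' x) (at x))"
proof (induction rule: trig_poly.induct)
  case (const c)
  show ?case by (rule exI[of _ "\<lambda>x. 0"]) (auto intro: trig_poly.const)
next
  case sin
  show ?case by (rule exI[of _ cos]) (auto intro: trig_poly.cos)
next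
  case cos
  show ?case
    by (rule exI[of _ "\<lambda>x. (- 1) * sin x"])
       (use trig_poly.mult[OF trig_poly.const[of "- 1"] trig_poly.sin] in \<open>auto intro!: derivative_eq_intros\<close>)
next
  case (add f g)
  then obtain f' g' where "trig_poly f'" "\<forall>x. (f has_real_derivative f' x) (at x)"
    "trig_poly g'" "\<forall>x. (g has_real_derivative g' x) (at x)" by blast
  then show ?case
    by (intro exI[of _ "\<lambda>x. f' x + g' x"]) (auto intro: trig_poly.add DERIV_add)
next
  case (mult f g)
  then obtain f' g' where fg: "trig_poly f'" "\<forall>x. (f has_real_derivative f' x) (at x)"
    "trig_poly g'" "\<forall>x. (g has_real_derivative g' x) (at x)" by blast
  have "trig_poly (\<lambda>x. f' x * g x + g' x * f x)"
    using fg mult.hyps by (intro trig_poly.add[OF trig_poly.mult trig_poly.mult])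
  then show ?case using fg DERIV_mult by blast
qed

lemma trig_poly_deriv:
  assumes "trig_poly f"
  shows "trig_poly (deriv f)" "(f has_real_derivative deriv f x) (at x)"
proof -
  obtain f' where f': "trig_poly f'" "\<And>x. (f has_real_derivative f' x) (at x)"
    using trig_poly_DERIV[OF assms] by blast
  then have "deriv f = f'" by (auto intro: DERIV_imp_deriv)
  with f' show "trig_poly (deriv f)" "(f has_real_derivative deriv f x) (at x)" by auto
qed

lemma trig_poly_power: "trig_poly f \<Longrightarrow> trig_poly (\<lambda>x. f x ^ n)"
  by (induction n) (auto intro: trig_poly.const trig_poly.mult)

text \<open>The powers of \<open>sin\<close> serve as monomials whose derivatives are all bounded.\<close>

lemma bounded_monomial:
  obtains D :: "nat \<Rightarrow> real \<Rightarrow> real"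
  where "\<And>n x. (D n has_real_derivative D (Suc n) x) (at x)" "\<And>n. \<exists>B. \<forall>x. \<bar>D n x\<bar> \<le> B"
    "\<And>n. n < k \<Longrightarrow> D n 0 = 0" "D k 0 \<noteq> 0"
proof -
  let ?f = "\<lambda>x::real. sin x ^ k"
  have tp: "trig_poly ((deriv ^^ n) ?f)" for n
    by (induction n) (auto intro: trig_poly_power trig_poly.sin trig_poly_deriv)
  \<comment> \<open>Every derivative up to order \<open>k\<close> removes exactly one factor
    \<open>sin x\<close> and leaves a cofactor that does not vanish at 0; so the zero of
    \<open>sin x ^ k\<close> has order exactly \<open>k\<close>.\<close>
  have ex: "\<exists>p. trig_poly p \<and> (\<forall>x. (deriv ^^ n) ?f x = sin x ^ (k - n) * p x) \<and> p 0 \<noteq> 0" if "n \<le> k" for n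
    using that
  proof (induction n)
    case 0
    show ?case by (rule exI[of _ "\<lambda>_. 1"]) (auto intro: trig_poly.const)
  next
    case (Suc n)
    then obtain p where p: "trig_poly p" "\<And>x. (deriv ^^ n) ?f x = sin x ^ (k - n) * p x" "p 0 \<noteq> 0"
      by auto
    from Suc.prems obtain m where m: "k - n = Suc m" "k - Suc n = m"
      by (metis Suc_diff_le diff_Suc_Suc)
    let ?p = "\<lambda>x. (1 + real m) * (cos x * p x) + sin x * deriv p x"
    have "((deriv ^^ n) ?f has_real_derivative sin x ^ m * ?p x) (at x)" for x
    proof -
      have "((\<lambda>x. sin x ^ Suc m * p x) has_real_derivative
          (1 + real m) * (cos x * sin x ^ m) * p x + deriv p x * sin x ^ Suc m) (at x)"
        by (intro DERIV_mult DERIV_power_Suc DERIV_sin trig_poly_deriv p(1))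
      moreover have "(deriv ^^ n) ?f = (\<lambda>x. sin x ^ Suc m * p x)" using p(2) m(1) by auto
      ultimately show ?thesis by (simp add: algebra_simps)
    qed
    then have "(deriv ^^ Suc n) ?f x = sin x ^ (k - Suc n) * ?p x" for x
      using m(2) by (simp add: DERIV_imp_deriv)
    moreover have "trig_poly ?p"
      by (intro trig_poly.add trig_poly.mult trig_poly.const trig_poly.cos trig_poly.sin p(1) trig_poly_deriv)
    ultimately show ?case using p(3) by (intro exI[of _ ?p]) auto
  qed
  show thesis
  proof (rule that[of "\<lambda>n. (deriv ^^ n) ?f"])
    show "((deriv ^^ n) ?f has_real_derivative (deriv ^^ Suc n) ?f x) (at x)" for n x
      using trig_poly_deriv(2)[OF tp] by simp
    show "\<exists>B. \<forall>x. \<bar>(deriv ^^ n) ?f x\<bar> \<le> B" for n by (rule trig_poly_bounded[OF tp])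
    show "(deriv ^^ n) ?f 0 = 0" if "n < k" for n using ex[of n] that by auto
    show "(deriv ^^ k) ?f 0 \<noteq> 0" using ex[of k] by auto
  qed
qed

text \<open>Replacing \<open>x\<close> by \<open>L * x\<close> and dividing by \<open>L ^ k\<close>
  keeps the derivative of order \<open>k\<close> at 0 and shrinks those of lower order by at least
  the factor \<open>L\<close>.\<close>

lemma small_monomial:
  "\<exists>D :: nat \<Rightarrow> real \<Rightarrow> real. (\<forall>n x. (D n has_real_derivative D (Suc n) x) (at x)) \<and>
    (\<forall>n<k. \<forall>x. \<bar>D n x\<bar> \<le> (1/2) ^ k) \<and> (\<forall>n<k. D n 0 = 0) \<and> D k 0 = c"
proof -
  obtain D :: "nat \<Rightarrow> real \<Rightarrow> real" where
    D: "\<And>n x. (D n has_real_derivative D (Suc n) x) (at x)" "\<And>n. \<exists>B. \<forall>x. \<bar>D n x\<bar> \<le> B"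
    "\<And>n. n < k \<Longrightarrow> D n 0 = 0" "D k 0 \<noteq> 0" using bounded_monomial by blast
  obtain B where B: "\<And>n x. \<bar>D n x\<bar> \<le> B n" using D(2) by metis
  define C where "C = (\<Sum>n<k. B n)"
  have B0: "0 \<le> B n" for n using B[of n 0] by linarith
  have C: "\<bar>D n x\<bar> \<le> C" if "n < k" for n x
    using B[of n x] member_le_sum[of n "{..<k}" B] that B0 by (auto simp: C_def)
  have C0: "0 \<le> C" using B0 by (auto simp: C_def intro: sum_nonneg)
  define d where "d = c / D k 0"
  \<comment> \<open>Chosen so that \<open>\<bar>d\<bar> * C / L\<close> is at most
    \<open>(1/2) ^ k\<close>; the summand 1 ensures \<open>L \<ge> 1\<close> even if
    \<open>d\<close> or \<open>C\<close> is zero.\<close>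
  define L where "L = 1 + 2 ^ k * \<bar>d\<bar> * C"
  have L: "1 \<le> L" "2 ^ k * \<bar>d\<bar> * C \<le> L" using C0 by (auto simp: L_def)
  let ?D = "\<lambda>n x. d * L ^ n / L ^ k * D n (L * x)"
  show ?thesis
  proof (intro exI[of _ ?D] conjI allI impI)
    fix n x
    have "((\<lambda>x. D n (L * x)) has_real_derivative D (Suc n) (L * x) * L) (at x)"
      by (rule DERIV_chain2[OF D(1)]) (use DERIV_cmult_Id in auto)
    from DERIV_cmult[OF this, of "d * L ^ n / L ^ k"]
    show "(?D n has_real_derivative ?D (Suc n) x) (at x)" by (simp add: ac_simps)
  next
    fix n x assume n: "n < k"
    have "L ^ n * L \<le> L ^ k"
      using power_increasing[of "Suc n" k L] n L(1) by (simp add: ac_simps)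
    then have "L ^ n / L ^ k \<le> 1 / L" using L(1) by (simp add: field_simps)
    then have "\<bar>d\<bar> * (L ^ n / L ^ k) * \<bar>D n (L * x)\<bar> \<le> \<bar>d\<bar> * (1 / L) * C"
      using L(1) C[OF n] by (intro mult_mono) auto
    then have "\<bar>?D n x\<bar> \<le> \<bar>d\<bar> * (1 / L) * C"
      using L(1) by (simp add: abs_mult)
    also have "\<dots> \<le> (1/2) ^ k" using L by (simp add: field_simps)
    finally show "\<bar>?D n x\<bar> \<le> (1/2) ^ k" .
  next
    show "?D n 0 = 0" if "n < k" for n using D(3)[OF that] by simp
    show "?D k 0 = c" using D(4) L(1) by (simp add: d_def)
  qed
qed

text \<open>For fixed \<open>n\<close> the derivative of order \<open>n\<close> of the term with
  index \<open>k > n\<close> is bounded by \<open>(1/2) ^ k\<close>, so every differentiated series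
  converges uniformly and termwise differentiation is allowed. At 0 only the finitely many terms
  with \<open>k \<le> n\<close> survive.\<close>

theorem borel_lemma:
  fixes a :: "nat \<Rightarrow> real"
  obtains D :: "nat \<Rightarrow> real \<Rightarrow> real"
  where "\<And>n x. (D n has_real_derivative D (Suc n) x) (at x)" "\<And>n. D n 0 = a n"
proof -
  obtain M :: "nat \<Rightarrow> real \<Rightarrow> nat \<Rightarrow> real \<Rightarrow> real" where
    M: "\<And>k c n x. (M k c n has_real_derivative M k c (Suc n) x) (at x)"
    "\<And>k c n x. n < k \<Longrightarrow> \<bar>M k c n x\<bar> \<le> (1/2) ^ k" "\<And>k c n. n < k \<Longrightarrow> M k c n 0 = 0"
    "\<And>k c. M k c k 0 = c"
    using small_monomial by metis
  \<comment> \<open>A bounded monomial of index \<open>i\<close> may have nonzero derivatives at 0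
    of orders above \<open>i\<close>, unlike a power of \<open>x\<close>. The prescribed values are
    therefore corrected recursively by the contributions of the earlier terms.\<close>
  define c where "c = wfrec less_than (\<lambda>c k. a k - (\<Sum>i<k. M i (c i) k 0))"
  have c: "c k = a k - (\<Sum>i<k. M i (c i) k 0)" for k
    unfolding c_def by (subst wfrec) (auto simp: cut_apply)
  define g where "g = (\<lambda>n k. M k (c k) n)"
  have ev: "\<forall>\<^sub>F k in sequentially. \<forall>x\<in>UNIV. norm (g n k x) \<le> (1/2) ^ k" for n
    using eventually_gt_at_top[of n] by eventually_elim (auto simp: g_def M(2))
  have half: "summable (\<lambda>k. (1/2::real) ^ k)" by (simp add: summable_geometric)
  have uc: "uniformly_convergent_on UNIV (\<lambda>N x. \<Sum>k<N. g n k x)" for n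
    by (rule Weierstrass_m_test'_ev[OF ev half])
  have sm: "summable (\<lambda>k. g n k x)" for n x
    by (rule summable_comparison_test_ev[OF _ half]) (use ev[of n] in \<open>auto elim: eventually_mono\<close>)
  let ?D = "\<lambda>n x. \<Sum>k. g n k x"
  show thesis
  proof (rule that[of ?D])
    show "(?D n has_real_derivative ?D (Suc n) x) (at x)" for n x
      by (rule has_field_derivative_series'(2)[where S = UNIV and f = "g n" and f' = "g (Suc n)"])
         (auto simp: uc sm, simp add: g_def M(1))
    have "?D n 0 = (\<Sum>k\<le>n. g n k 0)" for n
      by (rule suminf_finite) (auto simp: g_def M(3))
    also have "\<dots> n = a n" for n
      using c[of n] by (simp add: g_def M(4) lessThan_Suc_atMost[symmetric])
    finally show "?D n 0 = a n" for n .
  qed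
qed

subsection \<open>Functions of \<open>t ^ p\<close> and \<open>t ^ q\<close>\<close>

lemma smooth_on_DERIV:
  fixes f :: "real \<Rightarrow> real"
  shows "smooth_on U f \<Longrightarrow> open U \<Longrightarrow> t \<in> U \<Longrightarrow> (f has_real_derivative deriv f t) (at t)"
  using smooth_germ_DERIV smooth_germ_smooth_on by blast

lemma smooth_on_deriv:
  fixes f :: "real \<Rightarrow> real"
  assumes "smooth_on U f" "open U"
  shows "smooth_on U (deriv f)"
  using smooth_on_cong[OF smooth_on_vector_derivative[OF assms] assms(2)] smooth_on_DERIV[OF assms]
  by (metis has_real_derivative_iff_has_vector_derivative vector_derivative_at)

text \<open>The Taylor coefficients of \<open>R\<close> are sorted by their index modulo
  \<open>p\<close>, and Borel's lemma realises each class as the Taylor series of one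
  \<open>A i\<close>. The difference then has zero Taylor series; this flatness is recorded as
  divisibility by every power of \<open>t\<close> with a smooth quotient.\<close>

lemma residue_decomposition:
  fixes R :: "real \<Rightarrow> real"
  assumes R: "smooth_on (ball 0 e) R" and p: "p > 0" and e: "e > 0"
  obtains A where "\<And>i. smooth_on UNIV (A i)"
    "\<And>N. \<exists>g. smooth_on (ball 0 e) g \<and> (\<forall>t\<in>ball 0 e. R t - (\<Sum>i<p. t ^ i * A i (t ^ p)) = t ^ N * g t)"
proof -
  obtain D where D0: "D 0 = R" and
    D: "\<And>n t. t \<in> ball 0 e \<Longrightarrow> (D n has_vector_derivative D (Suc n) t) (at t)"
    using smooth_on_derivative_sequenceE[OF R open_ball] by blast
  define r where "r = (\<lambda>n. D n 0 / fact n)"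
  have "\<exists>B :: nat \<Rightarrow> real \<Rightarrow> real. (\<forall>n x. (B n has_real_derivative B (Suc n) x) (at x)) \<and>
      (\<forall>n. B n 0 = fact n * r (n * p + i))" for i
    by (rule borel_lemma[of "\<lambda>n. fact n * r (n * p + i)"]) blast
  then obtain B :: "nat \<Rightarrow> nat \<Rightarrow> real \<Rightarrow> real" where
    B: "\<And>i n x. (B i n has_real_derivative B i (Suc n) x) (at x)" "\<And>i n. B i n 0 = fact n * r (n * p + i)"
    by metis
  have Bv: "(B i n has_vector_derivative B i (Suc n) x) (at x)" for i n x
    using B(1) by (simp add: has_real_derivative_iff_has_vector_derivative)
  let ?A = "\<lambda>i. B i 0"
  show thesis
  proof (rule that[of ?A])
    show "smooth_on UNIV (?A i)" for i
      by (rule smooth_on_derivative_sequence[of UNIV "B i"]) (use Bv in auto)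
    fix N
    obtain g where g: "smooth_on (ball 0 e) g"
      "\<And>t. t \<in> ball 0 e \<Longrightarrow> R t = (\<Sum>n<N * p. (t ^ n / fact n) *\<^sub>R D n 0) + t ^ (N * p) *\<^sub>R g t"
      using taylor_smooth_remainder[of e D "N * p"] D unfolding D0 by blast
    \<comment> \<open>The radius is large enough to contain \<open>t ^ p\<close> for all
      \<open>t\<close> in the ball of radius \<open>e\<close>.\<close>
    have "\<exists>h. smooth_on (ball 0 (e ^ p + 1)) h \<and> (\<forall>x\<in>ball 0 (e ^ p + 1).
        ?A i x = (\<Sum>n<N. (x ^ n / fact n) *\<^sub>R B i n 0) + x ^ N *\<^sub>R h x)" for i
      by (rule taylor_smooth_remainder[of _ "B i" N]) (rule Bv)
    then obtain h where h: "\<And>i. smooth_on (ball 0 (e ^ p + 1)) (h i)"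
      "\<And>i x. x \<in> ball 0 (e ^ p + 1) \<Longrightarrow> ?A i x = (\<Sum>n<N. (x ^ n / fact n) *\<^sub>R B i n 0) + x ^ N *\<^sub>R h i x"
      by metis
    have tp: "t ^ p \<in> ball 0 (e ^ p + 1)" if "t \<in> ball 0 e" for t :: real
      using that power_mono[of "\<bar>t\<bar>" e p] by (simp add: power_abs[symmetric])
    \<comment> \<open>Expanding \<open>R\<close> to order \<open>N * p\<close> matches expanding
      each \<open>A i\<close> to order \<open>N\<close>; the order exceeds the required
      \<open>N\<close>, and the surplus power of \<open>t\<close> goes into the quotient.\<close>
    let ?g = "\<lambda>t. t ^ (N * p - N) * (g t - (\<Sum>i<p. t ^ i * h i (t ^ p)))"
    have "smooth_on (ball 0 e) (\<lambda>t. h i (t ^ p))" for i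
      by (rule smooth_on_compose[OF h(1) smooth_on_power[OF smooth_on_id]]) (use tp in auto)
    then have "smooth_on (ball 0 e) ?g"
      by (intro smooth_on_mult smooth_on_diff smooth_on_sum smooth_on_power smooth_on_id g(1) open_ball)
    moreover have "R t - (\<Sum>i<p. t ^ i * ?A i (t ^ p)) = t ^ N * ?g t" if t: "t \<in> ball 0 e" for t
    proof -
      have "(\<Sum>n<N * p. t ^ n * r n) = (\<Sum>n<N. \<Sum>k\<in>{n * p..<n * p + p}. t ^ k * r k)"
        by (rule sum.nat_group[symmetric])
      also have "\<dots> = (\<Sum>n<N. \<Sum>i<p. t ^ (n * p + i) * r (n * p + i))"
        using sum.shift_bounds_nat_ivl[of "\<lambda>k. t ^ k * r k" 0 "n * p" p for n]
        by (simp add: lessThan_atLeast0 add.commute)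
      also have "\<dots> = (\<Sum>i<p. \<Sum>n<N. t ^ (n * p + i) * r (n * p + i))" by (rule sum.swap)
      also have "\<dots> = (\<Sum>i<p. t ^ i * (\<Sum>n<N. (t ^ p) ^ n * r (n * p + i)))"
        by (simp add: sum_distrib_left power_add power_mult[symmetric] mult_ac)
      finally have 1: "(\<Sum>n<N * p. t ^ n * r n) = (\<Sum>i<p. t ^ i * (\<Sum>n<N. (t ^ p) ^ n * r (n * p + i)))" .
      have "?A i (t ^ p) = (\<Sum>n<N. (t ^ p) ^ n * r (n * p + i)) + t ^ (N * p) * h i (t ^ p)" for i
        using h(2)[OF tp[OF t], of i] by (simp add: B(2) power_mult[symmetric] mult.commute)
      then have 2: "(\<Sum>i<p. t ^ i * ?A i (t ^ p)) =
          (\<Sum>n<N * p. t ^ n * r n) + t ^ (N * p) * (\<Sum>i<p. t ^ i * h i (t ^ p))"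
        unfolding 1 by (simp add: distrib_left sum.distrib sum_distrib_left mult_ac)
      have 3: "R t = (\<Sum>n<N * p. t ^ n * r n) + t ^ (N * p) * g t"
        using g(2)[OF t] by (simp add: r_def)
      have "t ^ (N * p) = t ^ N * t ^ (N * p - N)"
        using p by (simp add: power_add[symmetric])
      then show ?thesis unfolding 2 3 by (simp add: algebra_simps)
    qed
    ultimately show "\<exists>g. smooth_on (ball 0 e) g \<and>
        (\<forall>t\<in>ball 0 e. R t - (\<Sum>i<p. t ^ i * ?A i (t ^ p)) = t ^ N * g t)" by blast
  qed
qed

text \<open>\<open>W\<close> is \<open>f\<close> composed with the root of order \<open>q\<close>,
  which is defined on the whole line as \<open>q\<close> is odd. Differentiating divides by
  \<open>q * t ^ (q - 1)\<close>, and flatness survives this division; so flat functions composed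
  with the root form a family stable under differentiation.\<close>

lemma flat_function_of_odd_power:
  fixes f :: "real \<Rightarrow> real"
  assumes q: "odd q" and e: "e > 0"
    and flat: "\<And>N. \<exists>g. smooth_on (ball 0 e) g \<and> (\<forall>t\<in>ball 0 e. f t = t ^ N * g t)"
  obtains W where "smooth_germ W 0" "(W has_real_derivative 0) (at 0)" "W 0 = 0"
    "\<And>t. W (t ^ q) = f t"
proof -
  define flat where "flat = (\<lambda>f :: real \<Rightarrow> real.
    \<forall>N. \<exists>g. smooth_on (ball 0 e) g \<and> (\<forall>t\<in>ball 0 e. f t = t ^ N * g t))"
  define U where "U = {y. root q y \<in> ball 0 e}"
  have q0: "q > 0" using q by (cases q) auto
  have cr: "continuous_on UNIV (root q)"
    using continuous_on_real_root[OF continuous_on_id, of UNIV q] by simp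
  have U: "open U"
    using open_vimage[OF open_ball cr, of 0 e] by (simp add: U_def vimage_def)
  have U0: "0 \<in> U" using e by (simp add: U_def)
  have step: "\<exists>f'. flat f' \<and> f' 0 = 0 \<and> (\<forall>y\<in>U. ((\<lambda>y. f (root q y)) has_real_derivative f' (root q y)) (at y))"
    if f: "flat f" for f
  proof (intro exI conjI ballI)
    \<comment> \<open>The chain rule with the derivative of the root. At 0, where the root is not
      differentiable if \<open>q > 1\<close>, the value 0 is prescribed and justified
      separately.\<close>
    let ?f' = "\<lambda>t. if t = 0 then 0 else deriv f t / (real q * t ^ (q - 1))"
    have "\<exists>h. smooth_on (ball 0 e) h \<and> (\<forall>t\<in>ball 0 e. ?f' t = t ^ Suc N * h t)" for N
    proof -
      \<comment> \<open>\<open>f\<close> is divided by \<open>t ^ (N + q + 1)\<close>: one power is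
        lost in differentiating and \<open>q - 1\<close> in the division. The remaining exponent
        \<open>Suc N\<close> is positive, so the formula also gives the prescribed value at
        0.\<close>
      let ?n = "Suc N + (q - 1)"
      obtain g where g: "smooth_on (ball 0 e) g" "\<And>t. t \<in> ball 0 e \<Longrightarrow> f t = t ^ Suc ?n * g t"
        using f unfolding flat_def by blast
      let ?h = "\<lambda>t. ((1 + real ?n) * g t + t * deriv g t) * inverse (real q)"
      have "smooth_on (ball 0 e) ?h"
        by (intro smooth_on_mult smooth_on_add smooth_on_const smooth_on_id smooth_on_deriv g(1) open_ball)
      moreover have "?f' t = t ^ Suc N * ?h t" if t: "t \<in> ball 0 e" for t
      proof (cases "t = 0")
        case False
        have "((\<lambda>t. t ^ Suc ?n * g t) has_real_derivative
            (1 + real ?n) * (1 * t ^ ?n) * g t + deriv g t * t ^ Suc ?n) (at t)"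
          by (intro DERIV_mult DERIV_power_Suc DERIV_ident smooth_on_DERIV[OF g(1) open_ball t])
        then have "(f has_real_derivative (1 + real ?n) * (1 * t ^ ?n) * g t + deriv g t * t ^ Suc ?n) (at t)"
          using has_field_derivative_transform_within_open[OF _ open_ball t] g(2) by (metis (no_types, lifting))
        then have "deriv f t = t ^ Suc N * t ^ (q - 1) * ((1 + real ?n) * g t + t * deriv g t)"
          by (subst DERIV_imp_deriv) (auto simp: power_add algebra_simps)
        moreover have "a * b * x / (real q * b) = a * (x * inverse (real q))" if "b \<noteq> 0" for a b x :: real
          using that by (simp add: divide_inverse)
        ultimately show ?thesis using False by (simp only: if_False power_not_zero not_False_eq_True)
      qed simp
      ultimately show ?thesis by blast
    qed note f'_Suc = this
    show "flat ?f'"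
      unfolding flat_def
    proof
      fix N
      show "\<exists>g. smooth_on (ball 0 e) g \<and> (\<forall>t\<in>ball 0 e. ?f' t = t ^ N * g t)"
      proof (cases N)
        case 0
        obtain h where h: "smooth_on (ball 0 e) h" "\<And>t. t \<in> ball 0 e \<Longrightarrow> ?f' t = t ^ Suc 0 * h t"
          using f'_Suc[of 0] by blast
        then show ?thesis
          unfolding 0 by (intro exI[of _ "\<lambda>t. t * h t"] conjI smooth_on_mult smooth_on_id open_ball) auto
      next
        case (Suc M)
        then show ?thesis using f'_Suc[of M] by simp
      qed
    qed
    show "?f' 0 = 0" by simp
    fix y assume y: "y \<in> U"
    obtain g where g: "smooth_on (ball 0 e) g" "\<And>t. t \<in> ball 0 e \<Longrightarrow> f t = t ^ Suc q * g t"
      using f unfolding flat_def by blast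
    show "((\<lambda>y. f (root q y)) has_real_derivative ?f' (root q y)) (at y)"
    proof (cases "y = 0")
      case False
      then have "root q y \<noteq> 0" using q0 by simp
      obtain g where "smooth_on (ball 0 e) g" "\<And>t. t \<in> ball 0 e \<Longrightarrow> f t = t ^ 0 * g t"
        using f unfolding flat_def by blast
      then have "smooth_on (ball 0 e) f" using smooth_on_cong[of "ball 0 e" g f] by simp
      then have "(f has_real_derivative deriv f (root q y)) (at (root q y))"
        by (rule smooth_on_DERIV) (use y in \<open>auto simp: U_def\<close>)
      from DERIV_chain2[OF this DERIV_odd_real_root[OF q False]] \<open>root q y \<noteq> 0\<close>
      show ?thesis by (simp add: field_simps)
    next
      case True
      \<comment> \<open>Since \<open>root q y ^ q = y\<close>, divisibility by
        \<open>t ^ Suc q\<close> presents the function as \<open>y\<close> times the continuous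
        \<open>?k\<close>, which vanishes at 0. Caratheodory's form of the derivative gives
        0.\<close>
      let ?k = "\<lambda>y. root q y * g (root q y)"
      have "isCont g 0" using g(1) e smooth_on_continuous_on continuous_on_eq_continuous_at
        by (metis centre_in_ball open_ball)
      moreover have "isCont (root q) 0" using cr continuous_on_eq_continuous_at by blast
      ultimately have "isCont ?k 0"
        by (intro continuous_intros isCont_o2[of 0 "root q" g]) auto
      then have "((\<lambda>y. ?k y * y) has_real_derivative 0) (at 0)"
        unfolding CARAT_DERIV by (intro exI[of _ ?k]) auto
      then have "((\<lambda>y. f (root q y)) has_real_derivative 0) (at 0)"
      proof (rule has_field_derivative_transform_within_open[OF _ U U0])
        fix y assume "y \<in> U"
        then have "f (root q y) = root q y ^ Suc q * g (root q y)" using g(2) by (simp add: U_def)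
        then show "?k y * y = f (root q y)" by (simp add: odd_real_root_pow[OF q])
      qed
      with True show ?thesis by simp
    qed
  qed
  let ?W = "\<lambda>y. f (root q y)"
  have f: "flat f" using flat unfolding flat_def by blast
  show thesis
  proof (rule that[of ?W])
    have "smooth_on U ?W"
    proof (rule smooth_on_coinduct[where P = "\<lambda>F. \<exists>c f. flat f \<and> F = (\<lambda>y. c * f (root q y))"])
      show "\<exists>c h. flat h \<and> ?W = (\<lambda>y. c * h (root q y))"
        using f by (intro exI[of _ 1] exI[of _ f]) simp
      fix F :: "real \<Rightarrow> real" assume "\<exists>c f. flat f \<and> F = (\<lambda>y. c * f (root q y))"
      then obtain c h where h: "flat h" "F = (\<lambda>y. c * h (root q y))" by blast
      from step[OF h(1)] obtain h' where h': "flat h'"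
        "\<And>y. y \<in> U \<Longrightarrow> ((\<lambda>y. h (root q y)) has_real_derivative h' (root q y)) (at y)" by blast
      show "\<exists>f'. (\<forall>x\<in>U. (F has_derivative f' x) (at x)) \<and>
          (\<forall>v. \<exists>c f. flat f \<and> (\<lambda>x. f' x v) = (\<lambda>y. c * f (root q y)))"
      proof (intro exI[of _ "\<lambda>y v. c * h' (root q y) * v"] conjI ballI allI)
        show "(F has_derivative (\<lambda>v. c * h' (root q y) * v)) (at y)" if "y \<in> U" for y
          using DERIV_cmult[OF h'(2)[OF that], of c] unfolding h(2) has_field_derivative_def .
        show "\<exists>d f. flat f \<and> (\<lambda>x. c * h' (root q x) * v) = (\<lambda>y. d * f (root q y))" for v
          using h'(1) by (intro exI[of _ "c * v"] exI[of _ h']) (simp add: mult_ac)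
      qed
    qed (fact U)
    then show "smooth_germ ?W 0" using U U0 by (rule smooth_germ_smooth_on)
    show "(?W has_real_derivative 0) (at 0)" using step[OF f] U0 by force
    obtain g where "\<forall>t\<in>ball 0 e. f t = t ^ 1 * g t" using f unfolding flat_def by blast
    then show "?W 0 = 0" using e by simp
    show "?W (t ^ q) = f t" for t by (simp add: odd_real_root_power_cancel[OF q])
  qed
qed

lemma has_derivative_zero_mult:
  fixes f g :: "'a::real_normed_vector \<Rightarrow> real"
  assumes "(f has_derivative (\<lambda>_. 0)) (at a)" "f a = 0" "g differentiable (at a)"
  shows "((\<lambda>x. f x * g x) has_derivative (\<lambda>_. 0)) (at a)"
proof -
  obtain g' where "(g has_derivative g') (at a)" using assms(3) by (auto simp: differentiable_def)
  from has_derivative_mult[OF assms(1) this] assms(2) show ?thesis by simp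
qed

lemma vec_nth_has_derivative: "((\<lambda>z::real^2. z $ i) has_derivative (\<lambda>z. z $ i)) (at a)"
  by (rule bounded_linear_imp_has_derivative[OF bounded_linear_vec_nth])

lemma flat_nth_has_derivative:
  assumes "(W has_real_derivative 0) (at (0::real))"
  shows "((\<lambda>z::real^2. W (z $ 2)) has_derivative (\<lambda>_. 0)) (at 0)"
proof -
  have "(W has_derivative (\<lambda>_. 0)) (at ((0::real^2) $ 2))"
    using assms by (simp add: has_field_derivative_def lambda_zero[symmetric])
  from has_derivative_compose[OF vec_nth_has_derivative this] show ?thesis by simp
qed

text \<open>Put x = t^2 and y = t^5. Up to a flat term \<open>R\<close> is A_0(x) + t A_1(x), and
  t^6 = x^3, t^7 = x y. All these terms have a zero of second order at the origin, and the flat term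
  becomes a function of y with zero derivative; so \<open>E\<close> will not disturb the linear part
  of a map.\<close>

lemma function_of_pow_2_5:
  fixes R :: "real \<Rightarrow> real"
  assumes "smooth_germ R 0"
  obtains E :: "real^2 \<Rightarrow> real" where "smooth_germ E 0" "(E has_derivative (\<lambda>_. 0)) (at 0)"
    "\<forall>\<^sub>F t in nhds 0. t ^ 6 * R t = E (vector [t ^ 2, t ^ 5])"
proof -
  obtain e where e: "e > 0" "smooth_on (ball 0 e) R" using assms smooth_germ_iff_ball by blast
  have "(0::nat) < 2" by simp
  from residue_decomposition[OF e(2) this e(1)] obtain A where A: "\<And>i. smooth_on UNIV (A i)"
    "\<And>N. \<exists>g. smooth_on (ball 0 e) g \<and> (\<forall>t\<in>ball 0 e. R t - (\<Sum>i<2. t ^ i * A i (t ^ 2)) = t ^ N * g t)"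
    by blast
  let ?f = "\<lambda>t. t ^ 6 * (R t - (\<Sum>i<2. t ^ i * A i (t ^ 2)))"
  have "\<exists>g. smooth_on (ball 0 e) g \<and> (\<forall>t\<in>ball 0 e. ?f t = t ^ N * g t)" for N
  proof -
    obtain g where "smooth_on (ball 0 e) g" "\<forall>t\<in>ball 0 e. R t - (\<Sum>i<2. t ^ i * A i (t ^ 2)) = t ^ N * g t"
      using A(2) by blast
    then show ?thesis
      by (intro exI[of _ "\<lambda>t. t ^ 6 * g t"] conjI smooth_on_mult smooth_on_power smooth_on_id open_ball) auto
  qed
  from flat_function_of_odd_power[OF _ e(1) this, of 5] obtain W where
    W: "smooth_germ W 0" "(W has_real_derivative 0) (at 0)" "W 0 = 0" "\<And>t. W (t ^ 5) = ?f t" by auto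
  have A0: "smooth_germ (\<lambda>z::real^2. A i (z $ 1)) 0" for i
    by (rule smooth_germ_compose[OF smooth_germ_smooth_on[OF A(1) open_UNIV]])
       (auto intro: smooth_germ_vec_nth smooth_germ_id)
  let ?E = "\<lambda>z::real^2. (z $ 1 * z $ 1) * (z $ 1 * A 0 (z $ 1)) + (z $ 1 * z $ 2) * A 1 (z $ 1) + W (z $ 2)"
  show thesis
  proof (rule that[of ?E])
    have "smooth_germ (\<lambda>z::real^2. W (z $ 2)) 0"
      by (rule smooth_germ_compose) (auto intro: W(1) smooth_germ_vec_nth smooth_germ_id)
    then show "smooth_germ ?E 0"
      by (intro smooth_germ_add smooth_germ_mult smooth_germ_vec_nth[OF smooth_germ_id] A0)
    have sq: "((\<lambda>z::real^2. z $ i * z $ j) has_derivative (\<lambda>_. 0)) (at 0)" for i j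
      using has_derivative_mult[OF vec_nth_has_derivative[of i] vec_nth_has_derivative[of j], of 0] by simp
    have "(?E has_derivative (\<lambda>_. 0 + 0 + 0)) (at 0)"
      by (intro has_derivative_add has_derivative_zero_mult sq flat_nth_has_derivative W(2)
          smooth_germ_differentiable smooth_germ_mult smooth_germ_vec_nth[OF smooth_germ_id] A0) auto
    then show "(?E has_derivative (\<lambda>_. 0)) (at 0)" by simp
    have "t ^ 6 * R t = ?E (vector [t ^ 2, t ^ 5])" for t
    proof -
      have "(\<Sum>i<2. t ^ i * A i (t ^ 2)) = A 0 (t ^ 2) + t * A 1 (t ^ 2)"
        by (simp add: lessThan_nat_numeral)
      then show ?thesis unfolding vector_2 W(4) by (simp add: algebra_simps flip: power_add power_Suc)
    qed
    then show "\<forall>\<^sub>F t in nhds 0. t ^ 6 * R t = ?E (vector [t ^ 2, t ^ 5])" by simp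
  qed
qed

text \<open>With x = t^3 and y = t^5 the three residue classes are served by t^8 = x y, t^9 = x^3
  and t^10 = y^2. The exponent 8 is the first one beyond the last gap 7.\<close>

lemma function_of_pow_3_5:
  fixes R :: "real \<Rightarrow> real"
  assumes "smooth_germ R 0"
  obtains E :: "real^2 \<Rightarrow> real" where "smooth_germ E 0" "(E has_derivative (\<lambda>_. 0)) (at 0)"
    "\<forall>\<^sub>F t in nhds 0. t ^ 8 * R t = E (vector [t ^ 3, t ^ 5])"
proof -
  obtain e where e: "e > 0" "smooth_on (ball 0 e) R" using assms smooth_germ_iff_ball by blast
  have "(0::nat) < 3" by simp
  from residue_decomposition[OF e(2) this e(1)] obtain A where A: "\<And>i. smooth_on UNIV (A i)"
    "\<And>N. \<exists>g. smooth_on (ball 0 e) g \<and> (\<forall>t\<in>ball 0 e. R t - (\<Sum>i<3. t ^ i * A i (t ^ 3)) = t ^ N * g t)"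
    by blast
  let ?f = "\<lambda>t. t ^ 8 * (R t - (\<Sum>i<3. t ^ i * A i (t ^ 3)))"
  have "\<exists>g. smooth_on (ball 0 e) g \<and> (\<forall>t\<in>ball 0 e. ?f t = t ^ N * g t)" for N
  proof -
    obtain g where "smooth_on (ball 0 e) g" "\<forall>t\<in>ball 0 e. R t - (\<Sum>i<3. t ^ i * A i (t ^ 3)) = t ^ N * g t"
      using A(2) by blast
    then show ?thesis
      by (intro exI[of _ "\<lambda>t. t ^ 8 * g t"] conjI smooth_on_mult smooth_on_power smooth_on_id open_ball) auto
  qed
  from flat_function_of_odd_power[OF _ e(1) this, of 5] obtain W where
    W: "smooth_germ W 0" "(W has_real_derivative 0) (at 0)" "W 0 = 0" "\<And>t. W (t ^ 5) = ?f t" by auto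
  have A0: "smooth_germ (\<lambda>z::real^2. A i (z $ 1)) 0" for i
    by (rule smooth_germ_compose[OF smooth_germ_smooth_on[OF A(1) open_UNIV]])
       (auto intro: smooth_germ_vec_nth smooth_germ_id)
  let ?E = "\<lambda>z::real^2. (z $ 1 * z $ 2) * A 0 (z $ 1) + (z $ 1 * z $ 1) * (z $ 1 * A 1 (z $ 1))
    + (z $ 2 * z $ 2) * A 2 (z $ 1) + W (z $ 2)"
  show thesis
  proof (rule that[of ?E])
    have "smooth_germ (\<lambda>z::real^2. W (z $ 2)) 0"
      by (rule smooth_germ_compose) (auto intro: W(1) smooth_germ_vec_nth smooth_germ_id)
    then show "smooth_germ ?E 0"
      by (intro smooth_germ_add smooth_germ_mult smooth_germ_vec_nth[OF smooth_germ_id] A0)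
    have sq: "((\<lambda>z::real^2. z $ i * z $ j) has_derivative (\<lambda>_. 0)) (at 0)" for i j
      using has_derivative_mult[OF vec_nth_has_derivative[of i] vec_nth_has_derivative[of j], of 0] by simp
    have "(?E has_derivative (\<lambda>_. 0 + 0 + 0 + 0)) (at 0)"
      by (intro has_derivative_add has_derivative_zero_mult sq flat_nth_has_derivative W(2)
          smooth_germ_differentiable smooth_germ_mult smooth_germ_vec_nth[OF smooth_germ_id] A0) auto
    then show "(?E has_derivative (\<lambda>_. 0)) (at 0)" by simp
    have "t ^ 8 * R t = ?E (vector [t ^ 3, t ^ 5])" for t
    proof -
      have "(\<Sum>i<3. t ^ i * A i (t ^ 3)) = A 0 (t ^ 3) + t * A 1 (t ^ 3) + t ^ 2 * A 2 (t ^ 3)"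
        by (simp add: lessThan_nat_numeral)
      then show ?thesis unfolding vector_2 W(4) by (simp add: algebra_simps flip: power_add power_Suc)
    qed
    then show "\<forall>\<^sub>F t in nhds 0. t ^ 8 * R t = ?E (vector [t ^ 3, t ^ 5])" by simp
  qed
qed

subsection \<open>Inverse functions and diffeomorphism germs\<close>

text \<open>The inverse function theorem provides \<open>g\<close> with derivative
  \<open>I (g y)\<close>. If \<open>g\<close> is of class k, so is this derivative, hence
  \<open>g\<close> is of class k + 1. Supplying the inverse of the derivative explicitly as
  \<open>I\<close> avoids arguing that inversion of linear maps is smooth.\<close>

lemma smooth_inverse_function:
  fixes f :: "'a::euclidean_space \<Rightarrow> 'a"
  assumes U: "open U" "a \<in> U" and f: "smooth_on U f"
    and inv: "\<And>v. smooth_on U (\<lambda>x. I x v)" "\<And>x v. x \<in> U \<Longrightarrow> frechet_derivative f (at x) (I x v) = v"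
  shows "diffeo_germ f a (f a)"
proof -
  let ?L = "\<lambda>x. frechet_derivative f (at x)"
  let ?B = "\<lambda>x. Blinfun (?L x)"
  have bl: "bounded_linear (?L x)" if "x \<in> U" for x
    using smooth_on_has_derivative[OF f that] has_derivative_bounded_linear by blast
  have B: "blinfun_apply (?B x) = ?L x" if "x \<in> U" for x
    by (rule bounded_linear_Blinfun_apply[OF bl[OF that]])
  have surj: "surj (?L x)" if "x \<in> U" for x using inv(2)[OF that] by (metis surjI)
  have "continuous_on U ?B"
  proof (rule continuous_on_blinfun_componentwise)
    fix i :: 'a assume "i \<in> Basis"
    have "continuous_on U (\<lambda>x. ?L x i)"
      by (rule smooth_on_continuous_on[OF smooth_on_frechet_derivative[OF f]])
    then show "continuous_on U (\<lambda>x. blinfun_apply (?B x) i)"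
      using B by (simp cong: continuous_on_cong)
  qed
  moreover have lin: "linear (?L a)" using bl[OF U(2)] by (rule bounded_linear.linear)
  then have "inj (?L a)" using linear_surjective_imp_injective surj[OF U(2)] by blast
  then obtain M where M: "linear M" "M \<circ> ?L a = id"
    using linear_injective_left_inverse[OF lin] by blast
  have "Blinfun M o\<^sub>L ?B a = id_blinfun"
    using M by (intro blinfun_eqI) (simp add: B[OF U(2)] bounded_linear_Blinfun_apply
        linear_conv_bounded_linear pointfree_idE)
  moreover have "(f has_derivative blinfun_apply (?B x)) (at x)" if "x \<in> U" for x
    using smooth_on_has_derivative[OF f that] B[OF that] by simp
  ultimately obtain U' V g g' where W: "open U'" "U' \<subseteq> U" "a \<in> U'" "open V" "f a \<in> V"
    "homeomorphism U' V f g" and g: "\<And>y. y \<in> V \<Longrightarrow> (g has_derivative (g' y)) (at y)"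
    "\<And>y. y \<in> V \<Longrightarrow> g' y = Hilbert_Choice.inv (blinfun_apply (?B (g y)))"
    "\<And>y. y \<in> V \<Longrightarrow> bij (blinfun_apply (?B (g y)))"
    using inverse_function_theorem[of U f ?B a "Blinfun M"] U by metis
  have gV: "g ` V \<subseteq> U" using W(2,6) by (auto simp: homeomorphism_def)
  have dg: "(g has_derivative I (g y)) (at y)" if y: "y \<in> V" for y
  proof -
    have gy: "g y \<in> U" using gV y by blast
    have "g' y = I (g y)"
      using g(2,3)[OF y] inv(2)[OF gy] B[OF gy] by (intro ext) (metis bij_inv_eq_iff)
    then show ?thesis using g(1)[OF y] by simp
  qed
  have "Ck_on k V g" for k
  proof (induction k)
    case 0
    then show ?case using W(6) by (simp add: homeomorphism_def)
  next
    case (Suc k)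
    show ?case
    proof (rule Ck_on_SucI[OF W(4) dg])
      show "Ck_on k V (\<lambda>x. I (g x) v)" for v
        by (rule Ck_on_compose[OF W(4) U(1) _ Suc gV]) (use inv(1) in \<open>simp add: smooth_on_def\<close>)
    qed
  qed
  then have "smooth_on V g" by (simp add: smooth_on_def)
  moreover have "smooth_on U' f" using smooth_on_subset[OF f W(2)] .
  ultimately show ?thesis
    unfolding diffeo_germ_def using W unfolding homeomorphism_def by blast
qed

lemma smooth_germ_eventually_nonzero:
  fixes f :: "'a::euclidean_space \<Rightarrow> real"
  assumes "smooth_germ f a" "f a \<noteq> 0"
  shows "\<forall>\<^sub>F x in nhds a. f x \<noteq> 0"
proof (rule tendsto_imp_eventually_ne[OF _ assms(2)])
  show "(f \<longlongrightarrow> f a) (nhds a)"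
    using smooth_germ_isCont[OF assms(1)] by (simp add: isCont_def tendsto_at_iff_tendsto_nhds)
qed

lemma diffeo_germ_real:
  fixes f :: "real \<Rightarrow> real"
  assumes "smooth_germ f a" "deriv f a \<noteq> 0"
  shows "diffeo_germ f a (f a)"
proof -
  have "smooth_germ (\<lambda>x. inverse (deriv f x)) a"
    by (intro smooth_germ_inverse smooth_germ_deriv assms)
  moreover have "\<forall>\<^sub>F x in nhds a. deriv f x \<noteq> 0 \<and> smooth_germ f x"
    by (intro eventually_conj smooth_germ_eventually smooth_germ_eventually_nonzero smooth_germ_deriv assms)
  ultimately obtain e where e: "e > 0" "smooth_on (ball a e) (\<lambda>x. inverse (deriv f x))"
    "\<And>x. x \<in> ball a e \<Longrightarrow> deriv f x \<noteq> 0 \<and> smooth_germ f x"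
    using smooth_germ_ball_eventually by blast
  obtain d where d: "d > 0" "smooth_on (ball a d) f" using assms(1) smooth_germ_iff_ball by blast
  let ?U = "ball a (min d e)"
  show ?thesis
  proof (rule smooth_inverse_function[where U = ?U and I = "\<lambda>x v. v * inverse (deriv f x)"])
    show "smooth_on ?U f" by (rule smooth_on_subset[OF d(2)]) auto
    show "smooth_on ?U (\<lambda>x. v * inverse (deriv f x))" for v
      by (intro smooth_on_mult smooth_on_const smooth_on_subset[OF e(2)]) auto
    fix x v assume "x \<in> ?U"
    then have x: "deriv f x \<noteq> 0" "smooth_germ f x" using e(3) by auto
    have "frechet_derivative f (at x) = (*) (deriv f x)"
      using frechet_derivative_at[of f "(*) (deriv f x)" x] smooth_germ_DERIV[OF x(2)] by (simp add: has_field_derivative_def)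
    then show "frechet_derivative f (at x) (v * inverse (deriv f x)) = v" using x(1) by simp
  qed (use d e in auto)
qed

text \<open>The 2 by 2 determinant as a function of two vectors, so that the rules for bilinear maps
  apply to it.\<close>

definition wedge :: "real^2 \<Rightarrow> real^2 \<Rightarrow> real" where
  "wedge x y = x $ 1 * y $ 2 - x $ 2 * y $ 1"

lemma bounded_bilinear_wedge: "bounded_bilinear wedge"
proof -
  have w: "wedge = (\<lambda>x y. x \<bullet> (vector [y $ 2, - y $ 1] :: real^2))"
    by (simp add: fun_eq_iff wedge_def inner_vec_def sum_2)
  have "bounded_linear (\<lambda>y::real^2. vector [y $ 2, - y $ 1] :: real^2)"
    by (intro linear_conv_bounded_linear[THEN iffD1] linearI) (auto simp: vec_eq_iff forall_2)
  then show ?thesis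
    unfolding w by (intro bounded_bilinear.comp[OF bounded_bilinear_inner bounded_linear_ident])
qed

lemma diffeo_germ_plane:
  fixes f :: "real^2 \<Rightarrow> real^2"
  assumes "smooth_germ f a"
    and "wedge (frechet_derivative f (at a) (axis 1 1)) (frechet_derivative f (at a) (axis 2 1)) \<noteq> 0"
  shows "diffeo_germ f a (f a)"
proof -
  obtain d where d: "d > 0" "smooth_on (ball a d) f" using assms(1) smooth_germ_iff_ball by blast
  define J1 where "J1 = (\<lambda>x. frechet_derivative f (at x) (axis 1 1))"
  define J2 where "J2 = (\<lambda>x. frechet_derivative f (at x) (axis 2 1))"
  have J: "smooth_germ J1 a" "smooth_germ J2 a"
    unfolding J1_def J2_def
    by (rule smooth_germ_smooth_on[OF smooth_on_frechet_derivative[OF d(2)]]; use d in simp)+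
  let ?d = "\<lambda>x. wedge (J1 x) (J2 x)"
  have sd: "smooth_germ ?d a" by (intro smooth_germ_bounded_bilinear[OF bounded_bilinear_wedge] J)
  have d0: "?d a \<noteq> 0" using assms(2) by (simp add: J1_def J2_def)
  \<comment> \<open>The columns of the inverse Jacobian matrix, by Cramer's rule.\<close>
  let ?I1 = "\<lambda>x. inverse (?d x) *\<^sub>R (vector [J2 x $ 2, - J1 x $ 2] :: real^2)"
  let ?I2 = "\<lambda>x. inverse (?d x) *\<^sub>R (vector [- J2 x $ 1, J1 x $ 1] :: real^2)"
  have vec: "(vector [p, q] :: real^2) = p *\<^sub>R axis 1 1 + q *\<^sub>R axis 2 1" for p q
    by (simp add: vec_eq_iff forall_2 axis_def)
  have I: "smooth_germ ?I1 a" "smooth_germ ?I2 a"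
    unfolding vec by (intro smooth_germ_scaleR smooth_germ_add smooth_germ_inverse smooth_germ_minus
        smooth_germ_vec_nth smooth_germ_const J sd d0)+
  have "\<forall>\<^sub>F x in nhds a. ?d x \<noteq> 0"
    by (rule smooth_germ_eventually_nonzero[OF sd d0])
  then obtain e0 where e0: "e0 > 0" "smooth_on (ball a e0) f" "\<And>x. x \<in> ball a e0 \<Longrightarrow> ?d x \<noteq> 0"
    using smooth_germ_ball_eventually[OF assms(1)] by blast
  obtain e where e: "e > 0" "smooth_on (ball a e) ?I1" "smooth_on (ball a e) ?I2"
    using smooth_germ_common_ball[OF I] by blast
  let ?U = "ball a (min e0 e)"
  show ?thesis
  proof (rule smooth_inverse_function[where U = ?U and I = "\<lambda>x v. (v $ 1) *\<^sub>R ?I1 x + (v $ 2) *\<^sub>R ?I2 x"])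
    show "smooth_on ?U f" by (rule smooth_on_subset[OF e0(2)]) auto
    have "smooth_on ?U ?I1" "smooth_on ?U ?I2"
      by (rule smooth_on_subset[OF e(2)] smooth_on_subset[OF e(3)]; auto)+
    then show "smooth_on ?U (\<lambda>x. (v $ 1) *\<^sub>R ?I1 x + (v $ 2) *\<^sub>R ?I2 x)" for v
      by (intro smooth_on_add smooth_on_scaleR[OF smooth_on_const] open_ball)
    fix x and v :: "real^2" assume x: "x \<in> ?U"
    then have dx: "?d x \<noteq> 0" using e0(3) by auto
    interpret L: linear "frechet_derivative f (at x)"
      using smooth_on_has_derivative[OF e0(2)] x has_derivative_linear by auto
    let ?a = "inverse (?d x) * (v $ 1 * J2 x $ 2 - v $ 2 * J2 x $ 1)"
    let ?b = "inverse (?d x) * (v $ 2 * J1 x $ 1 - v $ 1 * J1 x $ 2)"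
    have "(v $ 1) *\<^sub>R ?I1 x + (v $ 2) *\<^sub>R ?I2 x = ?a *\<^sub>R axis 1 1 + ?b *\<^sub>R axis 2 1"
      by (simp add: vec_eq_iff forall_2 axis_def algebra_simps)
    then have "frechet_derivative f (at x) ((v $ 1) *\<^sub>R ?I1 x + (v $ 2) *\<^sub>R ?I2 x) =
        ?a *\<^sub>R J1 x + ?b *\<^sub>R J2 x"
      by (simp only: L.add L.scale J1_def J2_def)
    also have "\<dots> = v"
    proof -
      have "inverse (?d x) * (v $ 1 * J2 x $ 2 - v $ 2 * J2 x $ 1) * J1 x $ 1
          + inverse (?d x) * (v $ 2 * J1 x $ 1 - v $ 1 * J1 x $ 2) * J2 x $ 1 = inverse (?d x) * (?d x * v $ 1)"
        by (simp add: wedge_def algebra_simps)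
      moreover have "inverse (?d x) * (v $ 1 * J2 x $ 2 - v $ 2 * J2 x $ 1) * J1 x $ 2
          + inverse (?d x) * (v $ 2 * J1 x $ 1 - v $ 1 * J1 x $ 2) * J2 x $ 2 = inverse (?d x) * (?d x * v $ 2)"
        by (simp add: wedge_def algebra_simps)
      ultimately show ?thesis using dx by (simp add: vec_eq_iff forall_2)
    qed
    finally show "frechet_derivative f (at x) ((v $ 1) *\<^sub>R ?I1 x + (v $ 2) *\<^sub>R ?I2 x) = v" .
  qed (use e e0 in auto)
qed

subsection \<open>Recognising cusps from expansions\<close>

lemma diffeo_germ_linear_part:
  fixes E :: "real^2 \<Rightarrow> real^2"
  assumes "smooth_germ E 0" "(E has_derivative (\<lambda>_. 0)) (at 0)" "wedge u v \<noteq> 0"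
  defines "F \<equiv> \<lambda>z. z $ 1 *\<^sub>R u + z $ 2 *\<^sub>R v + E z"
  shows "diffeo_germ F 0 (F 0)"
proof (rule diffeo_germ_plane)
  show "smooth_germ F 0"
    unfolding F_def by (intro smooth_germ_add smooth_germ_scaleR smooth_germ_vec_nth[OF smooth_germ_id]
        smooth_germ_const assms(1))
  have "(F has_derivative (\<lambda>h. h $ 1 *\<^sub>R u + h $ 2 *\<^sub>R v + 0)) (at 0)"
    unfolding F_def
    by (intro has_derivative_add assms(2) has_derivative_scaleR_left vec_nth_has_derivative)
  then have "frechet_derivative F (at 0) = (\<lambda>h. h $ 1 *\<^sub>R u + h $ 2 *\<^sub>R v)"
    using frechet_derivative_at by fastforce
  then show "wedge (frechet_derivative F (at 0) (axis 1 1)) (frechet_derivative F (at 0) (axis 2 1)) \<noteq> 0"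
    using assms(3) by (simp add: axis_def)
qed

lemma diffeo_germ_sym:
  assumes "diffeo_germ f a b"
  obtains g where "diffeo_germ g b a" "\<forall>\<^sub>F x in nhds a. g (f x) = x" "\<forall>\<^sub>F y in nhds b. f (g y) = y"
proof -
  obtain U V g where *: "f a = b" "open U" "a \<in> U" "open V" "b \<in> V" "f ` U = V" "g ` V = U"
    "\<forall>x\<in>U. g (f x) = x" "\<forall>y\<in>V. f (g y) = y" "smooth_on U f" "smooth_on V g"
    using assms unfolding diffeo_germ_def by blast
  show thesis
  proof (rule that[of g])
    show "diffeo_germ g b a" unfolding diffeo_germ_def using * by metis
  qed (use * in \<open>auto simp: eventually_nhds\<close>)
qed

lemma diffeo_germ_smooth_germ: "diffeo_germ f a b \<Longrightarrow> smooth_germ f a"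
  unfolding diffeo_germ_def smooth_germ_def by blast

text \<open>An expansion naturally yields a map from the plane of the model to that of the curve.
  The definition of equivalence asks for the opposite direction, so \<open>F\<close> is inverted
  here once and for all.\<close>

lemma curve_germs_equivalentI:
  assumes "diffeo_germ \<phi> 0 0" "diffeo_germ F 0 (f 0)" "\<forall>\<^sub>F t in nhds 0. f (\<phi> t) = F (g t)"
    and "isCont g 0" "g 0 = 0"
  shows "curve_germs_equivalent f g"
proof -
  obtain G where G: "diffeo_germ G (f 0) 0" "\<forall>\<^sub>F x in nhds 0. G (F x) = x"
    using diffeo_germ_sym[OF assms(2)] by metis
  have "filterlim g (nhds 0) (nhds 0)"
    using assms(4,5) by (metis isCont_def tendsto_at_iff_tendsto_nhds)
  then have "\<forall>\<^sub>F t in nhds 0. G (F (g t)) = g t" by (rule eventually_compose_filterlim[OF G(2)])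
  with assms(3) have "\<forall>\<^sub>F t in nhds 0. G (f (\<phi> t)) = g t" by eventually_elim simp
  then show ?thesis unfolding curve_germs_equivalent_def using assms(1,5) G(1) by metis
qed

lemma vector_has_derivative_zero:
  fixes E1 E2 :: "'a::real_normed_vector \<Rightarrow> real"
  assumes "(E1 has_derivative (\<lambda>_. 0)) (at a)" "(E2 has_derivative (\<lambda>_. 0)) (at a)"
  shows "((\<lambda>z. E1 z *\<^sub>R axis 1 1 + E2 z *\<^sub>R axis 2 1 :: real^2) has_derivative (\<lambda>_. 0)) (at a)"
  using has_derivative_add[OF has_derivative_scaleR_left[OF assms(1), of "axis 1 1"]
      has_derivative_scaleR_left[OF assms(2), of "axis 2 1"]] by simp

lemma square_vec_nth_has_derivative:
  "((\<lambda>z::real^2. (z $ i) ^ 2 *\<^sub>R c) has_derivative (\<lambda>_. 0)) (at 0)"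
proof -
  have "((\<lambda>z::real^2. (z $ i) ^ 2) has_derivative (\<lambda>_. 0)) (at 0)"
    using has_derivative_mult[OF vec_nth_has_derivative[of i] vec_nth_has_derivative[of i], of 0]
    by (simp add: power2_eq_square)
  from has_derivative_scaleR_left[OF this, of c] show ?thesis by simp
qed

lemma isCont_monomial_curve: "isCont (\<lambda>t::real. vector [t ^ p, t ^ q] :: real^2) 0"
proof -
  have "(\<lambda>t::real. vector [t ^ p, t ^ q] :: real^2) = (\<lambda>t. t ^ p *\<^sub>R axis 1 1 + t ^ q *\<^sub>R axis 2 1)"
    by (auto simp: vec_eq_iff forall_2 axis_def)
  then show ?thesis by (simp add: continuous_intros)
qed

text \<open>In x = t^2 and y = t^5 the right-hand side reads c0 + x c2 + y c5 + x^2 c4 plus terms of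
  zero derivative, so \<open>wedge c2 c5\<close> is the Jacobian determinant at the origin. Only the
  gap 3 is absent from the expansion.\<close>

lemma cusp_5_2_if_expansion:
  assumes "diffeo_germ \<phi> 0 0" "smooth_germ R 0" "wedge c2 c5 \<noteq> 0"
    and ex: "\<forall>\<^sub>F t in nhds 0. f (\<phi> t) = c0 + t ^ 2 *\<^sub>R c2 + t ^ 4 *\<^sub>R c4 + t ^ 5 *\<^sub>R c5 + t ^ 6 *\<^sub>R R t"
  shows "cusp_5_2 f"
proof -
  let ?c = "\<lambda>t::real. vector [t ^ 2, t ^ 5] :: real^2"
  obtain E1 where E1: "smooth_germ E1 0" "(E1 has_derivative (\<lambda>_. 0)) (at 0)"
    "\<forall>\<^sub>F t in nhds 0. t ^ 6 * R t $ 1 = E1 (?c t)"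
    using function_of_pow_2_5[OF smooth_germ_vec_nth[OF assms(2)]] by blast
  obtain E2 where E2: "smooth_germ E2 0" "(E2 has_derivative (\<lambda>_. 0)) (at 0)"
    "\<forall>\<^sub>F t in nhds 0. t ^ 6 * R t $ 2 = E2 (?c t)"
    using function_of_pow_2_5[OF smooth_germ_vec_nth[OF assms(2)]] by blast
  let ?E = "\<lambda>z. c0 + (z $ 1) ^ 2 *\<^sub>R c4 + (E1 z *\<^sub>R axis 1 1 + E2 z *\<^sub>R axis 2 1)"
  let ?F = "\<lambda>z. z $ 1 *\<^sub>R c2 + z $ 2 *\<^sub>R c5 + ?E z"
  have "smooth_germ ?E 0"
    by (intro smooth_germ_add smooth_germ_scaleR smooth_germ_const E1 E2 smooth_germ_power
        smooth_germ_vec_nth[OF smooth_germ_id])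
  moreover have "(?E has_derivative (\<lambda>_. 0 + 0 + 0)) (at 0)"
    by (intro has_derivative_add has_derivative_const square_vec_nth_has_derivative
        vector_has_derivative_zero E1 E2)
  ultimately have F: "diffeo_germ ?F 0 (?F 0)"
    using diffeo_germ_linear_part[OF _ _ assms(3), of ?E] by simp
  have fF: "\<forall>\<^sub>F t in nhds 0. f (\<phi> t) = ?F (?c t)"
    using ex E1(3) E2(3)
  proof eventually_elim
    case (elim t)
    then show ?case
      by (simp add: vec_eq_iff forall_2 axis_def power_mult[symmetric])
  qed
  have c0: "?c 0 = 0" by (simp add: vec_eq_iff forall_2)
  have "\<phi> 0 = 0" using assms(1) by (simp add: diffeo_germ_def)
  then have "f 0 = ?F 0" using eventually_nhds_x_imp_x[OF fF] c0 by metis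
  then show ?thesis
    unfolding cusp_5_2_def
    by (intro curve_germs_equivalentI[OF assms(1) _ fF isCont_monomial_curve c0]) (use F in argo)
qed

text \<open>Here x = t^3, y = t^5 and t^6 = x^2, and the exponents missing from the expansion are
  the gaps 4 and 7 (besides 1 and 2).\<close>

lemma cusp_5_3_if_expansion:
  assumes "diffeo_germ \<phi> 0 0" "smooth_germ R 0" "wedge c3 c5 \<noteq> 0"
    and ex: "\<forall>\<^sub>F t in nhds 0. f (\<phi> t) = c0 + t ^ 3 *\<^sub>R c3 + t ^ 5 *\<^sub>R c5 + t ^ 6 *\<^sub>R c6 + t ^ 8 *\<^sub>R R t"
  shows "cusp_5_3 f"
proof -
  let ?c = "\<lambda>t::real. vector [t ^ 3, t ^ 5] :: real^2"
  obtain E1 where E1: "smooth_germ E1 0" "(E1 has_derivative (\<lambda>_. 0)) (at 0)"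
    "\<forall>\<^sub>F t in nhds 0. t ^ 8 * R t $ 1 = E1 (?c t)"
    using function_of_pow_3_5[OF smooth_germ_vec_nth[OF assms(2)]] by blast
  obtain E2 where E2: "smooth_germ E2 0" "(E2 has_derivative (\<lambda>_. 0)) (at 0)"
    "\<forall>\<^sub>F t in nhds 0. t ^ 8 * R t $ 2 = E2 (?c t)"
    using function_of_pow_3_5[OF smooth_germ_vec_nth[OF assms(2)]] by blast
  let ?E = "\<lambda>z. c0 + (z $ 1) ^ 2 *\<^sub>R c6 + (E1 z *\<^sub>R axis 1 1 + E2 z *\<^sub>R axis 2 1)"
  let ?F = "\<lambda>z. z $ 1 *\<^sub>R c3 + z $ 2 *\<^sub>R c5 + ?E z"
  have "smooth_germ ?E 0"
    by (intro smooth_germ_add smooth_germ_scaleR smooth_germ_const E1 E2 smooth_germ_power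
        smooth_germ_vec_nth[OF smooth_germ_id])
  moreover have "(?E has_derivative (\<lambda>_. 0 + 0 + 0)) (at 0)"
    by (intro has_derivative_add has_derivative_const square_vec_nth_has_derivative
        vector_has_derivative_zero E1 E2)
  ultimately have F: "diffeo_germ ?F 0 (?F 0)"
    using diffeo_germ_linear_part[OF _ _ assms(3), of ?E] by simp
  have fF: "\<forall>\<^sub>F t in nhds 0. f (\<phi> t) = ?F (?c t)"
    using ex E1(3) E2(3)
  proof eventually_elim
    case (elim t)
    then show ?case
      by (simp add: vec_eq_iff forall_2 axis_def power_mult[symmetric])
  qed
  have c0: "?c 0 = 0" by (simp add: vec_eq_iff forall_2)
  have "\<phi> 0 = 0" using assms(1) by (simp add: diffeo_germ_def)
  then have "f 0 = ?F 0" using eventually_nhds_x_imp_x[OF fF] c0 by metis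
  then show ?thesis
    unfolding cusp_5_3_def
    by (intro curve_germs_equivalentI[OF assms(1) _ fF isCont_monomial_curve c0]) (use F in argo)
qed

section \<open>Taylor expansions of germs, and their normalisation by polynomial
  substitutions\<close>

lemma eventually_nhds_ball: "e > 0 \<Longrightarrow> \<forall>x\<in>ball a e. P x \<Longrightarrow> \<forall>\<^sub>F x in nhds a. P x"
  unfolding eventually_nhds by (meson centre_in_ball open_ball)

lemma smooth_germ_taylor:
  fixes f :: "real \<Rightarrow> real"
  assumes "smooth_germ f 0"
  obtains g where "smooth_germ g 0"
    "\<forall>\<^sub>F t in nhds 0. f t = (\<Sum>n<N. t ^ n / fact n * (deriv ^^ n) f 0) + t ^ N * g t"
proof -
  obtain e where e: "e > 0" "smooth_on (ball 0 e) f" using assms smooth_germ_iff_ball by blast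
  have "((deriv ^^ n) f has_vector_derivative (deriv ^^ Suc n) f t) (at t)" if "t \<in> ball 0 e" for n t
    using smooth_germ_DERIV[OF smooth_germ_deriv_funpow[OF smooth_germ_smooth_on[OF e(2) open_ball that]]]
    by (simp add: has_real_derivative_iff_has_vector_derivative)
  from taylor_smooth_remainder[of e "\<lambda>n. (deriv ^^ n) f" N, OF this] obtain g where
    "smooth_on (ball 0 e) g"
    "\<forall>t\<in>ball 0 e. f t = (\<Sum>n<N. t ^ n / fact n * (deriv ^^ n) f 0) + t ^ N * g t" by auto
  with e(1) show thesis
    by (intro that[of g]) (auto simp: smooth_germ_iff_ball eventually_nhds intro!: exI[of _ "ball 0 e"])
qed

lemma smooth_germ_taylor_vector:
  fixes f :: "real \<Rightarrow> 'b::euclidean_space"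
  assumes "smooth_germ f 0"
  obtains c g where "smooth_germ g 0" "\<forall>\<^sub>F t in nhds 0. f t = (\<Sum>n<N. t ^ n *\<^sub>R c n) + t ^ N *\<^sub>R g t"
proof -
  obtain e where e: "e > 0" "smooth_on (ball 0 e) f" using assms smooth_germ_iff_ball by blast
  obtain D where D: "D 0 = f" "\<And>n t. t \<in> ball 0 e \<Longrightarrow> (D n has_vector_derivative D (Suc n) t) (at t)"
    using smooth_on_derivative_sequenceE[OF e(2) open_ball] by blast
  from taylor_smooth_remainder[of e D N, OF D(2)] obtain g where
    g: "smooth_on (ball 0 e) g"
    "\<forall>t\<in>ball 0 e. f t = (\<Sum>n<N. (t ^ n / fact n) *\<^sub>R D n 0) + t ^ N *\<^sub>R g t"
    unfolding D(1) by blast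
  show thesis
  proof (rule that[of g "\<lambda>n. D n 0 /\<^sub>R fact n"])
    show "smooth_germ g 0" using e(1) g(1) smooth_germ_iff_ball by blast
    show "\<forall>\<^sub>F t in nhds 0. f t = (\<Sum>n<N. t ^ n *\<^sub>R (D n 0 /\<^sub>R fact n)) + t ^ N *\<^sub>R g t"
      using g(2) e(1) by (auto simp: eventually_nhds divide_inverse mult.commute intro!: exI[of _ "ball 0 e"])
  qed
qed

lemma antiderivative_power_germ:
  fixes h :: "real \<Rightarrow> 'b::euclidean_space"
  assumes "smooth_germ R 0" "\<forall>\<^sub>F t in nhds 0. (h has_vector_derivative t ^ N *\<^sub>R R t) (at t)"
  obtains g where "smooth_germ g 0" "\<forall>\<^sub>F t in nhds 0. h t = h 0 + t ^ Suc N *\<^sub>R g t"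
proof -
  obtain e where e: "e > 0" "smooth_on (ball 0 e) R"
    "\<And>t. t \<in> ball 0 e \<Longrightarrow> (h has_vector_derivative t ^ N *\<^sub>R R t) (at t)"
    using smooth_germ_ball_eventually[OF assms] by blast
  obtain g where g: "smooth_on (ball 0 e) g" "\<forall>t\<in>ball 0 e. h t = h 0 + t ^ Suc N *\<^sub>R g t"
    using antiderivative_power_expansion[OF e(2,3)] by blast
  show thesis
  proof (rule that[of g])
    show "smooth_germ g 0" using e(1) g(1) smooth_germ_iff_ball by blast
    show "\<forall>\<^sub>F t in nhds 0. h t = h 0 + t ^ Suc N *\<^sub>R g t"
      using e(1) g(2) by (rule eventually_nhds_ball)
  qed
qed

lemmas smooth_germ_intros = smooth_germ_add smooth_germ_diff smooth_germ_minus smooth_germ_scaleR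
  smooth_germ_mult smooth_germ_power smooth_germ_const smooth_germ_id

lemma filterlim_nhds_0_smooth_germ:
  assumes "smooth_germ \<phi> 0" "\<phi> 0 = 0"
  shows "filterlim \<phi> (nhds 0) (nhds 0)"
  using smooth_germ_isCont[OF assms(1)] assms(2) by (metis isCont_def tendsto_at_iff_tendsto_nhds)

text \<open>The reparametrisation \<open>t + a t\<^sup>2\<close> removes the term of order \<open>3\<close>.\<close>

lemma cusp_5_2_criterion:
  fixes f :: "real \<Rightarrow> real^2"
  assumes R: "smooth_germ R 0" and w: "wedge c2 ((4 * a) *\<^sub>R c4 + c5) \<noteq> 0"
    and ex: "\<forall>\<^sub>F t in nhds 0. f t = c0 + t ^ 2 *\<^sub>R c2 + t ^ 3 *\<^sub>R (- 2 * a) *\<^sub>R c2 + t ^ 4 *\<^sub>R c4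
      + t ^ 5 *\<^sub>R c5 + t ^ 6 *\<^sub>R R t"
  shows "cusp_5_2 f"
proof -
  let ?\<phi> = "\<lambda>t. t + a * t ^ 2"
  have s\<phi>: "smooth_germ ?\<phi> 0" by (intro smooth_germ_intros)
  have "deriv ?\<phi> 0 = 1" by (rule DERIV_imp_deriv) (auto intro!: derivative_eq_intros)
  then have \<phi>: "diffeo_germ ?\<phi> 0 0" using diffeo_germ_real[OF s\<phi>] by simp
  \<comment> \<open>The coefficients after substitution. Apart from multiples of \<open>c2\<close>,
    which the wedge with \<open>c2\<close> ignores, the only change in order 5 is
    \<open>4 * a\<close> times \<open>c4\<close>, from (t + a t^2)^4 = t^4 + 4 a t^5 + .... This is
    the source of the combination in the hypothesis; \<open>?S\<close> gathers the orders from 6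
    on.\<close>
  let ?d4 = "(- 5 * a ^ 2) *\<^sub>R c2 + c4" and ?d5 = "(- 6 * a ^ 3) *\<^sub>R c2 + ((4 * a) *\<^sub>R c4 + c5)"
  let ?S = "\<lambda>t. (- 2 * a ^ 4) *\<^sub>R c2 + (6 * a ^ 2 + 4 * a ^ 3 * t + a ^ 4 * t ^ 2) *\<^sub>R c4
    + (5 * a + 10 * a ^ 2 * t + 10 * a ^ 3 * t ^ 2 + 5 * a ^ 4 * t ^ 3 + a ^ 5 * t ^ 4) *\<^sub>R c5
    + (1 + a * t) ^ 6 *\<^sub>R R (?\<phi> t)"
  have lim: "filterlim ?\<phi> (nhds 0) (nhds 0)" by (rule filterlim_nhds_0_smooth_germ[OF s\<phi>]) simp
  have "smooth_germ (\<lambda>t. R (?\<phi> t)) 0" by (rule smooth_germ_compose[OF _ s\<phi>]) (simp add: R)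
  then have S: "smooth_germ ?S 0" by (intro smooth_germ_intros)
  have "\<forall>\<^sub>F t in nhds 0. f (?\<phi> t) = c0 + t ^ 2 *\<^sub>R c2 + t ^ 4 *\<^sub>R ?d4 + t ^ 5 *\<^sub>R ?d5 + t ^ 6 *\<^sub>R ?S t"
    using eventually_compose_filterlim[OF ex lim]
  proof eventually_elim
    case (elim t)
    show ?case unfolding elim vec_eq_iff vector_add_component vector_scaleR_component real_scaleR_def
      by (intro allI) algebra
  qed
  moreover have "wedge c2 ?d5 \<noteq> 0" using w by (simp add: wedge_def algebra_simps)
  ultimately show ?thesis by (rule cusp_5_2_if_expansion[OF \<phi> S, rotated])
qed

lemma basis_of_wedge:
  assumes "wedge u v \<noteq> 0"
  obtains a b where "w = a *\<^sub>R u + b *\<^sub>R v"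
proof (rule that)
  have "w $ 1 * wedge u v = wedge w v * u $ 1 + wedge u w * v $ 1"
    "w $ 2 * wedge u v = wedge w v * u $ 2 + wedge u w * v $ 2"
    by (simp_all add: wedge_def algebra_simps)
  then show "w = (wedge w v / wedge u v) *\<^sub>R u + (wedge u w / wedge u v) *\<^sub>R v"
    using assms by (simp add: vec_eq_iff forall_2 field_simps)
qed

text \<open>The reparametrisation \<open>t + b t\<^sup>3 + d t\<^sup>5\<close> removes the term of order \<open>7\<close>, the last gap of the
  semigroup generated by \<open>3\<close> and \<open>5\<close>.\<close>

lemma cusp_5_3_if_expansion_7:
  fixes f :: "real \<Rightarrow> real^2"
  assumes \<psi>: "smooth_germ \<psi> 0" "\<psi> 0 = 0" "deriv \<psi> 0 \<noteq> 0"
    and R: "smooth_germ R 0" and w: "wedge c3 c5 \<noteq> 0"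
    and ex: "\<forall>\<^sub>F t in nhds 0. f (\<psi> t) = c0 + t ^ 3 *\<^sub>R c3 + t ^ 5 *\<^sub>R c5 + t ^ 6 *\<^sub>R c6 + t ^ 7 *\<^sub>R c7
      + t ^ 8 *\<^sub>R R t"
  shows "cusp_5_3 f"
proof -
  obtain x y where c7: "c7 = x *\<^sub>R c3 + y *\<^sub>R c5" using basis_of_wedge[OF w] by blast
  \<comment> \<open>In order 7 the cube of the substitution contributes (3 d + 3 b^2) c3 and its
    fifth power 5 b c5, while \<open>c7\<close> is x c3 + y c5. The choices of \<open>b\<close> and
    \<open>d\<close> cancel both components.\<close>
  define b where "b = - y / 5"
  define d where "d = - x / 3 - b ^ 2"
  have xy: "x = - 3 * (d + b ^ 2)" "y = - 5 * b" by (simp_all add: b_def d_def)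
  let ?\<phi> = "\<lambda>t. t + b * t ^ 3 + d * t ^ 5"
  have s\<phi>: "smooth_germ ?\<phi> 0" by (intro smooth_germ_intros)
  have d\<phi>: "(?\<phi> has_real_derivative 1) (at 0)" by (auto intro!: derivative_eq_intros)
  \<comment> \<open>The substitution \<open>\<psi>\<close> made beforehand is carried along, so that
    the two steps compose to a single change of parameter.\<close>
  have s\<psi>: "smooth_germ (\<lambda>t. \<psi> (?\<phi> t)) 0" by (rule smooth_germ_compose[OF _ s\<phi>]) (simp add: \<psi>)
  have "(\<psi> has_real_derivative deriv \<psi> 0) (at (?\<phi> 0))" using smooth_germ_DERIV[OF \<psi>(1)] by simp
  from DERIV_chain2[OF this d\<phi>] have "deriv (\<lambda>t. \<psi> (?\<phi> t)) 0 \<noteq> 0"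
    using \<psi>(3) DERIV_imp_deriv by fastforce
  then have diff: "diffeo_germ (\<lambda>t. \<psi> (?\<phi> t)) 0 0" using diffeo_germ_real[OF s\<psi>] \<psi>(2) by simp
  let ?u = "\<lambda>t. b * t ^ 2 + d * t ^ 4" and ?v = "\<lambda>t. b + d * t ^ 2"
  let ?P3 = "\<lambda>t. 6 * b * d + 3 * d ^ 2 * t ^ 2 + ?v t ^ 3"
  let ?P5 = "\<lambda>t. 5 * d + ?v t ^ 2 * (10 + 10 * ?u t + 5 * ?u t ^ 2 + ?u t ^ 3)"
  let ?P6 = "\<lambda>t. ?v t * (6 + 15 * ?u t + 20 * ?u t ^ 2 + 15 * ?u t ^ 3 + 6 * ?u t ^ 4 + ?u t ^ 5)"
  let ?P7 = "\<lambda>t. ?v t * (7 + 21 * ?u t + 35 * ?u t ^ 2 + 35 * ?u t ^ 3 + 21 * ?u t ^ 4 + 7 * ?u t ^ 5 + ?u t ^ 6)"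
  let ?S = "\<lambda>t. (t * ?P3 t) *\<^sub>R c3 + (t * ?P5 t) *\<^sub>R c5 + ?P6 t *\<^sub>R c6 + (t * ?P7 t) *\<^sub>R c7
    + (1 + ?u t) ^ 8 *\<^sub>R R (?\<phi> t)"
  have lim: "filterlim ?\<phi> (nhds 0) (nhds 0)" by (rule filterlim_nhds_0_smooth_germ[OF s\<phi>]) simp
  have "smooth_germ (\<lambda>t. R (?\<phi> t)) 0" by (rule smooth_germ_compose[OF _ s\<phi>]) (simp add: R)
  then have S: "smooth_germ ?S 0" by (intro smooth_germ_intros)
  have "\<forall>\<^sub>F t in nhds 0. f (\<psi> (?\<phi> t)) = c0 + t ^ 3 *\<^sub>R c3 + t ^ 5 *\<^sub>R ((3 * b) *\<^sub>R c3 + c5) + t ^ 6 *\<^sub>R c6 + t ^ 8 *\<^sub>R ?S t"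
    using eventually_compose_filterlim[OF ex lim]
  proof eventually_elim
    case (elim t)
    have p: "?\<phi> t ^ 3 = t ^ 3 + 3 * b * t ^ 5 + (3 * d + 3 * b ^ 2) * t ^ 7 + t ^ 8 * (t * ?P3 t)"
      "?\<phi> t ^ 5 = t ^ 5 + 5 * b * t ^ 7 + t ^ 8 * (t * ?P5 t)"
      "?\<phi> t ^ 6 = t ^ 6 + t ^ 8 * ?P6 t"
      "?\<phi> t ^ 7 = t ^ 7 + t ^ 8 * (t * ?P7 t)"
      "?\<phi> t ^ 8 = t ^ 8 * (1 + ?u t) ^ 8" by algebra+
    \<comment> \<open>The identity is linear in these tails; treating them as atoms keeps the
      polynomial computation small.\<close>
    define p3 p5 p6 p7 p8 where d: "p3 = t * ?P3 t" "p5 = t * ?P5 t" "p6 = ?P6 t" "p7 = t * ?P7 t" "p8 = (1 + ?u t) ^ 8"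
    show ?case
      unfolding elim p d[symmetric] unfolding c7 xy vec_eq_iff vector_add_component vector_scaleR_component real_scaleR_def
      by (intro allI) algebra
  qed
  moreover have "wedge c3 ((3 * b) *\<^sub>R c3 + c5) \<noteq> 0" using w by (simp add: wedge_def algebra_simps)
  ultimately show ?thesis by (rule cusp_5_3_if_expansion[OF diff S, rotated])
qed

text \<open>(t + a t^2)^3 begins with t^3 + 3 a t^4, which cancels the term of order 4. Orders 5 to
  7 change, but \<open>c5\<close> only by a multiple of \<open>c3\<close>, so the wedge survives;
  the order 7 is left to the preceding lemma.\<close>

lemma cusp_5_3_criterion:
  fixes f :: "real \<Rightarrow> real^2"
  assumes R: "smooth_germ R 0" and w: "wedge c3 c5 \<noteq> 0"
    and ex: "\<forall>\<^sub>F t in nhds 0. f t = c0 + t ^ 3 *\<^sub>R c3 + t ^ 4 *\<^sub>R (- 3 * a) *\<^sub>R c3 + t ^ 5 *\<^sub>R c5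
      + t ^ 6 *\<^sub>R c6 + t ^ 7 *\<^sub>R c7 + t ^ 8 *\<^sub>R R t"
  shows "cusp_5_3 f"
proof -
  let ?\<phi> = "\<lambda>t. t + a * t ^ 2"
  have s\<phi>: "smooth_germ ?\<phi> 0" by (intro smooth_germ_intros)
  have d\<phi>: "deriv ?\<phi> 0 \<noteq> 0" by (subst DERIV_imp_deriv[of _ 1]) (auto intro!: derivative_eq_intros)
  let ?d5 = "(- 9 * a ^ 2) *\<^sub>R c3 + c5" and ?d6 = "(- 17 * a ^ 3) *\<^sub>R c3 + (5 * a) *\<^sub>R c5 + c6"
    and ?d7 = "(- 12 * a ^ 4) *\<^sub>R c3 + (10 * a ^ 2) *\<^sub>R c5 + (6 * a) *\<^sub>R c6 + c7"
  let ?S = "\<lambda>t. (- 3 * a ^ 5) *\<^sub>R c3 + (10 * a ^ 3 + 5 * a ^ 4 * t + a ^ 5 * t ^ 2) *\<^sub>R c5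
    + (15 * a ^ 2 + 20 * a ^ 3 * t + 15 * a ^ 4 * t ^ 2 + 6 * a ^ 5 * t ^ 3 + a ^ 6 * t ^ 4) *\<^sub>R c6
    + (7 * a + 21 * a ^ 2 * t + 35 * a ^ 3 * t ^ 2 + 35 * a ^ 4 * t ^ 3 + 21 * a ^ 5 * t ^ 4
       + 7 * a ^ 6 * t ^ 5 + a ^ 7 * t ^ 6) *\<^sub>R c7
    + (1 + a * t) ^ 8 *\<^sub>R R (?\<phi> t)"
  have lim: "filterlim ?\<phi> (nhds 0) (nhds 0)" by (rule filterlim_nhds_0_smooth_germ[OF s\<phi>]) simp
  have "smooth_germ (\<lambda>t. R (?\<phi> t)) 0" by (rule smooth_germ_compose[OF _ s\<phi>]) (simp add: R)
  then have S: "smooth_germ ?S 0" by (intro smooth_germ_intros)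
  have "\<forall>\<^sub>F t in nhds 0. f (?\<phi> t) = c0 + t ^ 3 *\<^sub>R c3 + t ^ 5 *\<^sub>R ?d5 + t ^ 6 *\<^sub>R ?d6 + t ^ 7 *\<^sub>R ?d7 + t ^ 8 *\<^sub>R ?S t"
    using eventually_compose_filterlim[OF ex lim]
  proof eventually_elim
    case (elim t)
    show ?case unfolding elim vec_eq_iff vector_add_component vector_scaleR_component real_scaleR_def
      by (intro allI) algebra
  qed
  moreover have "wedge c3 ?d5 \<noteq> 0" using w by (simp add: wedge_def algebra_simps)
  ultimately show ?thesis using cusp_5_3_if_expansion_7[OF s\<phi> _ d\<phi> S] by simp
qed

subsection \<open>Frontals with a vanishing velocity\<close>

definition normal_vec :: "real \<Rightarrow> real^2" where
  "normal_vec u = vector [- sin u, cos u]"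

lemma unit_vec_axis: "unit_vec u = cos u *\<^sub>R axis 1 1 + sin u *\<^sub>R axis 2 1"
  by (simp add: unit_vec_def vec_eq_iff forall_2 axis_def)

lemma normal_vec_axis: "normal_vec u = (- sin u) *\<^sub>R axis 1 1 + cos u *\<^sub>R axis 2 1"
  by (simp add: normal_vec_def vec_eq_iff forall_2 axis_def)

lemma unit_normal_inner [simp]:
  "unit_vec u \<bullet> unit_vec u = 1" "normal_vec u \<bullet> normal_vec u = 1"
  "unit_vec u \<bullet> normal_vec u = 0" "normal_vec u \<bullet> unit_vec u = 0"
  by (simp_all add: unit_vec_def normal_vec_def inner_vec_def sum_2 flip: power2_eq_square)

lemma wedge_unit_vec: "wedge (unit_vec u) x = x \<bullet> normal_vec u"
  by (simp add: unit_vec_def normal_vec_def wedge_def inner_vec_def sum_2)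

lemma unit_normal_representation: "x = (x \<bullet> unit_vec u) *\<^sub>R unit_vec u + (x \<bullet> normal_vec u) *\<^sub>R normal_vec u"
proof -
  have "x $ 1 = (x $ 1 * cos u + x $ 2 * sin u) * cos u + (x $ 1 * - sin u + x $ 2 * cos u) * - sin u"
    "x $ 2 = (x $ 1 * cos u + x $ 2 * sin u) * sin u + (x $ 1 * - sin u + x $ 2 * cos u) * cos u"
    using sin_cos_squared_add[of u] by algebra+
  then show ?thesis by (simp add: vec_eq_iff forall_2 unit_vec_def normal_vec_def inner_vec_def sum_2)
qed

lemma smooth_germ_unit_vec: "smooth_germ \<theta> a \<Longrightarrow> smooth_germ (\<lambda>t. unit_vec (\<theta> t)) a"
  unfolding unit_vec_axis by (intro smooth_germ_intros smooth_germ_cos smooth_germ_sin)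

lemma smooth_germ_normal_vec: "smooth_germ \<theta> a \<Longrightarrow> smooth_germ (\<lambda>t. normal_vec (\<theta> t)) a"
  unfolding normal_vec_axis by (intro smooth_germ_intros smooth_germ_cos smooth_germ_sin)

lemma unit_vec_has_vector_derivative:
  assumes "(\<theta> has_real_derivative \<theta>') (at t)"
  shows "((\<lambda>t. unit_vec (\<theta> t)) has_vector_derivative \<theta>' *\<^sub>R normal_vec (\<theta> t)) (at t)"
proof -
  have "((\<lambda>t. cos (\<theta> t)) has_real_derivative - (sin (\<theta> t) * \<theta>')) (at t)"
    "((\<lambda>t. sin (\<theta> t)) has_real_derivative cos (\<theta> t) * \<theta>') (at t)"
    using assms by (auto intro!: derivative_eq_intros)
  from has_vector_derivative_add[OF has_vector_derivative_scaleR[OF this(1) has_vector_derivative_const]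
      has_vector_derivative_scaleR[OF this(2) has_vector_derivative_const]]
  show ?thesis unfolding unit_vec_axis normal_vec_axis by (simp add: algebra_simps)
qed

lemma normal_vec_has_vector_derivative:
  assumes "(\<theta> has_real_derivative \<theta>') (at t)"
  shows "((\<lambda>t. normal_vec (\<theta> t)) has_vector_derivative (- \<theta>') *\<^sub>R unit_vec (\<theta> t)) (at t)"
proof -
  have "((\<lambda>t. - sin (\<theta> t)) has_real_derivative - (cos (\<theta> t) * \<theta>')) (at t)"
    "((\<lambda>t. cos (\<theta> t)) has_real_derivative - (sin (\<theta> t) * \<theta>')) (at t)"
    using assms by (auto intro!: derivative_eq_intros)
  from has_vector_derivative_add[OF has_vector_derivative_scaleR[OF this(1) has_vector_derivative_const]
      has_vector_derivative_scaleR[OF this(2) has_vector_derivative_const]]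
  show ?thesis unfolding unit_vec_axis normal_vec_axis by (simp add: algebra_simps)
qed

lemma smooth_germ_hadamard:
  fixes f :: "real \<Rightarrow> real"
  assumes "smooth_germ f 0"
  obtains g where "smooth_germ g 0" "\<forall>\<^sub>F t in nhds 0. f t = f 0 + t * g t"
  using smooth_germ_taylor[OF assms, where N = 1] by auto

lemma smooth_germ_cubic:
  fixes f :: "real \<Rightarrow> real"
  assumes "smooth_germ f 0"
  obtains g where "smooth_germ g 0"
    "\<forall>\<^sub>F t in nhds 0. f t = f 0 + t * deriv f 0 + t ^ 2 * ((deriv ^^ 2) f 0 / 2)
       + t ^ 3 * ((deriv ^^ 3) f 0 / 6) + t ^ 4 * g t"
proof -
  obtain g where g: "smooth_germ g 0"
    "\<forall>\<^sub>F t in nhds 0. f t = (\<Sum>n<4. t ^ n / fact n * (deriv ^^ n) f 0) + t ^ 4 * g t"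
    using smooth_germ_taylor[OF assms, where N = 4] by blast
  have "(\<Sum>n<4. t ^ n / fact n * (deriv ^^ n) f 0) =
      f 0 + t * deriv f 0 + t ^ 2 * ((deriv ^^ 2) f 0 / 2) + t ^ 3 * ((deriv ^^ 3) f 0 / 6)" for t
    by (simp add: lessThan_nat_numeral fact_numeral)
  with g show thesis by (intro that[of g]) auto
qed

lemma unit_vec_expansion:
  obtains E where "smooth_germ E 0"
    "\<forall>\<^sub>F d in nhds 0. unit_vec (a + d) = unit_vec a + d *\<^sub>R normal_vec a + d ^ 2 *\<^sub>R E d"
proof -
  have d: "deriv cos 0 = (0::real)" "deriv sin 0 = (1::real)"
    by (auto intro!: DERIV_imp_deriv derivative_eq_intros)
  obtain c :: "real \<Rightarrow> real" where c: "smooth_germ c 0"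
    "\<forall>\<^sub>F t in nhds 0. cos t = (\<Sum>n<2. t ^ n / fact n * (deriv ^^ n) cos 0) + t ^ 2 * c t"
    by (rule smooth_germ_taylor[OF smooth_germ_cos[OF smooth_germ_id], where N = 2])
  obtain s :: "real \<Rightarrow> real" where s: "smooth_germ s 0"
    "\<forall>\<^sub>F t in nhds 0. sin t = (\<Sum>n<2. t ^ n / fact n * (deriv ^^ n) sin 0) + t ^ 2 * s t"
    by (rule smooth_germ_taylor[OF smooth_germ_sin[OF smooth_germ_id], where N = 2])
  show thesis
  proof (rule that[of "\<lambda>d. c d *\<^sub>R unit_vec a + s d *\<^sub>R normal_vec a"])
    show "smooth_germ (\<lambda>d. c d *\<^sub>R unit_vec a + s d *\<^sub>R normal_vec a) 0"
      by (intro smooth_germ_intros c s)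
    show "\<forall>\<^sub>F d in nhds 0. unit_vec (a + d) = unit_vec a + d *\<^sub>R normal_vec a
        + d ^ 2 *\<^sub>R (c d *\<^sub>R unit_vec a + s d *\<^sub>R normal_vec a)"
      using c(2) s(2)
    proof eventually_elim
      case (elim t)
      have "unit_vec (a + t) = cos t *\<^sub>R unit_vec a + sin t *\<^sub>R normal_vec a"
        by (simp add: unit_vec_def normal_vec_def vec_eq_iff forall_2 cos_add sin_add algebra_simps)
      moreover have "cos t = 1 + t ^ 2 * c t" "sin t = t + t ^ 2 * s t"
        using elim d by (simp_all add: lessThan_nat_numeral)
      ultimately show ?case by (simp add: algebra_simps)
    qed
  qed
qed

lemma antiderivative_expansion:
  fixes \<gamma> :: "real \<Rightarrow> 'b::euclidean_space"
  assumes V: "smooth_germ V 0"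
    and \<gamma>: "\<forall>\<^sub>F t in nhds 0. (\<gamma> has_vector_derivative (\<Sum>n<N. t ^ n *\<^sub>R v n) + t ^ N *\<^sub>R V t) (at t)"
  obtains g where "smooth_germ g 0"
    "\<forall>\<^sub>F t in nhds 0. \<gamma> t = \<gamma> 0 + (\<Sum>n<N. t ^ Suc n *\<^sub>R (v n /\<^sub>R real (Suc n))) + t ^ Suc N *\<^sub>R g t"
proof -
  let ?P = "\<lambda>t. \<Sum>n<N. t ^ Suc n *\<^sub>R (v n /\<^sub>R real (Suc n))"
  have P: "(?P has_vector_derivative (\<Sum>n<N. t ^ n *\<^sub>R v n)) (at t)" for t
  proof (rule has_vector_derivative_sum)
    fix n
    have p: "((\<lambda>t. t ^ Suc n) has_real_derivative real (Suc n) * t ^ n) (at t)"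
      using DERIV_pow[of "Suc n" t UNIV] by simp
    have "real (Suc n) *\<^sub>R t ^ n *\<^sub>R (v n /\<^sub>R real (Suc n)) = t ^ n *\<^sub>R v n"
      by (simp add: scaleR_left_commute del: of_nat_Suc)
    then show "((\<lambda>t. t ^ Suc n *\<^sub>R (v n /\<^sub>R real (Suc n))) has_vector_derivative t ^ n *\<^sub>R v n) (at t)"
      using has_vector_derivative_scaleR[OF p has_vector_derivative_const[of "v n /\<^sub>R real (Suc n)"]]
      by (simp only: scaleR_zero_right add_0_left scaleR_scaleR mult.assoc)
  qed
  have "\<forall>\<^sub>F t in nhds 0. ((\<lambda>t. \<gamma> t - ?P t) has_vector_derivative t ^ N *\<^sub>R V t) (at t)"
    using \<gamma>
  proof eventually_elim
    case (elim t)
    from has_vector_derivative_diff[OF this P] show ?case by simp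
  qed
  from antiderivative_power_germ[OF V this] obtain g where g: "smooth_germ g 0"
    "\<forall>\<^sub>F t in nhds 0. \<gamma> t - ?P t = \<gamma> 0 - ?P 0 + t ^ Suc N *\<^sub>R g t" by blast
  from g(2) have "\<forall>\<^sub>F t in nhds 0. \<gamma> t = \<gamma> 0 + ?P t + t ^ Suc N *\<^sub>R g t"
    by eventually_elim (simp add: algebra_simps)
  with g(1) show thesis by (rule that)
qed

lemma sum_lessThan_5: "(\<Sum>n<5. f n) = f 0 + f 1 + f 2 + f 3 + f (4::nat)"
  for f :: "nat \<Rightarrow> 'a::comm_monoid_add"
  by (simp add: eval_nat_numeral)

lemma sum_lessThan_7: "(\<Sum>n<7. f n) = f 0 + f 1 + f 2 + f 3 + f 4 + f 5 + f (6::nat)"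
  for f :: "nat \<Rightarrow> 'a::comm_monoid_add"
  by (simp add: eval_nat_numeral)

text \<open>The angle differs from its value at 0 only from order 2 on and the speed begins with
  order 1, so the velocity has no normal component below order 3. After integration the coefficients
  of orders 2 and 3 are both tangential, hence parallel, and a quadratic substitution removes the
  latter.\<close>

lemma frontal_cusp_5_2:
  assumes l: "smooth_germ l 0" and \<theta>: "smooth_germ \<theta> 0"
    and \<gamma>: "\<forall>\<^sub>F t in nhds 0. (\<gamma> has_vector_derivative l t *\<^sub>R unit_vec (\<theta> t)) (at t)"
    and l0: "l 0 = 0" and l1: "deriv l 0 \<noteq> 0" and \<theta>1: "deriv \<theta> 0 = 0"
    and disc: "deriv l 0 * (deriv ^^ 3) \<theta> 0 - (deriv ^^ 2) l 0 * (deriv ^^ 2) \<theta> 0 \<noteq> 0"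
  shows "cusp_5_2 \<gamma>"
proof -
  define l1 l2 l3 \<theta>2 \<theta>3 where d: "l1 = deriv l 0" "l2 = (deriv ^^ 2) l 0 / 2" "l3 = (deriv ^^ 3) l 0 / 6"
    "\<theta>2 = (deriv ^^ 2) \<theta> 0 / 2" "\<theta>3 = (deriv ^^ 3) \<theta> 0 / 6"
  obtain L0 where L0: "smooth_germ L0 0"
    "\<forall>\<^sub>F t in nhds 0. l t = t * l1 + t ^ 2 * l2 + t ^ 3 * l3 + t ^ 4 * L0 t"
    using smooth_germ_cubic[OF l] unfolding l0 d by auto
  obtain L where L: "smooth_germ L 0" "\<forall>\<^sub>F t in nhds 0. L0 t = L0 0 + t * L t"
    using smooth_germ_hadamard[OF L0(1)] by blast
  define l4 where "l4 = L0 0"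
  obtain \<Theta> where \<Theta>: "smooth_germ \<Theta> 0"
    "\<forall>\<^sub>F t in nhds 0. \<theta> t = \<theta> 0 + t ^ 2 * \<theta>2 + t ^ 3 * \<theta>3 + t ^ 4 * \<Theta> t"
    using smooth_germ_cubic[OF \<theta>] unfolding \<theta>1 d by auto
  let ?e = "unit_vec (\<theta> 0)" and ?J = "normal_vec (\<theta> 0)"
  obtain E where E: "smooth_germ E 0"
    "\<forall>\<^sub>F d in nhds 0. unit_vec (\<theta> 0 + d) = ?e + d *\<^sub>R ?J + d ^ 2 *\<^sub>R E d"
    using unit_vec_expansion by blast
  let ?\<mu> = "\<lambda>t. \<theta>2 + t * \<theta>3 + t ^ 2 * \<Theta> t"
  let ?\<delta> = "\<lambda>t. t ^ 2 * ?\<mu> t"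
  let ?la2 = "\<lambda>t. l3 + t * l4 + t ^ 2 * L t"
  let ?la = "\<lambda>t. l1 + t * l2 + t ^ 2 * ?la2 t"
  \<comment> \<open>Everything of order at least 5 in the velocity, divided by
    \<open>t ^ 5\<close>.\<close>
  let ?V = "\<lambda>t. L t *\<^sub>R ?e + (l1 * \<Theta> t + l2 * \<theta>3 + l2 * t * \<Theta> t + ?la2 t * ?\<mu> t) *\<^sub>R ?J
    + (?la t * ?\<mu> t ^ 2) *\<^sub>R E (?\<delta> t)"
  let ?v = "\<lambda>n. [0, l1 *\<^sub>R ?e, l2 *\<^sub>R ?e, l3 *\<^sub>R ?e + (l1 * \<theta>2) *\<^sub>R ?J, l4 *\<^sub>R ?e + (l1 * \<theta>3 + l2 * \<theta>2) *\<^sub>R ?J] ! n"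
  have v: "(\<Sum>n<5. t ^ n *\<^sub>R ?v n) = t *\<^sub>R (l1 *\<^sub>R ?e) + t ^ 2 *\<^sub>R (l2 *\<^sub>R ?e)
      + t ^ 3 *\<^sub>R (l3 *\<^sub>R ?e + (l1 * \<theta>2) *\<^sub>R ?J)
      + t ^ 4 *\<^sub>R (l4 *\<^sub>R ?e + (l1 * \<theta>3 + l2 * \<theta>2) *\<^sub>R ?J)" for t
    by (simp add: lessThan_nat_numeral)
  have \<delta>: "smooth_germ ?\<delta> 0" by (intro smooth_germ_intros \<Theta>)
  have \<delta>0: "filterlim ?\<delta> (nhds 0) (nhds 0)" by (rule filterlim_nhds_0_smooth_germ[OF \<delta>]) simp
  have "smooth_germ (\<lambda>t. E (?\<delta> t)) 0" by (rule smooth_germ_compose[OF _ \<delta>]) (simp add: E)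
  then have V: "smooth_germ ?V 0" by (intro smooth_germ_intros L \<Theta>)
  have "\<forall>\<^sub>F t in nhds 0. (\<gamma> has_vector_derivative (\<Sum>n<5. t ^ n *\<^sub>R ?v n) + t ^ 5 *\<^sub>R ?V t) (at t)"
    using \<gamma> L0(2) L(2) \<Theta>(2) eventually_compose_filterlim[OF E(2) \<delta>0]
  proof eventually_elim
    case (elim t)
    have \<theta>t: "\<theta> t = \<theta> 0 + ?\<delta> t" unfolding elim(4) by algebra
    have lt: "l t = t * l1 + t ^ 2 * l2 + t ^ 3 * l3 + t ^ 4 * (l4 + t * L t)"
      unfolding elim(2) elim(3)[folded l4_def] ..
    have "l t *\<^sub>R unit_vec (\<theta> t) = (\<Sum>n<5. t ^ n *\<^sub>R ?v n) + t ^ 5 *\<^sub>R ?V t"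
      unfolding \<theta>t elim(5) lt
        vec_eq_iff vector_add_component vector_scaleR_component real_scaleR_def v
      by (intro allI) algebra
    with elim(1) show ?case by simp
  qed
  from antiderivative_expansion[OF V this] obtain R where R: "smooth_germ R 0"
    "\<forall>\<^sub>F t in nhds 0. \<gamma> t = \<gamma> 0 + (\<Sum>n<5. t ^ Suc n *\<^sub>R (?v n /\<^sub>R real (Suc n))) + t ^ Suc 5 *\<^sub>R R t"
    by blast
  \<comment> \<open>The coefficients of orders 2 and 3 are l1 / 2 and l2 / 3 times the tangent
    vector; this \<open>a\<close> makes the second one \<open>- 2 * a\<close> times the
    first.\<close>
  define a where "a = - l2 / (3 * l1)"
  define c2 where "c2 = (l1 *\<^sub>R ?e) /\<^sub>R 2"
  define c4 where "c4 = (l3 *\<^sub>R ?e + (l1 * \<theta>2) *\<^sub>R ?J) /\<^sub>R 4"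
  define c5 where "c5 = (l4 *\<^sub>R ?e + (l1 * \<theta>3 + l2 * \<theta>2) *\<^sub>R ?J) /\<^sub>R 5"
  have l1': "l1 \<noteq> 0" using l1 d by simp
  have c3: "(- 2 * a) *\<^sub>R c2 = (l2 *\<^sub>R ?e) /\<^sub>R 3" using l1' by (simp add: a_def c2_def field_simps)
  have S: "(\<Sum>n<5. t ^ Suc n *\<^sub>R (?v n /\<^sub>R real (Suc n))) =
      t ^ 2 *\<^sub>R c2 + t ^ 3 *\<^sub>R (- 2 * a) *\<^sub>R c2 + t ^ 4 *\<^sub>R c4 + t ^ 5 *\<^sub>R c5" for t
    unfolding c3 unfolding c2_def c4_def c5_def sum_lessThan_5 by (simp add: power2_eq_square)
  from R(2) have ex: "\<forall>\<^sub>F t in nhds 0. \<gamma> t = \<gamma> 0 + t ^ 2 *\<^sub>R c2 + t ^ 3 *\<^sub>R (- 2 * a) *\<^sub>R c2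
      + t ^ 4 *\<^sub>R c4 + t ^ 5 *\<^sub>R c5 + t ^ 6 *\<^sub>R R t"
    unfolding S by eventually_elim (simp add: algebra_simps)
  have "((4 * a) *\<^sub>R c4 + c5) \<bullet> ?J = a * (l1 * \<theta>2) + (l1 * \<theta>3 + l2 * \<theta>2) / 5"
    by (simp add: c4_def c5_def inner_add_left)
  \<comment> \<open>With the factors 1/2 and 1/6 contained in \<open>l2\<close>,
    \<open>\<theta>2\<close> and \<open>\<theta>3\<close>, this numerator is half of the expression
    in \<open>disc\<close>.\<close>
  also have "\<dots> = (3 * l1 * \<theta>3 - 2 * l2 * \<theta>2) / 15" using l1' by (simp add: a_def field_simps)
  also have "\<dots> \<noteq> 0" using disc by (simp add: d field_simps)
  finally have "wedge c2 ((4 * a) *\<^sub>R c4 + c5) \<noteq> 0"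
    using l1' by (simp add: c2_def bounded_bilinear.scaleR_left[OF bounded_bilinear_wedge] wedge_unit_vec)
  then show ?thesis by (rule cusp_5_2_criterion[OF R(1) _ ex])
qed

text \<open>Now the speed begins with order 2, so orders 3 and 4 of the curve are tangential, and
  the first normal component, \<open>m0 * \<theta>2 / 5\<close>, occurs in order 5.\<close>

lemma frontal_cusp_5_3:
  assumes l: "smooth_germ l 0" and \<theta>: "smooth_germ \<theta> 0"
    and \<gamma>: "\<forall>\<^sub>F t in nhds 0. (\<gamma> has_vector_derivative l t *\<^sub>R unit_vec (\<theta> t)) (at t)"
    and l0: "l 0 = 0" and l1: "deriv l 0 = 0" and \<theta>1: "deriv \<theta> 0 = 0"
    and l2: "(deriv ^^ 2) l 0 \<noteq> 0" and \<theta>2: "(deriv ^^ 2) \<theta> 0 \<noteq> 0"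
  shows "cusp_5_3 \<gamma>"
proof -
  define m0 m1 \<theta>2 \<theta>3 where d: "m0 = (deriv ^^ 2) l 0 / 2" "m1 = (deriv ^^ 3) l 0 / 6"
    "\<theta>2 = (deriv ^^ 2) \<theta> 0 / 2" "\<theta>3 = (deriv ^^ 3) \<theta> 0 / 6"
  obtain L0 where L0: "smooth_germ L0 0"
    "\<forall>\<^sub>F t in nhds 0. l t = t ^ 2 * m0 + t ^ 3 * m1 + t ^ 4 * L0 t"
    using smooth_germ_cubic[OF l] unfolding l0 l1 d by auto
  obtain L where L: "smooth_germ L 0" "\<forall>\<^sub>F t in nhds 0. L0 t = L0 0 + t * L t"
    using smooth_germ_hadamard[OF L0(1)] by blast
  define m2 where "m2 = L0 0"
  obtain \<Theta> where \<Theta>: "smooth_germ \<Theta> 0"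
    "\<forall>\<^sub>F t in nhds 0. \<theta> t = \<theta> 0 + t ^ 2 * \<theta>2 + t ^ 3 * \<theta>3 + t ^ 4 * \<Theta> t"
    using smooth_germ_cubic[OF \<theta>] unfolding \<theta>1 d by auto
  let ?e = "unit_vec (\<theta> 0)" and ?J = "normal_vec (\<theta> 0)"
  obtain E where E: "smooth_germ E 0"
    "\<forall>\<^sub>F d in nhds 0. unit_vec (\<theta> 0 + d) = ?e + d *\<^sub>R ?J + d ^ 2 *\<^sub>R E d"
    using unit_vec_expansion by blast
  let ?\<mu>1 = "\<lambda>t. \<theta>3 + t * \<Theta> t"
  let ?\<mu> = "\<lambda>t. \<theta>2 + t * ?\<mu>1 t"
  let ?\<delta> = "\<lambda>t. t ^ 2 * ?\<mu> t"
  let ?la1 = "\<lambda>t. m1 + t * m2 + t ^ 2 * L t"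
  let ?la = "\<lambda>t. m0 + t * ?la1 t"
  let ?V = "\<lambda>t. L t *\<^sub>R ?e + (m0 * ?\<mu>1 t + ?la1 t * ?\<mu> t) *\<^sub>R ?J + (t * ?la t * ?\<mu> t ^ 2) *\<^sub>R E (?\<delta> t)"
  have \<delta>: "smooth_germ ?\<delta> 0" by (intro smooth_germ_intros \<Theta>)
  have \<delta>0: "filterlim ?\<delta> (nhds 0) (nhds 0)" by (rule filterlim_nhds_0_smooth_germ[OF \<delta>]) simp
  have "smooth_germ (\<lambda>t. E (?\<delta> t)) 0" by (rule smooth_germ_compose[OF _ \<delta>]) (simp add: E)
  then have "smooth_germ ?V 0" by (intro smooth_germ_intros L \<Theta>)
  \<comment> \<open>Orders 6 and 7 of the curve have to appear explicitly, 7 being a gap still to be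
    cleared. Their coefficients may be arbitrary, so they come from an abstract expansion.\<close>
  from smooth_germ_taylor_vector[OF this, of 2] obtain c V where V: "smooth_germ V 0"
    "\<forall>\<^sub>F t in nhds 0. ?V t = (\<Sum>n<2. t ^ n *\<^sub>R c n) + t ^ 2 *\<^sub>R V t" by blast
  let ?v = "\<lambda>n. [0, 0, m0 *\<^sub>R ?e, m1 *\<^sub>R ?e, m2 *\<^sub>R ?e + (m0 * \<theta>2) *\<^sub>R ?J, c 0, c 1] ! n"
  have v: "(\<Sum>n<7. t ^ n *\<^sub>R ?v n) = t ^ 2 *\<^sub>R (m0 *\<^sub>R ?e) + t ^ 3 *\<^sub>R (m1 *\<^sub>R ?e)
      + t ^ 4 *\<^sub>R (m2 *\<^sub>R ?e + (m0 * \<theta>2) *\<^sub>R ?J) + t ^ 5 *\<^sub>R c 0 + t ^ 6 *\<^sub>R c 1" for t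
    by (simp add: lessThan_nat_numeral)
  have "\<forall>\<^sub>F t in nhds 0. (\<gamma> has_vector_derivative (\<Sum>n<7. t ^ n *\<^sub>R ?v n) + t ^ 7 *\<^sub>R V t) (at t)"
    using \<gamma> L0(2) L(2) \<Theta>(2) eventually_compose_filterlim[OF E(2) \<delta>0] V(2)
  proof eventually_elim
    case (elim t)
    have \<theta>t: "\<theta> t = \<theta> 0 + ?\<delta> t" unfolding elim(4) by algebra
    have lt: "l t = t ^ 2 * m0 + t ^ 3 * m1 + t ^ 4 * (m2 + t * L t)"
      unfolding elim(2) elim(3)[folded m2_def] ..
    have Vt: "?V t = c 0 + t *\<^sub>R c 1 + t ^ 2 *\<^sub>R V t"
      using elim(6) by (simp add: lessThan_nat_numeral)
    have "l t *\<^sub>R unit_vec (\<theta> t) = t ^ 2 *\<^sub>R (m0 *\<^sub>R ?e) + t ^ 3 *\<^sub>R (m1 *\<^sub>R ?e)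
      + t ^ 4 *\<^sub>R (m2 *\<^sub>R ?e + (m0 * \<theta>2) *\<^sub>R ?J) + t ^ 5 *\<^sub>R ?V t"
      unfolding \<theta>t elim(5) lt vec_eq_iff vector_add_component vector_scaleR_component real_scaleR_def
      by (intro allI) algebra
    also have "\<dots> = (\<Sum>n<7. t ^ n *\<^sub>R ?v n) + t ^ 7 *\<^sub>R V t"
      unfolding Vt v vec_eq_iff vector_add_component vector_scaleR_component real_scaleR_def
      by (intro allI) algebra
    finally show ?case using elim(1) by simp
  qed
  from antiderivative_expansion[OF V(1) this] obtain R where R: "smooth_germ R 0"
    "\<forall>\<^sub>F t in nhds 0. \<gamma> t = \<gamma> 0 + (\<Sum>n<7. t ^ Suc n *\<^sub>R (?v n /\<^sub>R real (Suc n))) + t ^ Suc 7 *\<^sub>R R t"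
    by blast
  define a where "a = - m1 / (4 * m0)"
  define c3 where "c3 = (m0 *\<^sub>R ?e) /\<^sub>R 3"
  define c5 where "c5 = (m2 *\<^sub>R ?e + (m0 * \<theta>2) *\<^sub>R ?J) /\<^sub>R 5"
  have m0: "m0 \<noteq> 0" "\<theta>2 \<noteq> 0" using l2 \<theta>2 d by simp_all
  have c4: "(- 3 * a) *\<^sub>R c3 = (m1 *\<^sub>R ?e) /\<^sub>R 4" using m0 by (simp add: a_def c3_def field_simps)
  have S: "(\<Sum>n<7. t ^ Suc n *\<^sub>R (?v n /\<^sub>R real (Suc n))) = t ^ 3 *\<^sub>R c3 + t ^ 4 *\<^sub>R (- 3 * a) *\<^sub>R c3
      + t ^ 5 *\<^sub>R c5 + t ^ 6 *\<^sub>R (c 0 /\<^sub>R 6) + t ^ 7 *\<^sub>R (c 1 /\<^sub>R 7)" for t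
    unfolding c4 unfolding c3_def c5_def sum_lessThan_7 by (simp add: power2_eq_square)
  from R(2) have ex: "\<forall>\<^sub>F t in nhds 0. \<gamma> t = \<gamma> 0 + t ^ 3 *\<^sub>R c3 + t ^ 4 *\<^sub>R (- 3 * a) *\<^sub>R c3
      + t ^ 5 *\<^sub>R c5 + t ^ 6 *\<^sub>R (c 0 /\<^sub>R 6) + t ^ 7 *\<^sub>R (c 1 /\<^sub>R 7) + t ^ 8 *\<^sub>R R t"
    unfolding S by eventually_elim (simp add: algebra_simps)
  have "c5 \<bullet> ?J = m0 * \<theta>2 / 5" by (simp add: c5_def inner_add_left)
  also have "\<dots> \<noteq> 0" using m0 by simp
  finally have "wedge c3 c5 \<noteq> 0"
    using m0 by (simp add: c3_def bounded_bilinear.scaleR_left[OF bounded_bilinear_wedge] wedge_unit_vec)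
  then show ?thesis by (rule cusp_5_3_criterion[OF R(1) _ ex])
qed

subsection \<open>Higher derivatives of germs\<close>

lemma smooth_germ_eventually_DERIV:
  fixes f :: "real \<Rightarrow> real"
  shows "smooth_germ f a \<Longrightarrow> \<forall>\<^sub>F t in nhds a. (f has_real_derivative deriv f t) (at t)"
  by (rule eventually_mono[OF smooth_germ_eventually smooth_germ_DERIV])

text \<open>The induction treats all points near \<open>a\<close> at once, because an equality can
  be differentiated only where it holds in a neighbourhood.\<close>

lemma deriv_funpow_cong_ev:
  fixes f g :: "real \<Rightarrow> real"
  assumes "\<forall>\<^sub>F t in nhds a. f t = g t"
  shows "(deriv ^^ n) f a = (deriv ^^ n) g a"
proof -
  have "\<forall>\<^sub>F t in nhds a. (deriv ^^ n) f t = (deriv ^^ n) g t"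
  proof (induction n)
    case (Suc n)
    then have "\<forall>\<^sub>F t in nhds a. \<forall>\<^sub>F s in nhds t. (deriv ^^ n) f s = (deriv ^^ n) g s"
      by (simp add: eventually_eventually)
    then show ?case by eventually_elim (simp add: deriv_cong_ev)
  qed (use assms in simp)
  then show ?thesis by (rule eventually_nhds_x_imp_x)
qed

lemma smooth_germ_deriv_add:
  fixes f g :: "real \<Rightarrow> real"
  assumes "smooth_germ f a" "smooth_germ g a"
  shows "(deriv ^^ n) (\<lambda>t. f t + g t) a = (deriv ^^ n) f a + (deriv ^^ n) g a"
  using assms
proof (induction n arbitrary: f g)
  case (Suc n)
  have "\<forall>\<^sub>F t in nhds a. deriv (\<lambda>t. f t + g t) t = deriv f t + deriv g t"
    using smooth_germ_eventually_DERIV[OF Suc.prems(1)] smooth_germ_eventually_DERIV[OF Suc.prems(2)]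
    by eventually_elim (auto intro: DERIV_imp_deriv DERIV_add)
  from deriv_funpow_cong_ev[OF this, of n] Suc.IH[OF smooth_germ_deriv smooth_germ_deriv, OF Suc.prems]
  show ?case by (simp only: funpow_Suc_right o_apply)
qed simp

lemma smooth_germ_deriv_cmult:
  fixes f :: "real \<Rightarrow> real"
  assumes "smooth_germ f a"
  shows "(deriv ^^ n) (\<lambda>t. c * f t) a = c * (deriv ^^ n) f a"
  using assms
proof (induction n arbitrary: f)
  case (Suc n)
  have "\<forall>\<^sub>F t in nhds a. deriv (\<lambda>t. c * f t) t = c * deriv f t"
    using smooth_germ_eventually_DERIV[OF Suc.prems] by eventually_elim (auto intro: DERIV_imp_deriv DERIV_cmult)
  from deriv_funpow_cong_ev[OF this, of n] Suc.IH[OF smooth_germ_deriv, OF Suc.prems]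
  show ?case by (simp only: funpow_Suc_right o_apply)
qed simp

lemma smooth_germ_deriv_mult:
  fixes f g :: "real \<Rightarrow> real"
  assumes "smooth_germ f a" "smooth_germ g a"
  shows "deriv (\<lambda>t. f t * g t) a = f a * deriv g a + deriv f a * g a"
  using DERIV_mult'[OF smooth_germ_DERIV[OF assms(1)] smooth_germ_DERIV[OF assms(2)]]
  by (rule DERIV_imp_deriv)

lemma smooth_germ_deriv2_mult:
  fixes f g :: "real \<Rightarrow> real"
  assumes f: "smooth_germ f a" and g: "smooth_germ g a"
  shows "(deriv ^^ 2) (\<lambda>t. f t * g t) a = f a * (deriv ^^ 2) g a + 2 * deriv f a * deriv g a + (deriv ^^ 2) f a * g a"
proof -
  have "\<forall>\<^sub>F t in nhds a. deriv (\<lambda>t. f t * g t) t = f t * deriv g t + deriv f t * g t"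
    using smooth_germ_eventually[OF f] smooth_germ_eventually[OF g]
    by eventually_elim (rule smooth_germ_deriv_mult)
  from deriv_funpow_cong_ev[OF this, of 1]
  have "(deriv ^^ 2) (\<lambda>t. f t * g t) a = deriv (\<lambda>t. f t * deriv g t + deriv f t * g t) a"
    by (simp add: numeral_2_eq_2)
  also have "\<dots> = deriv (\<lambda>t. f t * deriv g t) a + deriv (\<lambda>t. deriv f t * g t) a"
    using smooth_germ_deriv_add[of "\<lambda>t. f t * deriv g t" a "\<lambda>t. deriv f t * g t" 1]
    by (simp add: smooth_germ_mult smooth_germ_deriv f g)
  also have "\<dots> = f a * (deriv ^^ 2) g a + 2 * deriv f a * deriv g a + (deriv ^^ 2) f a * g a"
    by (simp add: smooth_germ_deriv_mult smooth_germ_deriv f g numeral_2_eq_2 algebra_simps)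
  finally show ?thesis .
qed

lemma smooth_germ_divide_by_id:
  fixes f :: "real \<Rightarrow> real"
  assumes f: "smooth_germ f 0" "f 0 = 0"
  obtains g where "smooth_germ g 0" "\<forall>\<^sub>F t in nhds 0. f t = t * g t" "g 0 = deriv f 0"
    "deriv g 0 = (deriv ^^ 2) f 0 / 2"
proof -
  obtain g where g: "smooth_germ g 0" "\<forall>\<^sub>F t in nhds 0. f t = t * g t"
    using smooth_germ_hadamard[OF f(1)] unfolding f(2) by auto
  have id: "deriv (\<lambda>t::real. t) 0 = 1" "(deriv ^^ 2) (\<lambda>t::real. t) 0 = 0"
    by (simp_all add: numeral_2_eq_2)
  show thesis
  proof (rule that[OF g])
    show "g 0 = deriv f 0"
      using deriv_funpow_cong_ev[OF g(2), of 1] smooth_germ_deriv_mult[OF smooth_germ_id g(1)] id by simp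
    show "deriv g 0 = (deriv ^^ 2) f 0 / 2"
      using deriv_funpow_cong_ev[OF g(2), of 2] smooth_germ_deriv2_mult[OF smooth_germ_id g(1)] id by simp
  qed
qed

subsection \<open>The Legendre data of a 5/2-cusp\<close>

lemma wedge_linear:
  assumes "linear L"
  shows "wedge (L u) (L v) = wedge (L (axis 1 1)) (L (axis 2 1)) * wedge u v"
proof -
  interpret linear L by fact
  have e: "x = x $ 1 *\<^sub>R axis 1 1 + x $ 2 *\<^sub>R axis 2 1" for x :: "real^2"
    by (simp add: vec_eq_iff forall_2 axis_def)
  have L: "L x = x $ 1 *\<^sub>R L (axis 1 1) + x $ 2 *\<^sub>R L (axis 2 1)" for x
    by (subst e[of x]) (simp only: add scale)
  show ?thesis by (simp add: wedge_def L[of u] L[of v] algebra_simps)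
qed

lemma has_derivative_left_inverse:
  assumes "(f has_derivative f') (at a)" "(g has_derivative g') (at (f a))" "\<forall>\<^sub>F x in nhds a. g (f x) = x"
  shows "g' (f' v) = v"
proof -
  have "((\<lambda>x. g (f x)) has_derivative (\<lambda>v. g' (f' v))) (at a)"
    by (rule has_derivative_compose[OF assms(1,2)])
  then have "((\<lambda>x. x) has_derivative (\<lambda>v. g' (f' v))) (at a)"
    by (rule has_derivative_transform_eventually)
       (use assms(3) eventually_nhds_x_imp_x[OF assms(3)] in \<open>auto simp: eventually_at_filter elim: eventually_mono\<close>)
  from has_derivative_unique[OF this has_derivative_ident] show ?thesis by metis
qed

lemma diffeo_germ_inverse_derivative:
  assumes "diffeo_germ f a b"
  obtains g where "diffeo_germ g b a" "\<forall>\<^sub>F x in nhds a. g (f x) = x" "\<forall>\<^sub>F y in nhds b. f (g y) = y"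
    "\<And>v. frechet_derivative g (at b) (frechet_derivative f (at a) v) = v"
proof -
  obtain g where g: "diffeo_germ g b a" "\<forall>\<^sub>F x in nhds a. g (f x) = x" "\<forall>\<^sub>F y in nhds b. f (g y) = y"
    using diffeo_germ_sym[OF assms] by blast
  have "f a = b" using assms by (simp add: diffeo_germ_def)
  moreover have "(f has_derivative frechet_derivative f (at a)) (at a)"
    "(g has_derivative frechet_derivative g (at b)) (at b)"
    using smooth_germ_differentiable diffeo_germ_smooth_germ assms g(1) frechet_derivative_works by metis+
  ultimately have "frechet_derivative g (at b) (frechet_derivative f (at a) v) = v" for v
    using has_derivative_left_inverse[of f "frechet_derivative f (at a)" a g "frechet_derivative g (at b)"] g(2)
    by simp
  with g show thesis by (rule that)
qed

text \<open>The derivative of the inverse germ undoes that of \<open>f\<close>, and determinants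
  multiply.\<close>

lemma diffeo_germ_wedge_nonzero:
  assumes "diffeo_germ f a b"
  shows "wedge (frechet_derivative f (at a) (axis 1 1)) (frechet_derivative f (at a) (axis 2 1)) \<noteq> 0"
proof -
  obtain g where g: "diffeo_germ g b a"
    "\<And>v. frechet_derivative g (at b) (frechet_derivative f (at a) v) = v"
    using diffeo_germ_inverse_derivative[OF assms] by metis
  have "linear (frechet_derivative g (at b))"
    using smooth_germ_differentiable[OF diffeo_germ_smooth_germ[OF g(1)]] by (rule linear_frechet_derivative)
  from wedge_linear[OF this, of "frechet_derivative f (at a) (axis 1 1)" "frechet_derivative f (at a) (axis 2 1)"]
  have "wedge (axis 1 1) (axis 2 1) = wedge (frechet_derivative g (at b) (axis 1 1)) (frechet_derivative g (at b) (axis 2 1)) *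
      wedge (frechet_derivative f (at a) (axis 1 1)) (frechet_derivative f (at a) (axis 2 1))"
    by (simp add: g(2))
  then show ?thesis by (auto simp: wedge_def axis_def)
qed

lemma diffeo_germ_deriv_nonzero:
  fixes f :: "real \<Rightarrow> real"
  assumes "diffeo_germ f a b"
  shows "deriv f a \<noteq> 0"
proof
  assume "deriv f a = 0"
  with smooth_germ_DERIV[OF diffeo_germ_smooth_germ[OF assms]]
  have "frechet_derivative f (at a) = (\<lambda>v. 0)"
    using frechet_derivative_at[of f "\<lambda>v. 0" a] by (simp add: has_field_derivative_def lambda_zero[symmetric])
  moreover obtain g where "diffeo_germ g b a" "\<And>v. frechet_derivative g (at b) (frechet_derivative f (at a) v) = v"
    using diffeo_germ_inverse_derivative[OF assms] by metis
  ultimately have "(v::real) = frechet_derivative g (at b) 0" for v by metis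
  from this[of 0] this[of 1] show False by simp
qed

definition curve_2_5 :: "real \<Rightarrow> real^2" where
  "curve_2_5 s = vector [s ^ 2, s ^ 5]"

abbreviation partial_x :: "(real^2 \<Rightarrow> 'b::real_normed_vector) \<Rightarrow> real^2 \<Rightarrow> 'b" where
  "partial_x H z \<equiv> frechet_derivative H (at z) (axis 1 1)"

abbreviation partial_y :: "(real^2 \<Rightarrow> 'b::real_normed_vector) \<Rightarrow> real^2 \<Rightarrow> 'b" where
  "partial_y H z \<equiv> frechet_derivative H (at z) (axis 2 1)"

lemma smooth_germ_partial:
  "smooth_germ H a \<Longrightarrow> smooth_germ (\<lambda>z. frechet_derivative H (at z) v) a"
  unfolding smooth_germ_def using smooth_on_frechet_derivative by blast

lemma curve_2_5_axis: "curve_2_5 s = s ^ 2 *\<^sub>R axis 1 1 + s ^ 5 *\<^sub>R axis 2 1"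
  by (simp add: curve_2_5_def vec_eq_iff forall_2 axis_def)

lemma smooth_germ_curve_2_5: "smooth_germ \<psi> a \<Longrightarrow> smooth_germ (\<lambda>t. curve_2_5 (\<psi> t)) a"
  unfolding curve_2_5_axis by (intro smooth_germ_intros)

lemma curve_2_5_0 [simp]: "curve_2_5 0 = 0"
  by (simp add: curve_2_5_axis)

text \<open>Differentiating along the model curve always brings out the factor \<psi> \<psi>'. This
  is used for \<open>G\<close> and for its first and second partial derivatives.\<close>

lemma curve_2_5_chain:
  fixes H :: "real^2 \<Rightarrow> 'b::euclidean_space"
  assumes H: "smooth_germ H 0" and \<psi>: "smooth_germ \<psi> 0" "\<psi> 0 = 0"
  shows "\<forall>\<^sub>F t in nhds 0. ((\<lambda>t. H (curve_2_5 (\<psi> t))) has_vector_derivative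
    deriv \<psi> t *\<^sub>R ((2 * \<psi> t) *\<^sub>R partial_x H (curve_2_5 (\<psi> t)) + (5 * \<psi> t ^ 4) *\<^sub>R partial_y H (curve_2_5 (\<psi> t)))) (at t)"
proof -
  have "filterlim (\<lambda>t. curve_2_5 (\<psi> t)) (nhds 0) (nhds 0)"
    using smooth_germ_isCont[OF smooth_germ_curve_2_5[OF \<psi>(1)]] \<psi>(2)
    by (metis isCont_def tendsto_at_iff_tendsto_nhds curve_2_5_0)
  from eventually_compose_filterlim[OF smooth_germ_eventually[OF H] this] smooth_germ_eventually_DERIV[OF \<psi>(1)]
  show ?thesis
  proof eventually_elim
    case (elim t)
    let ?c = "\<lambda>t. curve_2_5 (\<psi> t)"
    have "((\<lambda>t. \<psi> t ^ 2) has_real_derivative 2 * \<psi> t * deriv \<psi> t) (at t)"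
      "((\<lambda>t. \<psi> t ^ 5) has_real_derivative 5 * \<psi> t ^ 4 * deriv \<psi> t) (at t)"
      using elim(2) by (auto intro!: derivative_eq_intros)
    from has_vector_derivative_add[OF has_vector_derivative_scaleR[OF this(1) has_vector_derivative_const]
        has_vector_derivative_scaleR[OF this(2) has_vector_derivative_const]]
    have c: "(?c has_vector_derivative (2 * \<psi> t * deriv \<psi> t) *\<^sub>R axis 1 1 + (5 * \<psi> t ^ 4 * deriv \<psi> t) *\<^sub>R axis 2 1) (at t)"
      unfolding curve_2_5_axis by simp
    have dH: "(H has_derivative frechet_derivative H (at (?c t))) (at (?c t))"
      using smooth_germ_differentiable[OF elim(1)] frechet_derivative_works by blast
    then interpret L: linear "frechet_derivative H (at (?c t))" by (rule has_derivative_linear)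
    have "((\<lambda>t. H (?c t)) has_derivative (\<lambda>h. h *\<^sub>R frechet_derivative H (at (?c t))
        ((2 * \<psi> t * deriv \<psi> t) *\<^sub>R axis 1 1 + (5 * \<psi> t ^ 4 * deriv \<psi> t) *\<^sub>R axis 2 1))) (at t)"
      using has_derivative_compose[OF c[unfolded has_vector_derivative_def] dH] by (simp only: L.scale)
    then show ?case
      unfolding has_vector_derivative_def by (simp add: L.add L.scale scaleR_add_right mult_ac)
  qed
qed

text \<open>The curve is \<open>G (curve_2_5 (\<psi> t))\<close> with a diffeomorphism
  \<open>G\<close>, so its velocity is k V with k = \<psi> \<psi>' and V nonzero at 0, and again V'
  = k M. In the moving frame this reads l = k \<kappa> and \<theta>' \<kappa> = k m. Comparing
  derivatives at 0, where k has a simple zero and \<kappa>' = 0, gives all four claims; the last one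
  comes down to m'(0), which sees the t^5 direction of the model.\<close>

lemma frontal_cusp_5_2_conditions:
  assumes \<gamma>s: "smooth_germ \<gamma> 0" and l: "smooth_germ l 0" and \<theta>: "smooth_germ \<theta> 0"
    and \<gamma>: "\<forall>\<^sub>F t in nhds 0. (\<gamma> has_vector_derivative l t *\<^sub>R unit_vec (\<theta> t)) (at t)"
    and cusp: "cusp_5_2 \<gamma>"
  shows "l 0 = 0" "deriv l 0 \<noteq> 0" "deriv \<theta> 0 = 0"
    "deriv l 0 * (deriv ^^ 3) \<theta> 0 - (deriv ^^ 2) l 0 * (deriv ^^ 2) \<theta> 0 \<noteq> 0"
proof -
  obtain \<phi> \<Psi> where \<phi>: "diffeo_germ \<phi> 0 0" and \<Psi>: "diffeo_germ \<Psi> (\<gamma> 0) 0"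
    and eq: "\<forall>\<^sub>F t in nhds 0. \<Psi> (\<gamma> (\<phi> t)) = curve_2_5 t"
    using cusp unfolding cusp_5_2_def curve_germs_equivalent_def curve_2_5_def[symmetric] by auto
  obtain \<psi> where \<psi>: "diffeo_germ \<psi> 0 0" "\<forall>\<^sub>F t in nhds 0. \<phi> (\<psi> t) = t"
    using diffeo_germ_sym[OF \<phi>] by metis
  obtain G where G: "diffeo_germ G 0 (\<gamma> 0)" "\<forall>\<^sub>F x in nhds (\<gamma> 0). G (\<Psi> x) = x"
    using diffeo_germ_sym[OF \<Psi>] by metis
  have \<psi>s: "smooth_germ \<psi> 0" and Gs: "smooth_germ G 0"
    using \<psi>(1) G(1) diffeo_germ_smooth_germ by blast+
  have \<psi>0: "\<psi> 0 = 0" and \<phi>0: "\<phi> 0 = 0" using \<psi>(1) \<phi> by (simp_all add: diffeo_germ_def)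
  have "filterlim \<gamma> (nhds (\<gamma> 0)) (nhds 0)"
    using smooth_germ_isCont[OF \<gamma>s] by (metis isCont_def tendsto_at_iff_tendsto_nhds)
  from eventually_compose_filterlim[OF G(2) this]
    eventually_compose_filterlim[OF eq filterlim_nhds_0_smooth_germ[OF \<psi>s \<psi>0]] \<psi>(2)
  have \<gamma>G: "\<forall>\<^sub>F t in nhds 0. \<gamma> t = G (curve_2_5 (\<psi> t))" by eventually_elim metis
  \<comment> \<open>Velocities are compared at all parameters near 0, so the equality is needed
    around each of them.\<close>
  then have \<gamma>G_near: "\<forall>\<^sub>F t in nhds 0. \<forall>\<^sub>F s in nhds t. \<gamma> s = G (curve_2_5 (\<psi> s))"
    by (simp only: eventually_eventually)
  define p q where "p = (\<lambda>t. partial_x G (curve_2_5 (\<psi> t)))" and "q = (\<lambda>t. partial_y G (curve_2_5 (\<psi> t)))"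
  define p1 p2 where "p1 = (\<lambda>t. partial_x (partial_x G) (curve_2_5 (\<psi> t)))"
    and "p2 = (\<lambda>t. partial_y (partial_x G) (curve_2_5 (\<psi> t)))"
  define q1 q2 where "q1 = (\<lambda>t. partial_x (partial_y G) (curve_2_5 (\<psi> t)))"
    and "q2 = (\<lambda>t. partial_y (partial_y G) (curve_2_5 (\<psi> t)))"
  note defs = p_def q_def p1_def p2_def q1_def q2_def
  have comp: "smooth_germ (\<lambda>t. H (curve_2_5 (\<psi> t))) 0" if "smooth_germ H 0" for H :: "real^2 \<Rightarrow> real^2"
    by (rule smooth_germ_compose[OF _ smooth_germ_curve_2_5[OF \<psi>s]]) (simp add: that \<psi>0)
  have s: "smooth_germ p 0" "smooth_germ q 0" "smooth_germ p1 0" "smooth_germ p2 0" "smooth_germ q1 0" "smooth_germ q2 0"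
    unfolding defs by (intro comp smooth_germ_partial Gs)+
  define k where "k = (\<lambda>t. \<psi> t * deriv \<psi> t)"
  define V where "V = (\<lambda>t. 2 *\<^sub>R p t + (5 * \<psi> t ^ 3) *\<^sub>R q t)"
  define M where "M = (\<lambda>t. 4 *\<^sub>R p1 t + (10 * \<psi> t ^ 3) *\<^sub>R p2 t + (15 * \<psi> t) *\<^sub>R q t
    + (10 * \<psi> t ^ 3) *\<^sub>R q1 t + (25 * \<psi> t ^ 6) *\<^sub>R q2 t)"
  have ks: "smooth_germ k 0" unfolding k_def by (intro smooth_germ_intros smooth_germ_deriv \<psi>s)
  have Vs: "smooth_germ V 0" and Ms: "smooth_germ M 0"
    unfolding V_def M_def by (intro smooth_germ_intros s \<psi>s)+
  have \<gamma>V: "\<forall>\<^sub>F t in nhds 0. l t *\<^sub>R unit_vec (\<theta> t) = k t *\<^sub>R V t"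
    using \<gamma> curve_2_5_chain[OF Gs \<psi>s \<psi>0] \<gamma>G_near
  proof eventually_elim
    case (elim t)
    have "((\<lambda>t. G (curve_2_5 (\<psi> t))) has_vector_derivative l t *\<^sub>R unit_vec (\<theta> t)) (at t)"
      using elim(1) has_vector_derivative_cong_ev[of UNIV \<gamma> "\<lambda>t. G (curve_2_5 (\<psi> t))" t "l t *\<^sub>R unit_vec (\<theta> t)"]
        elim(3) eventually_nhds_x_imp_x[OF elim(3)] by simp
    from vector_derivative_unique_at[OF this elim(2)]
    show ?case by (simp add: k_def V_def p_def q_def scaleR_add_right mult_ac power_numeral_reduce)
  qed
  have V': "\<forall>\<^sub>F t in nhds 0. (V has_vector_derivative k t *\<^sub>R M t) (at t)"
    using curve_2_5_chain[OF smooth_germ_partial[OF Gs] \<psi>s \<psi>0, of "axis 1 1"]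
      curve_2_5_chain[OF smooth_germ_partial[OF Gs] \<psi>s \<psi>0, of "axis 2 1"] smooth_germ_eventually_DERIV[OF \<psi>s]
  proof eventually_elim
    case (elim t)
    note p' = elim(1)[folded defs] and q' = elim(2)[folded defs]
    have "((\<lambda>t. 5 * \<psi> t ^ 3) has_real_derivative 15 * \<psi> t ^ 2 * deriv \<psi> t) (at t)"
      using elim(3) by (auto intro!: derivative_eq_intros)
    from has_vector_derivative_add[OF bounded_linear.has_vector_derivative[OF bounded_linear_scaleR_right p', of 2]
        has_vector_derivative_scaleR[OF this q']]
    show ?case unfolding V_def
      by (rule has_vector_derivative_eq_rhs)
         (unfold M_def k_def defs vec_eq_iff vector_add_component vector_scaleR_component real_scaleR_def, intro allI, algebra)
  qed
  define e where "e = (\<lambda>t. unit_vec (\<theta> t))"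
  define J where "J = (\<lambda>t. normal_vec (\<theta> t))"
  \<comment> \<open>Tangential and normal components of \<open>V\<close>; below, \<open>m\<close>
    and \<open>r\<close> are the normal and tangential components of its derivative after division
    by \<open>k\<close>.\<close>
  define \<kappa> n where "\<kappa> = (\<lambda>t. V t \<bullet> e t)" and "n = (\<lambda>t. V t \<bullet> J t)"
  define m r where "m = (\<lambda>t. M t \<bullet> J t)" and "r = (\<lambda>t. M t \<bullet> e t)"
  have es: "smooth_germ e 0" and Js: "smooth_germ J 0"
    unfolding e_def J_def by (intro smooth_germ_unit_vec smooth_germ_normal_vec \<theta>)+
  have \<kappa>s: "smooth_germ \<kappa> 0" and ns: "smooth_germ n 0" and ms: "smooth_germ m 0" and rs: "smooth_germ r 0"
    unfolding \<kappa>_def n_def m_def r_def by (intro smooth_germ_inner Vs Ms es Js)+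
  have \<theta>': "smooth_germ (deriv \<theta>) 0" by (rule smooth_germ_deriv[OF \<theta>])
  have lk: "\<forall>\<^sub>F t in nhds 0. l t = k t * \<kappa> t"
    using \<gamma>V
  proof eventually_elim
    case (elim t)
    from arg_cong[OF this, of "\<lambda>x. x \<bullet> e t"] show ?case by (simp add: e_def \<kappa>_def)
  qed
  have kn: "\<forall>\<^sub>F t in nhds 0. k t * n t = 0"
    using \<gamma>V
  proof eventually_elim
    case (elim t)
    from arg_cong[OF this, of "\<lambda>x. x \<bullet> J t"] show ?case by (simp add: J_def n_def)
  qed
  have \<psi>1: "deriv \<psi> 0 \<noteq> 0" by (rule diffeo_germ_deriv_nonzero[OF \<psi>(1)])
  \<comment> \<open>As \<open>\<phi>\<close> inverts \<open>\<psi>\<close>, the only zero of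
    \<open>k\<close> near 0 is 0 itself. So the normal component \<open>n\<close> vanishes
    elsewhere, and by continuity also at 0.\<close>
  have n_punctured: "\<forall>\<^sub>F t in nhds 0. t \<noteq> 0 \<longrightarrow> n t = 0"
    using kn \<psi>(2) smooth_germ_eventually_nonzero[OF smooth_germ_deriv[OF \<psi>s] \<psi>1]
  proof eventually_elim
    case (elim t)
    then show ?case using \<phi>0 by (cases "\<psi> t = 0") (auto simp: k_def)
  qed
  have "(n \<longlongrightarrow> 0) (at 0)"
    by (rule tendsto_eventually) (use n_punctured in \<open>simp add: eventually_at_filter\<close>)
  then have n00: "n 0 = 0"
    using smooth_germ_isCont[OF ns] LIM_unique unfolding isCont_def by blast
  have n0: "\<forall>\<^sub>F t in nhds 0. n t = 0"
    using n_punctured by eventually_elim (use n00 in metis)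
  then have n_near: "\<forall>\<^sub>F t in nhds 0. \<forall>\<^sub>F s in nhds t. n s = 0" by (simp only: eventually_eventually)
  have \<kappa>': "\<forall>\<^sub>F t in nhds 0. deriv \<kappa> t = k t * r t"
    using V' smooth_germ_eventually_DERIV[OF \<theta>] n0
  proof eventually_elim
    case (elim t)
    from bounded_bilinear.has_vector_derivative[OF bounded_bilinear_inner elim(1) unit_vec_has_vector_derivative[OF elim(2)]]
    have "(\<kappa> has_real_derivative deriv \<theta> t * n t + k t * r t) (at t)"
      by (simp add: has_real_derivative_iff_has_vector_derivative \<kappa>_def n_def r_def e_def J_def)
    with elim(3) show ?case by (simp add: DERIV_imp_deriv)
  qed
  \<comment> \<open>This is the derivative of the identity n = 0: turning of the frame must
    compensate the normal part of V'.\<close>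
  have \<theta>\<kappa>: "\<forall>\<^sub>F t in nhds 0. deriv \<theta> t * \<kappa> t = k t * m t"
    using V' smooth_germ_eventually_DERIV[OF \<theta>] n_near
  proof eventually_elim
    case (elim t)
    from bounded_bilinear.has_vector_derivative[OF bounded_bilinear_inner elim(1) normal_vec_has_vector_derivative[OF elim(2)]]
    have "(n has_real_derivative - (deriv \<theta> t * \<kappa> t) + k t * m t) (at t)"
      by (simp add: has_real_derivative_iff_has_vector_derivative \<kappa>_def n_def m_def e_def J_def)
    moreover have "deriv n t = 0" using deriv_cong_ev[OF elim(3) refl] by simp
    ultimately show ?case using DERIV_imp_deriv by fastforce
  qed
  have k0: "k 0 = 0" by (simp add: k_def \<psi>0)
  have k1: "deriv k 0 = deriv \<psi> 0 ^ 2"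
    unfolding k_def by (simp add: smooth_germ_deriv_mult[OF \<psi>s smooth_germ_deriv[OF \<psi>s]] \<psi>0 power2_eq_square)
  have \<kappa>1: "deriv \<kappa> 0 = 0" using eventually_nhds_x_imp_x[OF \<kappa>'] k0 by simp
  have V0: "V 0 = \<kappa> 0 *\<^sub>R e 0"
    using unit_normal_representation[of "V 0" "\<theta> 0"] n00 by (simp add: \<kappa>_def n_def e_def J_def)
  have "2 *\<^sub>R p 0 = \<kappa> 0 *\<^sub>R e 0" using V0 by (simp add: V_def \<psi>0)
  from arg_cong[OF this, of "\<lambda>x. (1 / 2) *\<^sub>R x"] have p0: "p 0 = (\<kappa> 0 / 2) *\<^sub>R e 0" by simp
  \<comment> \<open>The Jacobian determinant of \<open>G\<close> at the origin. Since
    \<open>p 0\<close> is tangential, it is the product of \<kappa>(0) / 2 and the normal component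
    of \<open>q 0\<close>, so neither vanishes.\<close>
  have "wedge (p 0) (q 0) \<noteq> 0"
    using diffeo_germ_wedge_nonzero[OF G(1)] by (simp add: p_def q_def \<psi>0)
  then have \<kappa>0: "\<kappa> 0 \<noteq> 0" and qJ: "q 0 \<bullet> J 0 \<noteq> 0"
    unfolding p0 bounded_bilinear.scaleR_left[OF bounded_bilinear_wedge] e_def J_def
    by (auto simp: wedge_unit_vec)
  have "l 0 = k 0 * \<kappa> 0" by (rule eventually_nhds_x_imp_x[OF lk])
  with k0 show "l 0 = 0" by simp
  have l1: "deriv l 0 = deriv k 0 * \<kappa> 0"
    using deriv_funpow_cong_ev[OF lk, of 1] by (simp add: smooth_germ_deriv_mult ks \<kappa>s k0)
  then show "deriv l 0 \<noteq> 0" using k1 \<psi>1 \<kappa>0 by simp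
  have l2: "(deriv ^^ 2) l 0 = (deriv ^^ 2) k 0 * \<kappa> 0"
    using deriv_funpow_cong_ev[OF lk, of 2] by (simp add: smooth_germ_deriv2_mult ks \<kappa>s k0 \<kappa>1)
  have "deriv \<theta> 0 * \<kappa> 0 = k 0 * m 0" by (rule eventually_nhds_x_imp_x[OF \<theta>\<kappa>])
  with k0 \<kappa>0 show \<theta>1: "deriv \<theta> 0 = 0" by simp
  have \<theta>2: "(deriv ^^ 2) \<theta> 0 * \<kappa> 0 = deriv k 0 * m 0"
    using deriv_funpow_cong_ev[OF \<theta>\<kappa>, of 1]
    by (simp add: smooth_germ_deriv_mult ks ms \<theta>' \<kappa>s k0 \<theta>1 numeral_2_eq_2)
  have \<theta>3: "(deriv ^^ 3) \<theta> 0 * \<kappa> 0 = (deriv ^^ 2) k 0 * m 0 + 2 * deriv k 0 * deriv m 0"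
    using deriv_funpow_cong_ev[OF \<theta>\<kappa>, of 2]
    unfolding smooth_germ_deriv2_mult[OF \<theta>' \<kappa>s] smooth_germ_deriv2_mult[OF ks ms]
    by (simp add: k0 \<theta>1 \<kappa>1 numeral_2_eq_2 numeral_3_eq_3)
  \<comment> \<open>Among the terms of \<open>M\<close> only \<open>15 * \<psi> t\<close> times
    \<open>q t\<close> has a nonzero derivative at 0: \<open>p1\<close> is taken along a curve of
    zero velocity, and the other terms contain at least the cube of \<open>\<psi>\<close>. The frame
    is stationary there because \<theta>'(0) = 0.\<close>
  have m1: "deriv m 0 = 15 * deriv \<psi> 0 * (q 0 \<bullet> J 0)"
  proof -
    have "(p1 has_vector_derivative 0) (at 0)"
      using eventually_nhds_x_imp_x[OF curve_2_5_chain[OF smooth_germ_partial[OF smooth_germ_partial[OF Gs]] \<psi>s \<psi>0,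
          of "axis 1 1" "axis 1 1"]] by (simp add: p1_def \<psi>0)
    note p1' = bounded_linear.has_vector_derivative[OF bounded_linear_scaleR_right this, of 4]
    have cube: "((\<lambda>t. 10 * \<psi> t ^ 3) has_real_derivative 0) (at 0)"
      and six: "((\<lambda>t. 25 * \<psi> t ^ 6) has_real_derivative 0) (at 0)"
      and one: "((\<lambda>t. 15 * \<psi> t) has_real_derivative 15 * deriv \<psi> 0) (at 0)"
      using smooth_germ_DERIV[OF \<psi>s] \<psi>0 by (auto intro!: derivative_eq_intros)
    note vd = smooth_germ_has_vector_derivative
    have "(M has_vector_derivative (15 * deriv \<psi> 0) *\<^sub>R q 0) (at 0)"
      unfolding M_def
      by (rule has_vector_derivative_eq_rhs[OF has_vector_derivative_add[OF has_vector_derivative_add[OF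
          has_vector_derivative_add[OF has_vector_derivative_add[OF p1'
            has_vector_derivative_scaleR[OF cube vd[OF s(4)]]] has_vector_derivative_scaleR[OF one vd[OF s(2)]]]
            has_vector_derivative_scaleR[OF cube vd[OF s(5)]]] has_vector_derivative_scaleR[OF six vd[OF s(6)]]]])
         (simp add: \<psi>0)
    from bounded_bilinear.has_vector_derivative[OF bounded_bilinear_inner this
        normal_vec_has_vector_derivative[OF smooth_germ_DERIV[OF \<theta>]]]
    have "(m has_real_derivative 15 * deriv \<psi> 0 * (q 0 \<bullet> J 0)) (at 0)"
      by (simp add: has_real_derivative_iff_has_vector_derivative m_def J_def \<theta>1)
    then show ?thesis by (rule DERIV_imp_deriv)
  qed
  \<comment> \<open>The factor \<kappa>(0) allows \<open>\<theta>2\<close> and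
    \<open>\<theta>3\<close> to be inserted without dividing; the terms with k'' cancel.\<close>
  have "(deriv l 0 * (deriv ^^ 3) \<theta> 0 - (deriv ^^ 2) l 0 * (deriv ^^ 2) \<theta> 0) * \<kappa> 0
      = deriv k 0 * \<kappa> 0 * ((deriv ^^ 3) \<theta> 0 * \<kappa> 0) - (deriv ^^ 2) k 0 * \<kappa> 0 * ((deriv ^^ 2) \<theta> 0 * \<kappa> 0)"
    by (simp add: l1 l2 algebra_simps)
  also have "\<dots> = 2 * deriv k 0 ^ 2 * \<kappa> 0 * deriv m 0"
    unfolding \<theta>2 \<theta>3 by algebra
  also have "\<dots> \<noteq> 0" using k1 \<psi>1 \<kappa>0 m1 qJ by simp
  finally show "deriv l 0 * (deriv ^^ 3) \<theta> 0 - (deriv ^^ 2) l 0 * (deriv ^^ 2) \<theta> 0 \<noteq> 0" by auto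
qed

subsection \<open>Parallel pairs of frontals\<close>

lemma abs_rp2_scaleR: "p \<noteq> 0 \<Longrightarrow> c \<noteq> 0 \<Longrightarrow> abs_rp2 (c *\<^sub>R p) = abs_rp2 p"
  using Quotient3_rel_abs[OF Quotient3_rp2, of p "c *\<^sub>R p"] by force

lemma tendsto_abs_rp2:
  assumes "(p \<longlongrightarrow> p0) F" "p0 \<noteq> 0"
  shows "((\<lambda>t. abs_rp2 (p t)) \<longlongrightarrow> abs_rp2 p0) F"
proof (rule topological_tendstoI)
  fix A :: "rp2 set" assume "open A" "abs_rp2 p0 \<in> A"
  then have "\<forall>\<^sub>F t in F. p t \<in> {p. p \<noteq> 0 \<and> abs_rp2 p \<in> A}"
    using assms by (intro topological_tendstoD[OF assms(1)]) (auto simp: open_rp2_def)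
  then show "\<forall>\<^sub>F t in F. abs_rp2 (p t) \<in> A" by eventually_elim simp
qed

lemma unit_vec_add_pi: "unit_vec (u + pi) = - unit_vec u"
  by (simp add: unit_vec_def vec_eq_iff forall_2)

text \<open>The cusp hypothesis enters through its consequences \<open>l0\<close>,
  \<open>l1\<close>, \<open>\<theta>1\<close> and \<open>disc\<close>, which are all that the
  caustic and the centre symmetry set require of it.\<close>

locale parallel_pair =
  fixes \<gamma>p \<gamma>m :: "real \<Rightarrow> real^2" and l \<theta> \<rho>m :: "real \<Rightarrow> real" and r :: real
  assumes \<gamma>p: "smooth_germ \<gamma>p 0" and l: "smooth_germ l 0" and \<theta>: "smooth_germ \<theta> 0"
    and \<gamma>p': "\<forall>\<^sub>F t in nhds 0. (\<gamma>p has_vector_derivative l t *\<^sub>R unit_vec (\<theta> t)) (at t)"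
    and \<gamma>m: "smooth_germ \<gamma>m (\<theta> 0)" and \<rho>m: "smooth_germ \<rho>m (\<theta> 0)"
    and \<gamma>m': "\<forall>\<^sub>F u in nhds (\<theta> 0). (\<gamma>m has_vector_derivative (- \<rho>m u) *\<^sub>R unit_vec u) (at u)"
    and r: "r = \<rho>m (\<theta> 0)"
    and l0: "l 0 = 0" and l1: "deriv l 0 \<noteq> 0" and \<theta>1: "deriv \<theta> 0 = 0"
    and disc: "deriv l 0 * (deriv ^^ 3) \<theta> 0 - (deriv ^^ 2) l 0 * (deriv ^^ 2) \<theta> 0 \<noteq> 0"
    and chord0: "chord \<gamma>p \<gamma>m \<theta> 0 \<noteq> 0"
begin

text \<open>The opposite point \<open>\<gamma>m (\<theta> t)\<close> moves with velocity
  \<open>- b t\<close> times the common tangent. Speeds and ratios of both derived curves are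
  expressed by \<open>l\<close> and \<open>b\<close>.\<close>

definition b :: "real \<Rightarrow> real" where
  "b = (\<lambda>t. \<rho>m (\<theta> t) * deriv \<theta> t)"

lemma b: "smooth_germ b 0"
  unfolding b_def by (intro smooth_germ_mult smooth_germ_compose[OF \<rho>m \<theta>] smooth_germ_deriv \<theta>)

lemma b0: "b 0 = 0"
  by (simp add: b_def \<theta>1)

lemma b1: "deriv b 0 = r * (deriv ^^ 2) \<theta> 0"
  unfolding b_def
  by (simp add: smooth_germ_deriv_mult[OF smooth_germ_compose[OF \<rho>m \<theta>] smooth_germ_deriv[OF \<theta>]] r \<theta>1 numeral_2_eq_2)

text \<open>As \<theta>'(0) = 0, the factor \<rho>m(\<theta>(t)) is stationary at 0, so no
  derivative of \<rho>m appears.\<close>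

lemma b2: "(deriv ^^ 2) b 0 = r * (deriv ^^ 3) \<theta> 0"
proof -
  have "deriv (\<lambda>t. \<rho>m (\<theta> t)) 0 = 0"
    using DERIV_chain2[OF smooth_germ_DERIV[OF \<rho>m] smooth_germ_DERIV[OF \<theta>]] \<theta>1 by (simp add: DERIV_imp_deriv)
  then show ?thesis
    unfolding b_def smooth_germ_deriv2_mult[OF smooth_germ_compose[OF \<rho>m \<theta>] smooth_germ_deriv[OF \<theta>]]
    by (simp add: r \<theta>1 numeral_2_eq_2 numeral_3_eq_3)
qed

lemma opposite: "smooth_germ (\<lambda>t. \<gamma>m (\<theta> t)) 0"
  by (rule smooth_germ_compose[OF \<gamma>m \<theta>])

lemma opposite_derivative:
  "\<forall>\<^sub>F t in nhds 0. ((\<lambda>t. \<gamma>m (\<theta> t)) has_vector_derivative (- b t) *\<^sub>R unit_vec (\<theta> t)) (at t)"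
proof -
  have "filterlim \<theta> (nhds (\<theta> 0)) (nhds 0)"
    using smooth_germ_isCont[OF \<theta>] by (metis isCont_def tendsto_at_iff_tendsto_nhds)
  from eventually_compose_filterlim[OF \<gamma>m' this] smooth_germ_eventually_DERIV[OF \<theta>]
  show ?thesis
  proof eventually_elim
    case (elim t)
    from vector_diff_chain_at[OF elim(2)[unfolded has_real_derivative_iff_has_vector_derivative] elim(1)]
    show ?case by (simp add: o_def b_def mult.commute)
  qed
qed

lemma wigner_derivative:
  "\<forall>\<^sub>F t in nhds 0. (wigner_caustic \<gamma>p \<gamma>m \<theta> has_vector_derivative (1/2 * l t + - 1/2 * b t) *\<^sub>R unit_vec (\<theta> t)) (at t)"
  using \<gamma>p' opposite_derivative
proof eventually_elim
  case (elim t)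
  from bounded_linear.has_vector_derivative[OF bounded_linear_scaleR_right has_vector_derivative_add[OF elim], of "1/2"]
  show ?case by (simp add: wigner_caustic_def[abs_def] algebra_simps)
qed

text \<open>The speed (l - b) / 2 is spelled as a sum of constant multiples to fit the linearity
  rules for iterated derivatives.\<close>

lemma wigner_speed:
  defines "w \<equiv> \<lambda>t. 1/2 * l t + - 1/2 * b t"
  shows "smooth_germ w 0" "w 0 = 0" "deriv w 0 = (deriv l 0 - r * (deriv ^^ 2) \<theta> 0) / 2"
    "(deriv ^^ 2) w 0 = ((deriv ^^ 2) l 0 - r * (deriv ^^ 3) \<theta> 0) / 2"
proof -
  have s: "smooth_germ (\<lambda>t. 1/2 * l t) 0" "smooth_germ (\<lambda>t. - 1/2 * b t) 0"
    by (intro smooth_germ_mult smooth_germ_const l b)+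
  show "smooth_germ w 0" unfolding w_def by (rule smooth_germ_add[OF s])
  have "(deriv ^^ n) w 0 = 1/2 * (deriv ^^ n) l 0 + - 1/2 * (deriv ^^ n) b 0" for n
    unfolding w_def smooth_germ_deriv_add[OF s] smooth_germ_deriv_cmult[OF l] smooth_germ_deriv_cmult[OF b] ..
  from this[of 0] this[of 1] this[of 2] show "w 0 = 0" "deriv w 0 = (deriv l 0 - r * (deriv ^^ 2) \<theta> 0) / 2"
    "(deriv ^^ 2) w 0 = ((deriv ^^ 2) l 0 - r * (deriv ^^ 3) \<theta> 0) / 2"
    by (simp_all add: l0 b0 b1 b2 field_simps)
qed

text \<open>In the determinant for the new speed the products r \<theta>'' \<theta>''' occur twice
  with opposite signs; what remains is half of the old one.\<close>

lemma wigner_cusp_5_2: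
  assumes "deriv l 0 - r * (deriv ^^ 2) \<theta> 0 \<noteq> 0"
  shows "cusp_5_2 (wigner_caustic \<gamma>p \<gamma>m \<theta>)"
proof (rule frontal_cusp_5_2[OF wigner_speed(1) \<theta> wigner_derivative wigner_speed(2) _ \<theta>1])
  show "deriv (\<lambda>t. 1/2 * l t + - 1/2 * b t) 0 * (deriv ^^ 3) \<theta> 0
      - (deriv ^^ 2) (\<lambda>t. 1/2 * l t + - 1/2 * b t) 0 * (deriv ^^ 2) \<theta> 0 \<noteq> 0"
    unfolding wigner_speed(3,4) using disc by (simp add: algebra_simps flip: diff_divide_distrib)
qed (unfold wigner_speed(3), use assms in simp)

text \<open>With l' = r \<theta>'' the expression in \<open>disc\<close> factors as \<theta>'' (r
  \<theta>''' - l''), and the second factor is -2 times the second derivative of the speed.\<close>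

lemma wigner_cusp_5_3:
  assumes "deriv l 0 - r * (deriv ^^ 2) \<theta> 0 = 0"
  shows "cusp_5_3 (wigner_caustic \<gamma>p \<gamma>m \<theta>)"
proof (rule frontal_cusp_5_3[OF wigner_speed(1) \<theta> wigner_derivative wigner_speed(2) _ \<theta>1])
  have e: "deriv l 0 = r * (deriv ^^ 2) \<theta> 0" using assms by simp
  show "(deriv ^^ 2) \<theta> 0 \<noteq> 0" using l1 e by auto
  show "(deriv ^^ 2) (\<lambda>t. 1/2 * l t + - 1/2 * b t) 0 \<noteq> 0"
    unfolding wigner_speed(4) using disc e by auto
qed (unfold wigner_speed(3), use assms in simp)

section \<open>The centre symmetry set: regular case and degeneration to infinity\<close>

lemma css_denom_eq: "css_denom l \<theta> \<rho>m t = l t + b t"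
  by (simp add: css_denom_def b_def)

lemma css_ratio_eq: "css_ratio l \<theta> \<rho>m t = b t / (l t + b t)"
  by (simp add: css_ratio_def css_denom_eq b_def)

text \<open>After cancelling \<open>t\<close>, the quotient N / D extends the ratio, and N \<gamma>p
  + k \<gamma>m together with D are homogeneous coordinates of the projective set for t \<noteq>
  0.\<close>

lemma css_quotients:
  obtains N D k where "smooth_germ N 0" "smooth_germ D 0" "smooth_germ k 0"
    "\<forall>\<^sub>F t in nhds 0. b t = t * N t" "\<forall>\<^sub>F t in nhds 0. l t + b t = t * D t" "\<forall>\<^sub>F t in nhds 0. l t = t * k t"
    "N 0 = r * (deriv ^^ 2) \<theta> 0" "deriv N 0 = r * (deriv ^^ 3) \<theta> 0 / 2"
    "D 0 = deriv l 0 + r * (deriv ^^ 2) \<theta> 0" "deriv D 0 = ((deriv ^^ 2) l 0 + r * (deriv ^^ 3) \<theta> 0) / 2"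
    "k 0 = deriv l 0"
proof -
  obtain N where N: "smooth_germ N 0" "\<forall>\<^sub>F t in nhds 0. b t = t * N t" "N 0 = deriv b 0"
    "deriv N 0 = (deriv ^^ 2) b 0 / 2" by (rule smooth_germ_divide_by_id[OF b b0])
  obtain k where k: "smooth_germ k 0" "\<forall>\<^sub>F t in nhds 0. l t = t * k t" "k 0 = deriv l 0"
    using smooth_germ_divide_by_id[OF l l0] by metis
  have lb: "l 0 + b 0 = 0" using l0 b0 by simp
  obtain D where D: "smooth_germ D 0" "\<forall>\<^sub>F t in nhds 0. l t + b t = t * D t"
    "D 0 = deriv (\<lambda>t. l t + b t) 0" "deriv D 0 = (deriv ^^ 2) (\<lambda>t. l t + b t) 0 / 2"
    by (rule smooth_germ_divide_by_id[OF smooth_germ_add[OF l b] lb])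
  show thesis
    using that[OF N(1) D(1) k(1) N(2) D(2) k(2)] N(3,4) D(3,4) k(3) smooth_germ_deriv_add[OF l b, of 1]
      smooth_germ_deriv_add[OF l b, of 2] b1 b2 by simp
qed

lemma css_regular:
  assumes r0: "r \<noteq> 0" and reg: "deriv l 0 + r * (deriv ^^ 2) \<theta> 0 \<noteq> 0"
  shows "\<forall>\<^sub>F t in at 0. css_denom l \<theta> \<rho>m t \<noteq> 0"
    and "\<exists>S. smooth_extension_at_0 (css \<gamma>p \<gamma>m l \<theta> \<rho>m) S \<and> vector_derivative S (at 0) \<noteq> 0"
    and "\<exists>\<Lambda>. smooth_extension_at_0 (css_ratio l \<theta> \<rho>m) \<Lambda> \<and>
          \<Lambda> 0 = r * (deriv ^^ 2) \<theta> 0 / (deriv l 0 + r * (deriv ^^ 2) \<theta> 0) \<and>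
          deriv \<Lambda> 0 =
            r * (deriv l 0 * (deriv ^^ 3) \<theta> 0 - (deriv ^^ 2) l 0 * (deriv ^^ 2) \<theta> 0) /
            (2 * (deriv l 0 + r * (deriv ^^ 2) \<theta> 0) ^ 2) \<and>
          deriv \<Lambda> 0 \<noteq> 0"
proof -
  obtain N D k where s: "smooth_germ N 0" "smooth_germ D 0" "smooth_germ k 0"
    and N: "\<forall>\<^sub>F t in nhds 0. b t = t * N t" and D: "\<forall>\<^sub>F t in nhds 0. l t + b t = t * D t"
    and "\<forall>\<^sub>F t in nhds 0. l t = t * k t"
    and v: "N 0 = r * (deriv ^^ 2) \<theta> 0" "deriv N 0 = r * (deriv ^^ 3) \<theta> 0 / 2"
    "D 0 = deriv l 0 + r * (deriv ^^ 2) \<theta> 0" "deriv D 0 = ((deriv ^^ 2) l 0 + r * (deriv ^^ 3) \<theta> 0) / 2"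
    "k 0 = deriv l 0"
    by (rule css_quotients)
  have D0: "D 0 \<noteq> 0" using reg v(3) by simp
  have Dn: "\<forall>\<^sub>F t in at 0. D t \<noteq> 0 \<and> t \<noteq> 0 \<and> b t = t * N t \<and> l t + b t = t * D t"
    unfolding eventually_at_filter using smooth_germ_eventually_nonzero[OF s(2) D0] N D
    by eventually_elim simp
  then show "\<forall>\<^sub>F t in at 0. css_denom l \<theta> \<rho>m t \<noteq> 0"
    by eventually_elim (metis css_denom_eq mult_eq_0_iff)
  let ?\<Lambda> = "\<lambda>t. N t / D t"
  have \<Lambda>s: "smooth_germ ?\<Lambda> 0" by (rule smooth_germ_divide[OF s(1,2) D0])
  have \<Lambda>e: "\<forall>\<^sub>F t in at 0. ?\<Lambda> t = css_ratio l \<theta> \<rho>m t"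
    using Dn
  proof eventually_elim
    case (elim t)
    then have "css_ratio l \<theta> \<rho>m t = (t * N t) / (t * D t)" by (metis css_ratio_eq)
    with elim show ?case by simp
  qed
  have "(?\<Lambda> has_real_derivative (deriv N 0 * D 0 - N 0 * deriv D 0) / (D 0 * D 0)) (at 0)"
    by (rule DERIV_divide[OF smooth_germ_DERIV[OF s(1)] smooth_germ_DERIV[OF s(2)] D0])
  then have "deriv ?\<Lambda> 0 = (deriv N 0 * D 0 - N 0 * deriv D 0) / (D 0 * D 0)" by (rule DERIV_imp_deriv)
  \<comment> \<open>The terms quadratic in \<open>r\<close> cancel.\<close>
  also have "deriv N 0 * D 0 - N 0 * deriv D 0 = r * (deriv l 0 * (deriv ^^ 3) \<theta> 0 - (deriv ^^ 2) l 0 * (deriv ^^ 2) \<theta> 0) / 2"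
    unfolding v by (simp add: field_simps)
  also have "\<dots> / (D 0 * D 0) = r * (deriv l 0 * (deriv ^^ 3) \<theta> 0 - (deriv ^^ 2) l 0 * (deriv ^^ 2) \<theta> 0) / (2 * D 0 ^ 2)"
    by (simp add: power2_eq_square)
  finally have \<Lambda>1: "deriv ?\<Lambda> 0 = r * (deriv l 0 * (deriv ^^ 3) \<theta> 0 - (deriv ^^ 2) l 0 * (deriv ^^ 2) \<theta> 0) / (2 * D 0 ^ 2)" .
  then have \<Lambda>1': "deriv ?\<Lambda> 0 \<noteq> 0" using disc r0 D0 by simp
  show "\<exists>\<Lambda>. smooth_extension_at_0 (css_ratio l \<theta> \<rho>m) \<Lambda> \<and>
          \<Lambda> 0 = r * (deriv ^^ 2) \<theta> 0 / (deriv l 0 + r * (deriv ^^ 2) \<theta> 0) \<and>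
          deriv \<Lambda> 0 =
            r * (deriv l 0 * (deriv ^^ 3) \<theta> 0 - (deriv ^^ 2) l 0 * (deriv ^^ 2) \<theta> 0) /
            (2 * (deriv l 0 + r * (deriv ^^ 2) \<theta> 0) ^ 2) \<and>
          deriv \<Lambda> 0 \<noteq> 0"
    using \<Lambda>s \<Lambda>e \<Lambda>1 \<Lambda>1' v by (intro exI[of _ ?\<Lambda>]) (simp add: smooth_extension_at_0_def)
  let ?S = "\<lambda>t. \<gamma>m (\<theta> t) + ?\<Lambda> t *\<^sub>R chord \<gamma>p \<gamma>m \<theta> t"
  have "smooth_germ ?S 0"
    unfolding chord_def by (intro smooth_germ_add smooth_germ_scaleR smooth_germ_diff \<Lambda>s \<gamma>p opposite)
  moreover have "\<forall>\<^sub>F t in at 0. ?S t = css \<gamma>p \<gamma>m l \<theta> \<rho>m t"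
    using \<Lambda>e by eventually_elim (simp add: css_def)
  \<comment> \<open>Both points of the parallel pair are at rest for t = 0, so the velocity comes
    from the ratio alone and points along the chord.\<close>
  moreover have "vector_derivative ?S (at 0) = deriv ?\<Lambda> 0 *\<^sub>R chord \<gamma>p \<gamma>m \<theta> 0"
  proof (rule vector_derivative_at)
    have m: "((\<lambda>t. \<gamma>m (\<theta> t)) has_vector_derivative 0) (at 0)"
      using eventually_nhds_x_imp_x[OF opposite_derivative] b0 by simp
    have p: "(\<gamma>p has_vector_derivative 0) (at 0)" using eventually_nhds_x_imp_x[OF \<gamma>p'] l0 by simp
    from has_vector_derivative_add[OF m has_vector_derivative_scaleR[OF smooth_germ_DERIV[OF \<Lambda>s]
        has_vector_derivative_diff[OF p m]]]
    show "(?S has_vector_derivative deriv ?\<Lambda> 0 *\<^sub>R chord \<gamma>p \<gamma>m \<theta> 0) (at 0)" by (simp add: chord_def)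
  qed
  ultimately show "\<exists>S. smooth_extension_at_0 (css \<gamma>p \<gamma>m l \<theta> \<rho>m) S \<and> vector_derivative S (at 0) \<noteq> 0"
    using \<Lambda>1' chord0 by (intro exI[of _ ?S]) (simp add: smooth_extension_at_0_def)
qed

text \<open>Here l' = - r \<theta>'', so the two weights N and k are opposite at 0 and the numerator
  tends to a nonzero multiple of the chord, while D tends to 0. To stay affine for t \<noteq> 0, D
  must have an isolated zero; it is simple, since D(0) = D'(0) = 0 would make (l', l'') proportional
  to (\<theta>'', \<theta>''') against \<open>disc\<close>.\<close>

lemma css_degenerate_limit:
  assumes r0: "r \<noteq> 0" and deg: "deriv l 0 + r * (deriv ^^ 2) \<theta> 0 = 0"
  shows "(projective_css \<gamma>p \<gamma>m l \<theta> \<rho>m \<longlongrightarrow> proj_point (chord \<gamma>p \<gamma>m \<theta> 0) 0) (at 0)"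
    and "\<forall>\<^sub>F t in at 0. css_denom l \<theta> \<rho>m t \<noteq> 0"
    and "filterlim (css \<gamma>p \<gamma>m l \<theta> \<rho>m) at_infinity (at 0)"
    and "((\<lambda>t. proj_point (css \<gamma>p \<gamma>m l \<theta> \<rho>m t) 1) \<longlongrightarrow> proj_point (chord \<gamma>p \<gamma>m \<theta> 0) 0) (at 0)"
proof -
  obtain N D k where s: "smooth_germ N 0" "smooth_germ D 0" "smooth_germ k 0"
    and N: "\<forall>\<^sub>F t in nhds 0. b t = t * N t" and D: "\<forall>\<^sub>F t in nhds 0. l t + b t = t * D t"
    and k: "\<forall>\<^sub>F t in nhds 0. l t = t * k t"
    and v: "N 0 = r * (deriv ^^ 2) \<theta> 0" "deriv N 0 = r * (deriv ^^ 3) \<theta> 0 / 2"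
    "D 0 = deriv l 0 + r * (deriv ^^ 2) \<theta> 0" "deriv D 0 = ((deriv ^^ 2) l 0 + r * (deriv ^^ 3) \<theta> 0) / 2"
    "k 0 = deriv l 0"
    by (rule css_quotients)
  have D0: "D 0 = 0" using v(3) deg by simp
  have e: "deriv l 0 = - (r * (deriv ^^ 2) \<theta> 0)" using deg by simp
  have D1: "deriv D 0 \<noteq> 0"
  proof
    assume "deriv D 0 = 0"
    then have "(deriv ^^ 2) l 0 = - (r * (deriv ^^ 3) \<theta> 0)" using v(4) by simp
    then show False using disc e by simp
  qed
  have N0: "N 0 \<noteq> 0" using v(1) e l1 by simp
  obtain D2 where D2: "smooth_germ D2 0" "\<forall>\<^sub>F t in nhds 0. D t = t * D2 t" "D2 0 = deriv D 0"
    by (rule smooth_germ_divide_by_id[OF s(2) D0])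
  have "D2 0 \<noteq> 0" using D1 D2(3) by simp
  note D2n = smooth_germ_eventually_nonzero[OF D2(1) this]
  have ev: "\<forall>\<^sub>F t in at 0. t \<noteq> 0 \<and> D t \<noteq> 0 \<and> b t = t * N t \<and> l t + b t = t * D t \<and> l t = t * k t"
    unfolding eventually_at_filter using D2n D2(2) N D k by eventually_elim simp
  then show den: "\<forall>\<^sub>F t in at 0. css_denom l \<theta> \<rho>m t \<noteq> 0"
    by eventually_elim (metis css_denom_eq mult_eq_0_iff)
  define P where "P = (\<lambda>t. N t *\<^sub>R \<gamma>p t + k t *\<^sub>R \<gamma>m (\<theta> t))"
  have "smooth_germ P 0"
    unfolding P_def by (intro smooth_germ_add smooth_germ_scaleR s \<gamma>p opposite)
  then have limP: "(P \<longlongrightarrow> P 0) (at 0)" using smooth_germ_isCont isCont_def by blast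
  have P0: "P 0 = N 0 *\<^sub>R chord \<gamma>p \<gamma>m \<theta> 0"
    by (simp add: P_def v e chord_def algebra_simps)
  have limD: "(D \<longlongrightarrow> 0) (at 0)" using smooth_germ_isCont[OF s(2)] D0 by (simp add: isCont_def)
  have "((\<lambda>t. abs_rp2 (P t, D t)) \<longlongrightarrow> abs_rp2 (P 0, 0)) (at 0)"
    by (rule tendsto_abs_rp2[OF tendsto_Pair[OF limP limD]]) (simp add: P0 N0 chord0 zero_prod_def)
  moreover have "abs_rp2 (P 0, 0) = proj_point (chord \<gamma>p \<gamma>m \<theta> 0) 0"
    using abs_rp2_scaleR[of "(chord \<gamma>p \<gamma>m \<theta> 0, 0)" "N 0"] N0 chord0
    by (simp add: P0 proj_point_def zero_prod_def)
  ultimately have lim: "((\<lambda>t. abs_rp2 (P t, D t)) \<longlongrightarrow> proj_point (chord \<gamma>p \<gamma>m \<theta> 0) 0) (at 0)" by simp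
  have "\<forall>\<^sub>F t in at 0. abs_rp2 (P t, D t) = projective_css \<gamma>p \<gamma>m l \<theta> \<rho>m t"
    using ev
  proof eventually_elim
    case (elim t)
    then have "(P t, D t) \<noteq> 0" by (simp add: zero_prod_def)
    from elim have lb: "l t + b t = t * D t" and "b t = t * N t" "l t = t * k t" by auto
    then have "b t *\<^sub>R \<gamma>p t + l t *\<^sub>R \<gamma>m (\<theta> t) = t *\<^sub>R P t" by (simp add: P_def scaleR_add_right)
    with lb have "(b t *\<^sub>R \<gamma>p t + l t *\<^sub>R \<gamma>m (\<theta> t), l t + b t) = t *\<^sub>R (P t, D t)" by simp
    with abs_rp2_scaleR[OF \<open>(P t, D t) \<noteq> 0\<close>, of t] elim
    have "abs_rp2 (P t, D t) = abs_rp2 (b t *\<^sub>R \<gamma>p t + l t *\<^sub>R \<gamma>m (\<theta> t), l t + b t)" by metis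
    then show ?case by (simp add: projective_css_def proj_point_def css_denom_eq b_def)
  qed
  with lim show "(projective_css \<gamma>p \<gamma>m l \<theta> \<rho>m \<longlongrightarrow> proj_point (chord \<gamma>p \<gamma>m \<theta> 0) 0) (at 0)"
    by (rule Lim_transform_eventually)
  have css: "\<forall>\<^sub>F t in at 0. css \<gamma>p \<gamma>m l \<theta> \<rho>m t = inverse (D t) *\<^sub>R P t"
    using ev
  proof eventually_elim
    case (elim t)
    \<comment> \<open>Thus \<open>css\<close> is the combination of \<open>\<gamma>p t\<close> and
      \<open>\<gamma>m (\<theta> t)\<close> with weights N / D and k / D.\<close>
    then have tk: "D t = k t + N t" by (metis distrib_left mult_left_cancel)
    have "css_ratio l \<theta> \<rho>m t = (t * N t) / (t * D t)" using elim by (metis css_ratio_eq)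
    then have "css_ratio l \<theta> \<rho>m t = N t / D t" using elim by simp
    then have "D t *\<^sub>R css \<gamma>p \<gamma>m l \<theta> \<rho>m t = P t"
      using elim by (simp add: css_def chord_def P_def scaleR_add_right tk[symmetric])
         (simp add: tk algebra_simps)
    with elim show ?case by (metis inverse_scaleR_times scaleR_one scaleR_scaleR left_inverse)
  qed
  show "filterlim (css \<gamma>p \<gamma>m l \<theta> \<rho>m) at_infinity (at 0)"
  proof (rule filterlim_mono_eventually[OF _ order.refl order.refl])
    show "\<forall>\<^sub>F t in at 0. inverse (D t) *\<^sub>R P t = css \<gamma>p \<gamma>m l \<theta> \<rho>m t"
      using css by eventually_elim simp
    have "filterlim D (at 0) (at 0)"
      using limD ev by (intro filterlim_atI) (auto elim: eventually_mono)
    from filterlim_compose[OF filterlim_inverse_at_infinity this]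
    have "filterlim (\<lambda>t. norm (inverse (D t))) at_top (at 0)"
      by (simp add: filterlim_at_infinity_conv_norm_at_top)
    moreover have "((\<lambda>t. norm (P t)) \<longlongrightarrow> norm (P 0)) (at 0)" by (rule tendsto_norm[OF limP])
    moreover have "0 < norm (P 0)" by (simp add: P0 N0 chord0)
    ultimately have "filterlim (\<lambda>t. norm (P t) * norm (inverse (D t))) at_top (at 0)"
      by (intro filterlim_tendsto_pos_mult_at_top)
    then show "filterlim (\<lambda>t. inverse (D t) *\<^sub>R P t) at_infinity (at 0)"
      by (simp add: filterlim_at_infinity_conv_norm_at_top mult.commute)
  qed
  have "\<forall>\<^sub>F t in at 0. abs_rp2 (P t, D t) = proj_point (css \<gamma>p \<gamma>m l \<theta> \<rho>m t) 1"
    using ev css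
  proof eventually_elim
    case (elim t)
    have "(css \<gamma>p \<gamma>m l \<theta> \<rho>m t, 1::real) \<noteq> 0" by (simp add: zero_prod_def)
    from abs_rp2_scaleR[OF this, of "D t"] elim show ?case by (simp add: proj_point_def)
  qed
  with lim show "((\<lambda>t. proj_point (css \<gamma>p \<gamma>m l \<theta> \<rho>m t) 1) \<longlongrightarrow> proj_point (chord \<gamma>p \<gamma>m \<theta> 0) 0) (at 0)"
    by (rule Lim_transform_eventually)
qed

lemma resonant_radii:
  assumes \<theta>2: "(deriv ^^ 2) \<theta> 0 \<noteq> 0"
  shows "\<exists>!\<rho>0. wigner_exceptional l \<theta> \<rho>0" "\<exists>!\<rho>0. css_degenerate l \<theta> \<rho>0"
    "wigner_resonant_radius l \<theta> = deriv l 0 / (deriv ^^ 2) \<theta> 0"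
    "css_resonant_radius l \<theta> = - (deriv l 0 / (deriv ^^ 2) \<theta> 0)"
    "wigner_resonant_radius l \<theta> = - css_resonant_radius l \<theta>"
proof -
  have w: "wigner_exceptional l \<theta> \<rho> \<longleftrightarrow> \<rho> = deriv l 0 / (deriv ^^ 2) \<theta> 0" for \<rho>
    using \<theta>2 by (auto simp: wigner_exceptional_def field_simps)
  \<comment> \<open>The solution is nonzero because l'(0) \<noteq> 0, as the first clause of
    \<open>css_degenerate\<close> demands.\<close>
  have c: "css_degenerate l \<theta> \<rho> \<longleftrightarrow> \<rho> = - (deriv l 0 / (deriv ^^ 2) \<theta> 0)" for \<rho>
    using \<theta>2 l1 by (auto simp: css_degenerate_def field_simps)
  show "\<exists>!\<rho>0. wigner_exceptional l \<theta> \<rho>0" "\<exists>!\<rho>0. css_degenerate l \<theta> \<rho>0"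
    "wigner_resonant_radius l \<theta> = deriv l 0 / (deriv ^^ 2) \<theta> 0"
    "css_resonant_radius l \<theta> = - (deriv l 0 / (deriv ^^ 2) \<theta> 0)"
    "wigner_resonant_radius l \<theta> = - css_resonant_radius l \<theta>"
    by (simp_all add: w c wigner_resonant_radius_def css_resonant_radius_def)
qed

end

theorem theorem6p2:
  fixes \<gamma>p np \<gamma>m nm :: "real \<Rightarrow> real^2" and l \<theta> \<rho>m :: "real \<Rightarrow> real" and r :: real
  assumes "legendre_data \<gamma>p np l \<theta> 0"
    and "opposite_tangent_angle_param \<gamma>m nm \<rho>m (\<theta> 0)"
    and "r = \<rho>m (\<theta> 0)"
    and "chord \<gamma>p \<gamma>m \<theta> 0 \<noteq> 0"
    and "det (vector [chord \<gamma>p \<gamma>m \<theta> 0, unit_vec (\<theta> 0)] :: real^2^2) \<noteq> 0"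
    and "cusp_5_2 \<gamma>p"
  shows
    "((deriv l 0 - r * (deriv ^^ 2) \<theta> 0 \<noteq> 0 \<longrightarrow> cusp_5_2 (wigner_caustic \<gamma>p \<gamma>m \<theta>)) \<and>
     (deriv l 0 - r * (deriv ^^ 2) \<theta> 0 = 0 \<longrightarrow> cusp_5_3 (wigner_caustic \<gamma>p \<gamma>m \<theta>))) \<and>
     (r \<noteq> 0 \<and> deriv l 0 + r * (deriv ^^ 2) \<theta> 0 \<noteq> 0 \<longrightarrow>
       (\<forall>\<^sub>F t in at 0. css_denom l \<theta> \<rho>m t \<noteq> 0) \<and>
       (\<exists>S. smooth_extension_at_0 (css \<gamma>p \<gamma>m l \<theta> \<rho>m) S \<and> vector_derivative S (at 0) \<noteq> 0) \<and>
       (\<exists>\<Lambda>. smooth_extension_at_0 (css_ratio l \<theta> \<rho>m) \<Lambda> \<and>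
          \<Lambda> 0 = r * (deriv ^^ 2) \<theta> 0 / (deriv l 0 + r * (deriv ^^ 2) \<theta> 0) \<and>
          deriv \<Lambda> 0 =
            r * (deriv l 0 * (deriv ^^ 3) \<theta> 0 - (deriv ^^ 2) l 0 * (deriv ^^ 2) \<theta> 0) /
            (2 * (deriv l 0 + r * (deriv ^^ 2) \<theta> 0) ^ 2) \<and>
          deriv \<Lambda> 0 \<noteq> 0)) \<and>
     (r \<noteq> 0 \<and> deriv l 0 + r * (deriv ^^ 2) \<theta> 0 = 0 \<longrightarrow>
       (projective_css \<gamma>p \<gamma>m l \<theta> \<rho>m \<longlongrightarrow> proj_point (chord \<gamma>p \<gamma>m \<theta> 0) 0) (at 0) \<and>
       (\<forall>\<^sub>F t in at 0. css_denom l \<theta> \<rho>m t \<noteq> 0) \<and>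
       filterlim (css \<gamma>p \<gamma>m l \<theta> \<rho>m) at_infinity (at 0) \<and>
       ((\<lambda>t. proj_point (css \<gamma>p \<gamma>m l \<theta> \<rho>m t) 1) \<longlongrightarrow> proj_point (chord \<gamma>p \<gamma>m \<theta> 0) 0) (at 0)) \<and>
     ((deriv ^^ 2) \<theta> 0 \<noteq> 0 \<longrightarrow>
       (\<exists>!\<rho>0. wigner_exceptional l \<theta> \<rho>0) \<and> (\<exists>!\<rho>0. css_degenerate l \<theta> \<rho>0) \<and>
       wigner_resonant_radius l \<theta> = deriv l 0 / (deriv ^^ 2) \<theta> 0 \<and>
       css_resonant_radius l \<theta> = - (deriv l 0 / (deriv ^^ 2) \<theta> 0) \<and>
       wigner_resonant_radius l \<theta> = - css_resonant_radius l \<theta>)"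
proof -
  have \<gamma>p: "smooth_germ \<gamma>p 0" and l: "smooth_germ l 0" and \<theta>: "smooth_germ \<theta> 0"
    using assms(1) by (auto simp: legendre_data_def cooriented_frontal_def)
  have \<gamma>p': "\<forall>\<^sub>F t in nhds 0. (\<gamma>p has_vector_derivative l t *\<^sub>R unit_vec (\<theta> t)) (at t)"
    using assms(1) by (auto simp: legendre_data_def elim: eventually_mono)
  have \<gamma>m: "smooth_germ \<gamma>m (\<theta> 0)" and \<rho>m: "smooth_germ \<rho>m (\<theta> 0)"
    using assms(2) by (auto simp: opposite_tangent_angle_param_def legendre_data_def cooriented_frontal_def)
  \<comment> \<open>The Legendre angle \<open>u + pi\<close> reverses the unit tangent; this is the
    origin of the minus sign.\<close>
  have \<gamma>m': "\<forall>\<^sub>F u in nhds (\<theta> 0). (\<gamma>m has_vector_derivative (- \<rho>m u) *\<^sub>R unit_vec u) (at u)"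
    using assms(2) unfolding opposite_tangent_angle_param_def legendre_data_def unit_vec_add_pi
    by (auto elim: eventually_mono)
  note cond = frontal_cusp_5_2_conditions[OF \<gamma>p l \<theta> \<gamma>p' assms(6)]
  interpret parallel_pair \<gamma>p \<gamma>m l \<theta> \<rho>m r
    by unfold_locales (fact \<gamma>p l \<theta> \<gamma>p' \<gamma>m \<rho>m \<gamma>m' assms(3,4) cond)+
  show ?thesis
    by (intro conjI impI; (elim conjE)?;
        (rule wigner_cusp_5_2 wigner_cusp_5_3 css_regular css_degenerate_limit resonant_radii; assumption))
qed

end
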